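(* Let $(X,d,\mu)$ be a Cheeger space for the exponent $p=1$, and let $\Gamma_1$ be the $\overline\Gamma$-limit of the localized functionals $E_{1,r_n}(\cdot,\cdot)$ along a sequence $r_n\to0^+$ for which it exists. There exist $C_1,C_2>0$ such that for every $f\in KS^{1,1}(X)$ and every open $U\subset X$ with $\overline U$ compact, $$C_1\|Df\|(U)\le\Gamma_1(f)(U)\le C_2\|Df\|(U).$$ In particular, for every $f\in KS^{1,1}(X)$, the measures $\|Df\|$ and $\Gamma_1(f)$ are equivalent (mutually absolutely continuous) with bounded Radon-Nikodym derivatives.
   Context: Cheeger space for $p=1$: a locally compact, complete metric space $(X,d)$ with a Radon measure $\mu$ such that, writing $B(x,r)=\{y:d(x,y)<r\}$: (VD) there is $C>0$ with $0<\mu(B(x,2r))\le C\mu(B(x,r))<\infty$ for all $x\in X$, $r>0$; (PI) there are $C>0$, $\lambda\ge1$ such that for every Lipschitz $f$ on $X$ and every ball $B(x,R)$, $\int_{B(x,R)}|f-f_{B(x,R)}| d\mu\le CR\int_{B(x,\lambda R)}\mathrm{Lip} f\, d\mu$, where $f_B=\frac1{\mu(B)}\int_B f\,d\mu$ and $(\mathrm{Lip} f)(y)=\limsup_{r\to0^+}\sup_{d(x,y)\le r}\frac{|f(x)-f(y)|}{r}$. Energies: for $r>0$, $f\in L^1(X,\mu)$ and $U\subset X$ open, $E_{1,r}(f,U)=\frac1{r}\int_U\frac1{\mu(B(x,r))}\int_{B(x,r)}|f(y)-f(x)| d\mu(y)d\mu(x)$, and $KS^{1,1}(X)=\{f\in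 L^1(X,\mu):\limsup_{r\to0^+}E_{1,r}(f,X)<\infty\}$ (which coincides with the space $BV(X)$). $U\Subset V$ means $\overline U$ is compact and $\overline U\subset V$; $\mathcal{O}$ is the family of open subsets of $X$. $\overline{\Gamma}$-convergence: $E_n\colon L^1(X,\mu)\times\mathcal{O}\to[-\infty,\infty]$ $\overline\Gamma$-converge to $E$ if (i) $E(f,U)\le\liminf_nE_n(f_n,U)$ for all $U\in\mathcal{O}$ whenever $f_n\to f$ strongly in $L^1$; (ii) for all $f$ and all $U\Subset V$ in $\mathcal{O}$ there is $f_n\to f$ in $L^1$ with $\limsup_nE_n(f_n,U)\le E(f,V)$; and $E$ is inner regular: $E(f,V)=\sup\{E(f,U):U\in\mathcal{O},U\Subset V\}$. Notation: $\Gamma_1(f)(U)=\Gamma_1(f,U)$; for $f\in KS^{1,1}(X)$ this is the restriction to open sets of a finite Radon measure on $X$, also denoted $\Gamma_1(f)$. (The sequence $r_n$ is also taken so that $E_{1,r_n}(\cdot,X)$ $\Gamma$-converges in $L^1(X,\mu)$.) Miranda's BV measure: for $f\in L^1(X,\mu)$ and $U$ open, $\|Df\|(U)=\inf\liminf_{n\to\infty}\int_U\mathrm{Lip} f_n\,d\mu$, the infimum being over sequences of locally Lipschitz functions $f_n$ on $U$ with $f_n\to f$ in $L^1_{loc}(U,\mu)$; for $f\in KS^{1,1}(X)$ it extends to a Radon measure on $X$ by $\|Df\|(A)=\inf\{\|Df\|(U):U\supset A\text{ open}\}$ for Borel $A$ (Miranda's theorem). *)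

theory Defs
  imports "HOL-Analysis.Analysis"
begin

text \<open>Limits are taken in \<^typ>\<open>ennreal\<close>, so that the suprema need not be finite. If \<open>f\<close> is only
  of interest on an open set \<open>U\<close>, its values off \<open>U\<close> do not affect \<open>Lip_const f\<close> on \<open>U\<close>.\<close>

definition Lip_const :: "('a::metric_space \<Rightarrow> real) \<Rightarrow> 'a \<Rightarrow> ennreal" where
  "Lip_const f y = Limsup (at_right 0) (\<lambda>r. SUP x\<in>cball y r. ennreal (\<bar>f x - f y\<bar> / r))"

definition radon_measure :: "'a::metric_space measure \<Rightarrow> bool" where
  "radon_measure M \<longleftrightarrow>
     sets M = sets borel \<and>
     (\<forall>K. compact K \<longrightarrow> emeasure M K < \<infinity>) \<and>
     (\<forall>A\<in>sets borel. emeasure M A = (INF U\<in>{U. open U \<and> A \<subseteq> U}. emeasure M U)) \<and>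
     (\<forall>U. open U \<longrightarrow> emeasure M U = (SUP K\<in>{K. compact K \<and> K \<subseteq> U}. emeasure M K))"

definition volume_doubling :: "'a::metric_space measure \<Rightarrow> bool" where
  "volume_doubling M \<longleftrightarrow>
     (\<exists>C>0. \<forall>x. \<forall>r>0.
        0 < emeasure M (ball x (2 * r)) \<and>
        emeasure M (ball x (2 * r)) \<le> ennreal C * emeasure M (ball x r) \<and>
        ennreal C * emeasure M (ball x r) < \<infinity>)"

definition mean_on :: "'a measure \<Rightarrow> 'a set \<Rightarrow> ('a \<Rightarrow> real) \<Rightarrow> real" where
  "mean_on M B f = (1 / measure M B) * (LINT y:B|M. f y)"

definition poincare_1 :: "'a::metric_space measure \<Rightarrow> bool" where
  "poincare_1 M \<longleftrightarrow>
     (\<exists>C>0. \<exists>\<kappa>\<ge>1. \<forall>f. (\<exists>L. L-lipschitz_on UNIV f) \<longrightarrow>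
        (\<forall>x. \<forall>R>0.
           (\<integral>\<^sup>+y\<in>ball x R. ennreal \<bar>f y - mean_on M (ball x R) f\<bar> \<partial>M)
           \<le> ennreal (C * R) * (\<integral>\<^sup>+y\<in>ball x (\<kappa> * R). Lip_const f y \<partial>M)))"

text \<open>Completeness of the space is the type class constraint.\<close>

definition cheeger_space_1 :: "'a::complete_space measure \<Rightarrow> bool" where
  "cheeger_space_1 M \<longleftrightarrow>
     locally compact (UNIV :: 'a set) \<and> radon_measure M \<and> volume_doubling M \<and> poincare_1 M"

definition energy_1 :: "'a::metric_space measure \<Rightarrow> real \<Rightarrow> ('a \<Rightarrow> real) \<Rightarrow> 'a set \<Rightarrow> ennreal" where
  "energy_1 M r f U =
     ennreal (1 / r) *
     (\<integral>\<^sup>+x\<in>U. (1 / emeasure M (ball x r)) *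
        (\<integral>\<^sup>+y\<in>ball x r. ennreal \<bar>f y - f x\<bar> \<partial>M) \<partial>M)"

definition KS_1_1 :: "'a::metric_space measure \<Rightarrow> ('a \<Rightarrow> real) set" where
  "KS_1_1 M = {f. integrable M f \<and> Limsup (at_right 0) (\<lambda>r. energy_1 M r f UNIV) < \<infinity>}"

definition compactly_in :: "'a::topological_space set \<Rightarrow> 'a set \<Rightarrow> bool" where
  "compactly_in U V \<longleftrightarrow> compact (closure U) \<and> closure U \<subseteq> V"

definition L1_converges :: "'a measure \<Rightarrow> (nat \<Rightarrow> 'a \<Rightarrow> real) \<Rightarrow> ('a \<Rightarrow> real) \<Rightarrow> bool" where
  "L1_converges M fn f \<longleftrightarrow>
     (\<forall>n. integrable M (fn n)) \<and> integrable M f \<and>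
     (\<lambda>n. \<integral>x. \<bar>fn n x - f x\<bar> \<partial>M) \<longlonglongrightarrow> 0"

definition Gamma_converges ::
  "'a measure \<Rightarrow> (nat \<Rightarrow> ('a \<Rightarrow> real) \<Rightarrow> ereal) \<Rightarrow> (('a \<Rightarrow> real) \<Rightarrow> ereal) \<Rightarrow> bool" where
  "Gamma_converges M Fn F \<longleftrightarrow>
     (\<forall>f fn. L1_converges M fn f \<longrightarrow> F f \<le> liminf (\<lambda>n. Fn n (fn n))) \<and>
     (\<forall>f. integrable M f \<longrightarrow>
        (\<exists>fn. L1_converges M fn f \<and> limsup (\<lambda>n. Fn n (fn n)) \<le> F f))"

text \<open>Functionals on \<open>L\<^sup>1\<close> are given on integrable representatives. The three conditions force the
  limit to take equal values on functions that agree almost everywhere.\<close>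

definition Gamma_bar_converges ::
  "'a::topological_space measure \<Rightarrow> (nat \<Rightarrow> ('a \<Rightarrow> real) \<Rightarrow> 'a set \<Rightarrow> ereal)
     \<Rightarrow> (('a \<Rightarrow> real) \<Rightarrow> 'a set \<Rightarrow> ereal) \<Rightarrow> bool" where
  "Gamma_bar_converges M En E \<longleftrightarrow>
     (\<forall>f fn U. open U \<longrightarrow> L1_converges M fn f \<longrightarrow> E f U \<le> liminf (\<lambda>n. En n (fn n) U)) \<and>
     (\<forall>f U V. integrable M f \<longrightarrow> open U \<longrightarrow> open V \<longrightarrow> compactly_in U V \<longrightarrow>
        (\<exists>fn. L1_converges M fn f \<and> limsup (\<lambda>n. En n (fn n) U) \<le> E f V)) \<and>
     (\<forall>f V. integrable M f \<longrightarrow> open V \<longrightarrow>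
        E f V = (SUP U\<in>{U. open U \<and> compactly_in U V}. E f U))"

definition locally_lipschitz_on :: "'a::metric_space set \<Rightarrow> ('a \<Rightarrow> real) \<Rightarrow> bool" where
  "locally_lipschitz_on U g \<longleftrightarrow> (\<forall>x\<in>U. \<exists>e>0. \<exists>L. L-lipschitz_on (ball x e \<inter> U) g)"

definition L1_loc_converges ::
  "'a::topological_space measure \<Rightarrow> 'a set \<Rightarrow> (nat \<Rightarrow> 'a \<Rightarrow> real) \<Rightarrow> ('a \<Rightarrow> real) \<Rightarrow> bool" where
  "L1_loc_converges M U fn f \<longleftrightarrow>
     (\<forall>K. compact K \<and> K \<subseteq> U \<longrightarrow>
        (\<lambda>n. \<integral>\<^sup>+x\<in>K. ennreal \<bar>fn n x - f x\<bar> \<partial>M) \<longlonglongrightarrow> 0)"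

definition total_variation :: "'a::metric_space measure \<Rightarrow> ('a \<Rightarrow> real) \<Rightarrow> 'a set \<Rightarrow> ennreal" where
  "total_variation M f U =
     Inf {liminf (\<lambda>n. \<integral>\<^sup>+x\<in>U. Lip_const (fn n) x \<partial>M) | fn.
            (\<forall>n. locally_lipschitz_on U (fn n)) \<and> L1_loc_converges M U fn f}"

text \<open>The constant \<^const>\<open>measure_of\<close> returns the null measure when the set function it is given is
  not countably additive. That the outer extension is a measure agreeing with the given set function
  on open sets is therefore a separate claim, expressed by \<open>is_radon_extension\<close>.\<close>

definition outer_extension :: "('a::topological_space set \<Rightarrow> ennreal) \<Rightarrow> 'a measure" where
  "outer_extension F =
     measure_of UNIV (sets borel) (\<lambda>A. INF U\<in>{U. open U \<and> A \<subseteq> U}. F U)"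

definition variation_measure :: "'a::metric_space measure \<Rightarrow> ('a \<Rightarrow> real) \<Rightarrow> 'a measure" where
  "variation_measure M f = outer_extension (total_variation M f)"

definition Gamma_measure ::
  "(('a::topological_space \<Rightarrow> real) \<Rightarrow> 'a set \<Rightarrow> ereal) \<Rightarrow> ('a \<Rightarrow> real) \<Rightarrow> 'a measure" where
  "Gamma_measure \<Gamma> f = outer_extension (\<lambda>U. e2ennreal (\<Gamma> f U))"

definition is_radon_extension :: "'a::metric_space measure \<Rightarrow> ('a set \<Rightarrow> ereal) \<Rightarrow> bool" where
  "is_radon_extension N F \<longleftrightarrow>
     radon_measure N \<and> (\<forall>U. open U \<longrightarrow> enn2ereal (emeasure N U) = F U)"

definition bounded_RN_deriv :: "'a measure \<Rightarrow> 'a measure \<Rightarrow> bool" where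
  "bounded_RN_deriv M N \<longleftrightarrow> (\<exists>K::real. AE x in M. RN_deriv M N x \<le> ennreal K)"

end

theory Submission
  imports Defs
begin

text \<open>The energies and the total variation are compared by two constructions. Averaging \<open>f\<^sub>n\<close> against
  a Lipschitz kernel at the scale \<open>r\<^sub>n\<close> gives locally Lipschitz functions whose Lipschitz constant is at
  most a multiple of \<open>1 / r\<^sub>n\<close> times the mean oscillation of \<open>f\<^sub>n\<close>, hence
  \<open>\<parallel>Df\<parallel>(U) \<le> C \<Gamma>\<^sub>1(f)(U)\<close>. Conversely the Poincare inequality bounds
  \<open>E\<^sub>1\<^sub>,\<^sub>r(u, W)\<close> by \<open>C \<integral>\<^bsub>U\<^esub> Lip u\<close> for small \<open>r\<close> when \<open>W\<close> is compactly contained in \<open>U\<close>; this passes to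
  \<open>f\<close> by approximation at fixed \<open>r\<close>, and the constant sequence \<open>f\<close> then bounds \<open>\<Gamma>\<^sub>1\<close>. That both set
  functions are restrictions of measures follows from the De Giorgi--Letta criterion, whose
  hypotheses come from gluing approximating sequences with Lipschitz cutoffs.\<close>

section \<open>Measures from set functions on open sets\<close>

text \<open>Recovery sequences bound the energy on \<open>U\<close> only when \<open>U\<close> is
  compactly contained in the set on which the limit is evaluated. Most arguments therefore lose a
  little domain, and inner regularity has to give it back. For \<open>\<Gamma>\<^sub>1\<close> it is
  part of the convergence; for the total variation it must be proved, and this is the longest step:
  competitors approximate \<open>f\<close> only on compact sets, so infinitely many of them are
  glued along an exhaustion. A second obstacle is that the Poincare inequality speaks of globally
  Lipschitz functions, whereas competitors are locally Lipschitz on \<open>U\<close>; a McShane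
  extension from a compact set closes the gap. Doubling and completeness make closed balls compact
  and the space separable, which supplies the exhaustions and the measurability of
  \<open>dist\<close> on the product. Both constants depend only on the doubling and Poincare data.
  The bounds are proved on all open sets, so outer regularity turns them into a comparison of
  measures, with densities bounded by the same constants. Finite total mass comes from the constant
  sequence \<open>f\<close> and the definition of \<open>KS_1_1\<close>.\<close>

text \<open>The De Giorgi--Letta criterion: inner regularity turns countable covers of open sets into
  finite ones, and together with superadditivity it makes open sets Caratheodory measurable.\<close>

locale open_set_function =
  fixes a :: "'a::metric_space set \<Rightarrow> ennreal"
  assumes empty: "a {} = 0"
    and mono: "open U \<Longrightarrow> open V \<Longrightarrow> U \<subseteq> V \<Longrightarrow> a U \<le> a V"
    and subadd: "open U \<Longrightarrow> open V \<Longrightarrow> a (U \<union> V) \<le> a U + a V"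
    and superadd: "open U \<Longrightarrow> open V \<Longrightarrow> U \<inter> V = {} \<Longrightarrow> a U + a V \<le> a (U \<union> V)"
    and inner_regular: "open U \<Longrightarrow> a U \<le> (SUP W\<in>{W. open W \<and> compactly_in W U}. a W)"
    and finite: "a UNIV < \<infinity>"
begin

definition ext :: "'a set \<Rightarrow> ennreal" where
  "ext A = (INF U\<in>{U. open U \<and> A \<subseteq> U}. a U)"

lemma ext_open: "open U \<Longrightarrow> ext U = a U"
  unfolding ext_def by (intro antisym INF_lower INF_greatest) (auto intro: mono)

lemma ext_mono: "A \<subseteq> B \<Longrightarrow> ext A \<le> ext B"
  unfolding ext_def by (intro INF_superset_mono) auto

lemma ext_le: "open U \<Longrightarrow> A \<subseteq> U \<Longrightarrow> ext A \<le> a U"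
  unfolding ext_def by (intro INF_lower) auto

lemma finite_subadd:
  assumes "finite I" "\<And>i. i \<in> I \<Longrightarrow> open (U i)"
  shows "a (\<Union>i\<in>I. U i) \<le> (\<Sum>i\<in>I. a (U i))"
  using assms
proof (induction I rule: finite_induct)
  case (insert j I)
  have "a (\<Union>i\<in>insert j I. U i) \<le> a (U j) + a (\<Union>i\<in>I. U i)"
    using subadd[of "U j" "\<Union>i\<in>I. U i"] insert.prems by auto
  also have "\<dots> \<le> a (U j) + (\<Sum>i\<in>I. a (U i))"
    using insert by (intro add_left_mono) auto
  finally show ?case using insert by simp
qed (simp add: empty)

lemma countable_subadd_open:
  fixes U :: "nat \<Rightarrow> 'a set"
  assumes op: "\<And>i. open (U i)"
  shows "a (\<Union>i. U i) \<le> (\<Sum>i. a (U i))"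
proof -
  have "a W \<le> (\<Sum>i. a (U i))" if W: "open W" "compactly_in W (\<Union>i. U i)" for W
  proof -
    obtain I where I: "finite I" "closure W \<subseteq> (\<Union>i\<in>I. U i)"
      using W op compactE_image[of "closure W" UNIV U] unfolding compactly_in_def by auto
    have "a W \<le> a (\<Union>i\<in>I. U i)"
      using I W op closure_subset[of W] by (intro mono) auto
    also have "\<dots> \<le> (\<Sum>i\<in>I. a (U i))" by (intro finite_subadd I op)
    also have "\<dots> \<le> (\<Sum>i. a (U i))" by (intro sum_le_suminf I) auto
    finally show ?thesis .
  qed
  then have "(SUP W\<in>{W. open W \<and> compactly_in W (\<Union>i. U i)}. a W) \<le> (\<Sum>i. a (U i))"
    by (intro SUP_least) auto
  moreover have "open (\<Union>i. U i)" using op by auto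
  ultimately show ?thesis using inner_regular by (meson order_trans)
qed

lemma ext_lt_open:
  assumes "ext A < \<infinity>" "e > 0"
  obtains U where "open U" "A \<subseteq> U" "a U \<le> ext A + e"
proof -
  have "ext A + 0 < ext A + e" using assms by (subst ennreal_add_left_cancel_less) auto
  then have "ext A < ext A + e" by simp
  then show ?thesis using that unfolding ext_def INF_less_iff
    by (auto intro: less_imp_le)
qed

lemma ext_countable_subadd:
  fixes A :: "nat \<Rightarrow> 'a set"
  shows "ext (\<Union>i. A i) \<le> (\<Sum>i. ext (A i))"
proof (rule ennreal_le_epsilon)
  fix e :: real assume e: "0 < e"
  assume fin: "(\<Sum>i. ext (A i)) < top"
  have fi: "ext (A i) < \<infinity>" for i
    using ext_le[of UNIV "A i"] finite by auto
  have "\<exists>U. open U \<and> A i \<subseteq> U \<and> a U \<le> ext (A i) + ennreal (e * (1/2)^Suc i)" for i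
    using ext_lt_open[OF fi, of "ennreal (e * (1/2)^Suc i)" i] e
    by (metis ennreal_less_zero_iff mult_pos_pos zero_less_power half_gt_zero_iff zero_less_one)
  then obtain U where U: "\<And>i. open (U i)" "\<And>i. A i \<subseteq> U i"
     "\<And>i. a (U i) \<le> ext (A i) + ennreal (e * (1/2)^Suc i)" by metis
  have "ext (\<Union>i. A i) \<le> a (\<Union>i. U i)" using U by (intro ext_le) auto
  also have "\<dots> \<le> (\<Sum>i. a (U i))" by (intro countable_subadd_open U)
  also have "\<dots> \<le> (\<Sum>i. ext (A i) + ennreal (e * (1/2)^Suc i))"
    by (intro suminf_le U) auto
  also have "\<dots> = (\<Sum>i. ext (A i)) + (\<Sum>i. ennreal (e * (1/2)^Suc i))"
    by (intro suminf_add[symmetric]) auto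
  also have "(\<Sum>i. ennreal (e * (1/2)^Suc i)) = ennreal (e * 1)"
    using e by (intro suminf_ennreal_eq sums_mult power_half_series) auto
  finally show "ext (\<Union>i. A i) \<le> (\<Sum>i. ext (A i)) + ennreal e" by simp
qed

lemma ext_empty: "ext {} = 0"
  using ext_open[of "{}"] by (simp add: empty)

lemma outer_measure_ext: "outer_measure_space UNIV ext"
  unfolding outer_measure_space_def positive_def increasing_def countably_subadditive_def
  using ext_mono ext_countable_subadd ext_empty by auto

text \<open>A test set \<open>U\<close> is split by a \<open>W\<close> compactly contained in
  \<open>U \<inter> V\<close>: \<open>W\<close> and \<open>U - closure W\<close> are disjoint open
  subsets of \<open>U\<close>, and the second one covers \<open>A - V\<close>. Superadditivity
  applies to this pair, and letting \<open>W\<close> exhaust \<open>U \<inter> V\<close> gives the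
  bound.\<close>

lemma ext_split_open:
  assumes V: "open V"
  shows "ext (A \<inter> V) + ext (A - V) \<le> ext A"
proof -
  have "ext (A \<inter> V) + ext (A - V) \<le> a U" if U: "open U" "A \<subseteq> U" for U
  proof -
    have *: "a W + ext (A - V) \<le> a U" if W: "open W" "compactly_in W (U \<inter> V)" for W
    proof -
      have WU: "closure W \<subseteq> U \<inter> V" using W by (auto simp: compactly_in_def)
      have "a W + ext (A - V) \<le> a W + a (U - closure W)"
        using U WU by (intro add_left_mono ext_le open_Diff) auto
      also have "\<dots> \<le> a (W \<union> (U - closure W))"
        using U W closure_subset[of W] by (intro superadd open_Diff) auto
      also have "\<dots> \<le> a U" using U W WU closure_subset[of W]
        by (intro mono open_Un open_Diff) auto
      finally show ?thesis .
    qed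
    have "ext (A \<inter> V) + ext (A - V) \<le> a (U \<inter> V) + ext (A - V)"
      using U V by (intro add_right_mono ext_le) auto
    also have "\<dots> \<le> (SUP W\<in>{W. open W \<and> compactly_in W (U \<inter> V)}. a W) + ext (A - V)"
      using U V by (intro add_right_mono inner_regular) auto
    \<comment> \<open>The empty set is compactly contained in every set, so the supremum ranges over
      a nonempty family and the summand may be moved inside.\<close>
    also have "\<dots> = (SUP W\<in>{W. open W \<and> compactly_in W (U \<inter> V)}. a W + ext (A - V))"
      by (intro ennreal_SUP_add_left[symmetric]) (auto intro!: exI[of _ "{}"] simp: compactly_in_def)
    also have "\<dots> \<le> a U" using * by (intro SUP_least) auto
    finally show ?thesis .
  qed
  then show ?thesis unfolding ext_def[of A] by (intro INF_greatest) auto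
qed

lemma open_in_lambda_system: "open V \<Longrightarrow> V \<in> lambda_system UNIV UNIV ext"
  unfolding algebra.lambda_system_eq[OF algebra_Pow[of UNIV, simplified]]
proof safe
  fix A assume V: "open V"
  have 1: "ext (A \<inter> V) + ext (A - V) \<le> ext A" by (rule ext_split_open[OF V])
  interpret sigma_algebra "UNIV :: 'a set" UNIV using sigma_algebra_Pow[of UNIV] by simp
  have "subadditive UNIV ext"
    using outer_measure_ext unfolding outer_measure_space_def
    by (intro countably_subadditive_subadditive) auto
  then have "ext ((V \<inter> A) \<union> (- V \<inter> A)) \<le> ext (V \<inter> A) + ext (- V \<inter> A)"
    by (rule subadditiveD) auto
  moreover have "(V \<inter> A) \<union> (- V \<inter> A) = A" by auto
  ultimately show "ext (A \<inter> V) + ext (A - V) = ext A"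
    using 1 by (simp add: Int_commute Diff_eq)
qed simp

text \<open>Caratheodory's measurable sets form a sigma-algebra that contains the open sets, so
  \<open>ext\<close> is countably additive on the Borel sets. Hence \<open>measure_of\<close> does
  not fall back to the null measure, and its values are those of \<open>ext\<close>.\<close>

lemma emeasure_outer_extension: "A \<in> sets borel \<Longrightarrow> emeasure (outer_extension a) A = ext A"
proof -
  interpret sigma_algebra "UNIV :: 'a set" UNIV using sigma_algebra_Pow[of UNIV] by simp
  have ms: "measure_space UNIV (lambda_system UNIV UNIV ext) ext"
    by (rule caratheodory_lemma[OF outer_measure_ext])
  then interpret L: sigma_algebra UNIV "lambda_system UNIV UNIV ext" by (simp add: measure_space_def)
  have sub: "sets borel \<subseteq> lambda_system UNIV UNIV ext"
    unfolding borel_def using L.sigma_sets_subset[of "Collect open"] open_in_lambda_system by auto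
  have "emeasure (measure_of UNIV (sets borel) ext) A = ext A" if "A \<in> sets borel"
  proof (rule emeasure_measure_of_sigma)
    show "sigma_algebra UNIV (sets (borel :: 'a measure))" 
      using sets.sigma_algebra_axioms[of borel] by simp
    show "positive (sets borel) ext" by (simp add: positive_def ext_empty)
    show "countably_additive (sets borel) ext"
      using ms sub unfolding measure_space_def countably_additive_def by blast
  qed fact
  then show "A \<in> sets borel \<Longrightarrow> emeasure (outer_extension a) A = ext A"
    unfolding outer_extension_def ext_def[abs_def] by simp
qed

lemma sets_outer_extension: "sets (outer_extension a) = sets borel"
  unfolding outer_extension_def
  by (subst sets_measure_of) (auto simp: sets.sigma_sets_eq[of borel, simplified])

lemma emeasure_outer_extension_open: "open U \<Longrightarrow> emeasure (outer_extension a) U = a U"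
  by (simp add: emeasure_outer_extension ext_open)

lemma finite_outer_extension: "finite_measure (outer_extension a)"
proof
  have "space (outer_extension a) = UNIV" by (simp add: outer_extension_def)
  then show "emeasure (outer_extension a) (space (outer_extension a)) \<noteq> \<infinity>"
    using finite emeasure_outer_extension_open[of UNIV] by auto
qed

lemma radon_outer_extension: "radon_measure (outer_extension a)"
proof -
  let ?N = "outer_extension a"
  have "emeasure ?N K < \<infinity>" for K
    using finite_measure.emeasure_finite[OF finite_outer_extension, of K] by (simp add: less_top)
  moreover have "emeasure ?N A = (INF U\<in>{U. open U \<and> A \<subseteq> U}. emeasure ?N U)" if "A \<in> sets borel" for A
    using that by (simp add: emeasure_outer_extension ext_def emeasure_outer_extension_open cong: INF_cong_simp)
      (intro INF_cong, auto simp: emeasure_outer_extension_open emeasure_outer_extension ext_open ext_def[symmetric])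
  moreover have "emeasure ?N U = (SUP K\<in>{K. compact K \<and> K \<subseteq> U}. emeasure ?N K)" if U: "open U" for U
  proof (rule antisym)
    \<comment> \<open>Inner regularity by open sets becomes inner regularity by compact sets:
      \<open>closure W\<close> is compact, lies in \<open>U\<close> and has at least the measure of
      \<open>W\<close>.\<close>
    have "emeasure ?N W \<le> (SUP K\<in>{K. compact K \<and> K \<subseteq> U}. emeasure ?N K)"
      if "open W" "compactly_in W U" for W
      using that closure_subset[of W]
      by (intro SUP_upper2[of "closure W"] emeasure_mono)
         (auto simp: compactly_in_def sets_outer_extension)
    then show "emeasure ?N U \<le> (SUP K\<in>{K. compact K \<and> K \<subseteq> U}. emeasure ?N K)"
      using order_trans[OF inner_regular[OF U]] U
      by (auto simp: emeasure_outer_extension_open intro!: SUP_least)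
    show "(SUP K\<in>{K. compact K \<and> K \<subseteq> U}. emeasure ?N K) \<le> emeasure ?N U"
      using U by (intro SUP_least emeasure_mono) (auto simp: sets_outer_extension)
  qed
  ultimately show ?thesis
    unfolding radon_measure_def using sets_outer_extension by auto
qed

end

section \<open>Domination of measures and bounded densities\<close>

text \<open>Both outer extensions are infima over the same open supersets, so a near-optimal
  superset for \<open>b\<close> also bounds the infimum for \<open>a\<close>.\<close>

lemma outer_extension_le:
  assumes a: "open_set_function a" and b: "open_set_function b"
    and le: "\<And>U. open U \<Longrightarrow> a U \<le> ennreal K * b U" and A: "A \<in> sets borel"
  shows "emeasure (outer_extension a) A \<le> ennreal K * emeasure (outer_extension b) A"
proof -
  interpret a: open_set_function a by fact
  interpret b: open_set_function b by fact
  have "a.ext A \<le> ennreal K * b.ext A"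
  proof (rule ennreal_le_epsilon)
    fix e :: real assume e: "0 < e"
    \<comment> \<open>Division by \<open>\<bar>K\<bar> + 1\<close> gives
      \<open>K * e' \<le> e\<close> for every real \<open>K\<close>, zero and negative values
      included.\<close>
    define e' where "e' = e / (\<bar>K\<bar> + 1)"
    have e': "0 < e'" "K * e' \<le> e"
    proof -
      show "0 < e'" using e by (simp add: e'_def)
      have "K * e \<le> (\<bar>K\<bar> + 1) * e" using e by (intro mult_right_mono) auto
      then show "K * e' \<le> e" by (simp add: e'_def field_simps)
    qed
    have "b.ext A < \<infinity>" using b.ext_le[of UNIV A] b.finite by auto
    then obtain U where U: "open U" "A \<subseteq> U" "b U \<le> b.ext A + ennreal e'"
      using b.ext_lt_open[of A "ennreal e'"] e' by auto
    have "a.ext A \<le> ennreal K * b U" using a.ext_le[OF U(1,2)] le[OF U(1)] by (rule order_trans)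
    also have "\<dots> \<le> ennreal K * (b.ext A + ennreal e')" by (intro mult_left_mono U) auto
    also have "\<dots> = ennreal K * b.ext A + ennreal K * ennreal e'" by (simp add: distrib_left)
    also have "ennreal K * ennreal e' \<le> ennreal e"
      using e' by (cases "K \<ge> 0") (auto simp: ennreal_mult[symmetric] ennreal_neg intro!: ennreal_leI)
    finally show "a.ext A \<le> ennreal K * b.ext A + ennreal e" by (simp add: add_left_mono)
  qed
  then show ?thesis using A by (simp add: a.emeasure_outer_extension b.emeasure_outer_extension)
qed

text \<open>On the set where the density exceeds \<open>K\<close>, the measure \<open>N\<close> is
  at most \<open>K\<close> times \<open>M\<close>, so the integral of the excess over this set
  vanishes. Finiteness of \<open>M\<close> is what allows the common term to be cancelled.\<close>

lemma bounded_RN_derivI: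
  assumes fin: "finite_measure M" and finN: "finite_measure N" and sets: "sets N = sets M"
    and le: "\<And>A. A \<in> sets M \<Longrightarrow> emeasure N A \<le> ennreal K * emeasure M A"
  shows "absolutely_continuous M N" "bounded_RN_deriv M N"
proof -
  interpret finite_measure M by fact
  show ac: "absolutely_continuous M N"
    unfolding absolutely_continuous_def
  proof
    fix A assume "A \<in> null_sets M"
    then show "A \<in> null_sets N" using le[of A] sets by (auto simp: null_sets_def)
  qed
  let ?f = "RN_deriv M N"
  let ?A = "{x\<in>space M. ennreal K < ?f x}"
  have A[measurable]: "?A \<in> sets M" by measurable
  have "(\<integral>\<^sup>+x. (?f x - ennreal K) * indicator ?A x \<partial>M) + (\<integral>\<^sup>+x. ennreal K * indicator ?A x \<partial>M)
      = (\<integral>\<^sup>+x. ?f x * indicator ?A x \<partial>M)"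
    by (subst nn_integral_add[symmetric])
       (auto intro!: nn_integral_cong simp: indicator_def diff_add_cancel_ennreal less_imp_le)
  also have "\<dots> = emeasure N ?A"
    using density_RN_deriv[OF ac sets] by (metis A borel_measurable_RN_deriv emeasure_density)
  also have "\<dots> \<le> ennreal K * emeasure M ?A" by (rule le[OF A])
  also have "\<dots> = (\<integral>\<^sup>+x. ennreal K * indicator ?A x \<partial>M)"
    by (rule nn_integral_cmult_indicator[symmetric, OF A])
  finally have "(\<integral>\<^sup>+x. (?f x - ennreal K) * indicator ?A x \<partial>M) + (\<integral>\<^sup>+x. ennreal K * indicator ?A x \<partial>M)
      \<le> 0 + (\<integral>\<^sup>+x. ennreal K * indicator ?A x \<partial>M)" by simp
  moreover have "(\<integral>\<^sup>+x. ennreal K * indicator ?A x \<partial>M) < \<infinity>"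
    by (simp only: nn_integral_cmult_indicator[OF A])
       (simp add: ennreal_mult_eq_top_iff emeasure_finite less_top[symmetric])
  ultimately have "(\<integral>\<^sup>+x. (?f x - ennreal K) * indicator ?A x \<partial>M) = 0"
    by (metis (no_types, lifting) ennreal_add_left_cancel_le add.commute infinity_ennreal_def le_zero_eq less_irrefl)
  then have "AE x in M. (?f x - ennreal K) * indicator ?A x = 0"
    by (subst (asm) nn_integral_0_iff_AE) auto
  then have "AE x in M. ?f x \<le> ennreal K"
    using AE_space by eventually_elim
       (auto simp: indicator_def diff_eq_0_iff_ennreal not_less split: if_splits)
  then show "bounded_RN_deriv M N" unfolding bounded_RN_deriv_def by blast
qed

section \<open>Doubling spaces\<close>

text \<open>The distance to the complement of \<open>V\<close> attains a positive minimum on the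
  compact set, and half of it serves as \<open>e\<close>.\<close>

lemma infdist_neighbourhood:
  fixes K V :: "'a::metric_space set"
  assumes "K \<noteq> {}" "compact K" "open V" "K \<subseteq> V"
  obtains e where "e > 0" "{x. infdist x K \<le> e} \<subseteq> V"
proof -
  obtain d where d: "d > 0" "\<And>x y. x \<in> K \<Longrightarrow> y \<in> - V \<Longrightarrow> d \<le> dist x y"
  \<comment> \<open>\<open>infdist\<close> to the empty set is 0 by convention, so the case without
    complement is treated apart; there any positive \<open>d\<close> works.\<close>
  proof (cases "V = UNIV")
    case False
    have "continuous_on K (\<lambda>x. infdist x (- V))" by (intro continuous_intros)
    then obtain z where z: "z \<in> K" "\<And>x. x \<in> K \<Longrightarrow> infdist z (- V) \<le> infdist x (- V)"
      using continuous_attains_inf[OF assms(2,1)] by blast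
    have "0 < infdist z (- V)"
      using infdist_pos_not_in_closed[of "- V" z] assms False z(1) by auto
    show ?thesis
    proof (rule that[of "infdist z (- V)"])
      show "0 < infdist z (- V)" by fact
      fix x y assume "x \<in> K" "y \<in> - V"
      then show "infdist z (- V) \<le> dist x y" using z(2)[of x] infdist_le[of y "- V" x] by simp
    qed
  qed (use that[of 1] in auto)
  have "{x. infdist x K \<le> d / 2} \<subseteq> V"
  proof safe
    fix x assume "infdist x K \<le> d / 2"
    then have "infdist x K < d" using d by simp
    then obtain y where "y \<in> K" "dist x y < d"
      using assms(1) by (auto simp: infdist_notempty cINF_less_iff)
    then show "x \<in> V" using d(2)[of y x] by (force simp: dist_commute)
  qed
  then show ?thesis using that[of "d / 2"] d by auto
qed

section \<open>Lipschitz cutoffs\<close>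

text \<open>The open set \<open>P\<close> and the closed set \<open>F\<close> are recorded along
  with \<open>\<phi>\<close> so that a function glued with \<open>\<phi>\<close> coincides with one
  of its two pieces on the open sets \<open>P\<close> and \<open>- F\<close>; there its pointwise
  Lipschitz constant is that of this piece alone.\<close>

definition cutoff :: "'a::metric_space set \<Rightarrow> 'a set \<Rightarrow> ('a \<Rightarrow> real) \<Rightarrow> real \<Rightarrow> 'a set \<Rightarrow> 'a set \<Rightarrow> bool" where
  "cutoff K V \<phi> L P F \<longleftrightarrow> L-lipschitz_on UNIV \<phi> \<and> (\<forall>x. 0 \<le> \<phi> x) \<and> (\<forall>x. \<phi> x \<le> 1) \<and>
     open P \<and> K \<subseteq> P \<and> (\<forall>x\<in>P. \<phi> x = 1) \<and> closed F \<and> F \<subseteq> V \<and> (\<forall>x. x \<notin> F \<longrightarrow> \<phi> x = 0)"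

lemma cutoffD:
  assumes "cutoff K V \<phi> L P F"
  shows "L-lipschitz_on UNIV \<phi>" "0 \<le> \<phi> x" "\<phi> x \<le> 1" "open P" "K \<subseteq> P" "x \<in> P \<Longrightarrow> \<phi> x = 1"
    "closed F" "F \<subseteq> V" "x \<notin> F \<Longrightarrow> \<phi> x = 0" "0 \<le> L" "P \<subseteq> F"
  using assms unfolding cutoff_def by (auto intro: lipschitz_on_nonneg)

lemma cutoff_exists:
  fixes K V :: "'a::metric_space set"
  assumes K: "compact K" and V: "open V" "K \<subseteq> V"
  shows "\<exists>\<phi> L P F. cutoff K V \<phi> L P F"
proof (cases "K = {}")
  case True
  show ?thesis
    by (intro exI[of _ 0] exI[of _ "\<lambda>_. 0"] exI[of _ "{}"]) (use True in \<open>auto simp: cutoff_def intro!: lipschitz_onI\<close>)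
next
  case False
  then obtain e where e: "e > 0" "{x. infdist x K \<le> e} \<subseteq> V"
    using infdist_neighbourhood[OF False K V] by auto
  \<comment> \<open>A piecewise linear profile in the distance to \<open>K\<close>: 1 up to
    \<open>e / 3\<close>, 0 from \<open>2 * e / 3\<close> on, slope \<open>3 / e\<close> in
    between.\<close>
  define \<phi> where "\<phi> x = min 1 (max 0 (2 - 3 / e * infdist x K))" for x
  have "cutoff K V \<phi> (3 / e) {x. infdist x K < e / 3} {x. infdist x K \<le> 2 * e / 3}"
    unfolding cutoff_def
  proof (intro conjI allI ballI impI)
    show "(3 / e)-lipschitz_on UNIV \<phi>"
    proof (rule lipschitz_onI)
      fix x y :: 'a
      have "\<bar>\<phi> x - \<phi> y\<bar> \<le> \<bar>3 / e * infdist x K - 3 / e * infdist y K\<bar>"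
        unfolding \<phi>_def by linarith
      also have "\<dots> = 3 / e * \<bar>infdist x K - infdist y K\<bar>"
        using e by (subst right_diff_distrib[symmetric], subst abs_mult) simp
      also have "\<dots> \<le> 3 / e * dist x y"
        using e infdist_triangle_abs[of x K y] by (intro mult_left_mono) auto
      finally show "dist (\<phi> x) (\<phi> y) \<le> 3 / e * dist x y" by (simp add: dist_real_def)
    qed (use e in auto)
    show "open {x. infdist x K < e / 3}"
      by (intro open_Collect_less continuous_intros)
    show "closed {x. infdist x K \<le> 2 * e / 3}"
      by (intro closed_Collect_le continuous_intros)
    show "\<phi> x = 1" if "x \<in> {x. infdist x K < e / 3}" for x
      using that e by (auto simp: \<phi>_def min_def max_def field_simps)
    show "\<phi> x = 0" if "x \<notin> {x. infdist x K \<le> 2 * e / 3}" for x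
      using that e by (auto simp: \<phi>_def min_def max_def field_simps)
    show "{x. infdist x K \<le> 2 * e / 3} \<subseteq> V" using e by force
    show "K \<subseteq> {x. infdist x K < e / 3}" using e by auto
  qed (auto simp: \<phi>_def)
  then show ?thesis by blast
qed

section \<open>Volume growth and compactness of balls\<close>

locale doubling_space =
  fixes M :: "'a::complete_space measure" and C :: real
  assumes sets_M[measurable_cong]: "sets M = sets borel"
    and C_ge_1: "1 \<le> C"
    and emeasure_ball_finite: "emeasure M (ball x r) < \<infinity>"
    and emeasure_ball_pos: "0 < r \<Longrightarrow> 0 < emeasure M (ball x r)"
    and emeasure_doubling: "0 < r \<Longrightarrow> emeasure M (ball x (2 * r)) \<le> ennreal C * emeasure M (ball x r)"
begin

lemma space_M[simp]: "space M = UNIV"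
  using sets_eq_imp_space_eq[OF sets_M] by simp

definition vol :: "'a \<Rightarrow> real \<Rightarrow> real" where "vol x r = measure M (ball x r)"

lemma emeasure_ball: "emeasure M (ball x r) = ennreal (vol x r)"
  unfolding vol_def using emeasure_ball_finite[of x r] by (intro emeasure_eq_ennreal_measure) auto

lemma vol_nonneg[simp]: "0 \<le> vol x r" by (simp add: vol_def)

lemma vol_pos: "0 < r \<Longrightarrow> 0 < vol x r"
  using emeasure_ball_pos[of r x] by (simp add: emeasure_ball)

lemma vol_doubling: "0 < r \<Longrightarrow> vol x (2 * r) \<le> C * vol x r"
  using emeasure_doubling[of r x] C_ge_1 by (simp add: emeasure_ball ennreal_mult[symmetric])

lemma vol_mono: "ball x r \<subseteq> ball y s \<Longrightarrow> vol x r \<le> vol y s"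
  unfolding vol_def using emeasure_ball_finite[of y s]
  by (intro measure_mono_fmeasurable) (auto simp: fmeasurable_def sets_M)

lemma vol_pow: "0 < r \<Longrightarrow> vol x (2 ^ k * r) \<le> C ^ k * vol x r"
proof (induction k)
  case (Suc k)
  have "vol x (2 ^ Suc k * r) \<le> C * vol x (2 ^ k * r)"
    using vol_doubling[of "2 ^ k * r" x] Suc.prems by (simp add: mult.assoc)
  also have "\<dots> \<le> C * (C ^ k * vol x r)" using Suc C_ge_1 by (intro mult_left_mono) auto
  finally show ?case by (simp add: mult.assoc)
qed simp

text \<open>Powers of \<open>C\<close> in the later constants come from here:
  \<open>ball x s\<close> fits into the ball around \<open>y\<close> of radius
  \<open>2 ^ k * t\<close>, and \<open>k\<close> doublings lead back to radius
  \<open>t\<close>.\<close>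

lemma vol_compare:
  assumes "dist x y + s \<le> 2 ^ k * t" "0 < t"
  shows "vol x s \<le> C ^ k * vol y t"
proof -
  have "ball x s \<subseteq> ball y (2 ^ k * t)"
  proof
    fix z assume "z \<in> ball x s"
    then show "z \<in> ball y (2 ^ k * t)"
      using assms dist_triangle[of y z x] by (auto simp: dist_commute)
  qed
  then have "vol x s \<le> vol y (2 ^ k * t)" by (rule vol_mono)
  also have "\<dots> \<le> C ^ k * vol y t" by (rule vol_pow[OF assms(2)])
  finally show ?thesis .
qed

text \<open>The balls of radius \<open>e / 2\<close> around separated points are disjoint and lie in
  \<open>ball x (R + e)\<close>; each carries at least the fraction \<open>1 / C ^ k\<close> of its
  volume. The exponent is fitted to \<open>dist x a + (R + e) \<le> 2 * R + e\<close>.\<close>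

lemma card_separated_le:
  fixes x :: 'a
  assumes S: "finite S" "S \<subseteq> cball x R" "\<And>a b. a \<in> S \<Longrightarrow> b \<in> S \<Longrightarrow> a \<noteq> b \<Longrightarrow> e \<le> dist a b"
    and e: "0 < e" and R: "0 \<le> R" and k: "2 * R + e \<le> 2 ^ k * (e / 2)"
  shows "real (card S) \<le> C ^ k"
proof -
  have disj: "disjoint_family_on (\<lambda>a. ball a (e / 2)) S"
  proof -
    have "ball a (e / 2) \<inter> ball b (e / 2) = {}" if "a \<in> S" "b \<in> S" "a \<noteq> b" for a b
    proof (rule ccontr)
      assume "ball a (e / 2) \<inter> ball b (e / 2) \<noteq> {}"
      then obtain z where "dist a z < e / 2" "dist b z < e / 2" by auto
      then show False using S(3)[OF that] dist_triangle_half_r[of z a e b] by (auto simp: dist_commute)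
    qed
    then show ?thesis by (auto simp: disjoint_family_on_def)
  qed
  have "real (card S) * vol x (R + e) = (\<Sum>a\<in>S. vol x (R + e))" by simp
  also have "\<dots> \<le> (\<Sum>a\<in>S. C ^ k * vol a (e / 2))"
  proof (rule sum_mono)
    fix a assume "a \<in> S"
    then have "dist x a \<le> R" using S by auto
    then show "vol x (R + e) \<le> C ^ k * vol a (e / 2)" using k e by (intro vol_compare) auto
  qed
  also have "\<dots> = C ^ k * (\<Sum>a\<in>S. vol a (e / 2))" by (simp add: sum_distrib_left)
  also have "(\<Sum>a\<in>S. vol a (e / 2)) = measure M (\<Union>a\<in>S. ball a (e / 2))"
    unfolding vol_def using S(1) disj emeasure_ball_finite
    by (intro measure_finite_Union[symmetric]) (auto simp: sets_M less_top)
  also have "\<dots> \<le> vol x (R + e)"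
    unfolding vol_def
  proof (rule measure_mono_fmeasurable)
    show "(\<Union>a\<in>S. ball a (e / 2)) \<subseteq> ball x (R + e)"
    proof safe
      fix a z assume "a \<in> S" "z \<in> ball a (e / 2)"
      then have "dist x a \<le> R" "dist a z < e" using S e by auto
      then show "z \<in> ball x (R + e)" using dist_triangle[of x z a] by auto
    qed
    show "(\<Union>a\<in>S. ball a (e / 2)) \<in> sets M" unfolding sets_M by (intro borel_open) auto
  qed (use emeasure_ball_finite in \<open>auto simp: sets_M fmeasurable_def\<close>)
  finally show ?thesis using C_ge_1 vol_pos[of "R + e" x] R e by (simp add: mult_le_cancel_right)
qed

text \<open>An \<open>e\<close>-separated subset of the ball of largest cardinality is an
  \<open>e\<close>-net; it exists because the volume count bounds the sizes of separated sets.
  Completeness turns total boundedness into compactness.\<close>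

lemma compact_cball: "compact (cball (x::'a) R)"
proof (cases "0 \<le> R")
  case True
  have "\<exists>K. finite K \<and> cball x R \<subseteq> (\<Union>a\<in>K. ball a e)" if e: "0 < e" for e
  proof -
    obtain k where "(2 * R + e) / (e / 2) < 2 ^ k" using real_arch_pow[of 2] by auto
    then have k: "2 * R + e \<le> 2 ^ k * (e / 2)" using e by (simp add: field_simps)
    let ?P = "\<lambda>S. finite S \<and> S \<subseteq> cball x R \<and> (\<forall>a\<in>S. \<forall>b\<in>S. a \<noteq> b \<longrightarrow> e \<le> dist a b)"
    have "card S \<le> nat \<lceil>C ^ k\<rceil>" if "?P S" for S
    proof -
      have "real (card S) \<le> C ^ k" using that by (intro card_separated_le[OF _ _ _ e True k]) auto
      then show ?thesis by linarith
    qed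
    then obtain S where S: "?P S" "\<And>T. ?P T \<Longrightarrow> card T \<le> card S"
      using ex_has_greatest_nat[of ?P "{}" card "Suc (nat \<lceil>C ^ k\<rceil>)"] by (auto simp: less_Suc_eq_le)
    have cov: "cball x R \<subseteq> (\<Union>a\<in>S. ball a e)"
    proof
      fix y assume y: "y \<in> cball x R"
      show "y \<in> (\<Union>a\<in>S. ball a e)"
      proof (rule ccontr)
        assume n: "y \<notin> (\<Union>a\<in>S. ball a e)"
        then have "?P (insert y S)" using S y by (auto simp: not_less dist_commute)
        then have "card (insert y S) \<le> card S" by (rule S)
        moreover have "y \<notin> S" using n e by auto
        ultimately show False using S by simp
      qed
    qed
    show ?thesis using S(1) cov by (intro exI[of _ S] conjI) simp_all
  qed
  then show ?thesis unfolding compact_eq_totally_bounded by (auto simp: complete_eq_closed)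
qed (auto simp: cball_empty)

lemma compact_closed_bounded:
  assumes "closed S" "bounded S"
  shows "compact (S :: 'a set)"
proof -
  obtain x R where "S \<subseteq> cball x R"
    using assms(2) unfolding bounded_def by (metis mem_cball subsetI)
  then show ?thesis using closed_Int_compact[OF assms(1) compact_cball[of x R]]
    by (simp add: Int_absorb2)
qed

section \<open>Separability and measurability on the product\<close>

definition base_point :: 'a where "base_point = undefined"

text \<open>The type class provides completeness only; separability follows from the finite nets of
  the compact balls of integer radius.\<close>

lemma countable_dense_ex: "\<exists>D::'a set. countable D \<and> (\<forall>x. \<forall>e>0. \<exists>q\<in>D. dist x q < e)"
proof -
  have "\<forall>n m. \<exists>K. finite K \<and> cball base_point (real n) \<subseteq> (\<Union>a\<in>K. ball a (1 / real (Suc m)))"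
  proof (intro allI)
    fix n m
    show "\<exists>K. finite K \<and> cball base_point (real n) \<subseteq> (\<Union>a\<in>K. ball a (1 / real (Suc m)))"
      using compact_cball[of base_point "real n", unfolded compact_eq_totally_bounded]
      by (meson of_nat_0_less_iff zero_less_Suc zero_less_divide_1_iff)
  qed
  then obtain K where K: "\<And>n m. finite (K n m)"
    "\<And>n m. cball base_point (real n) \<subseteq> (\<Union>a\<in>K n m. ball a (1 / real (Suc m)))" by metis
  have "\<exists>q\<in>(\<Union>n m. K n m). dist x q < e" if e: "e > 0" for x e
  proof -
    obtain n where n: "dist base_point x \<le> real n" using real_arch_simple by blast
    obtain m where m: "1 / real (Suc m) < e" using e nat_approx_posE by metis
    from K(2)[of n m] n obtain q where "q \<in> K n m" "dist q x < 1 / real (Suc m)" by auto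
    then show ?thesis using m by (intro bexI[of _ q]) (auto simp: dist_commute simp del: of_nat_Suc)
  qed
  moreover have "countable (\<Union>n m. K n m)"
    by (rule countable_UN, simp, rule countable_UN, simp, rule countable_finite, rule K)
  ultimately show ?thesis by blast
qed

text \<open>Openness alone does not put a set into the product sigma-algebra. Separability writes
  this one as a countable union of products of balls with centres in a dense set and rational
  radii.\<close>

lemma dist_less_in_sets_pair: "{p. dist (fst p) (snd p) < r} \<in> sets (M \<Otimes>\<^sub>M M)"
proof -
  obtain D :: "'a set" where D: "countable D" "\<And>x e. e > 0 \<Longrightarrow> \<exists>q\<in>D. dist x q < e"
    using countable_dense_ex by blast
  have "{p :: 'a \<times> 'a. dist (fst p) (snd p) < r} =
    (\<Union>q\<in>D. \<Union>s\<in>\<rat>. \<Union>t\<in>{t\<in>\<rat>. s + t \<le> r}. ball q s \<times> ball q t)" (is "?L = ?R")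
  proof safe
    fix x y :: 'a assume *: "dist (fst (x, y)) (snd (x, y)) < r"
    \<comment> \<open>With the slack divided by four, \<open>s < 2 * e\<close> and
      \<open>t < dist x y + 2 * e\<close> add up to less than \<open>r\<close>.\<close>
    define e where "e = (r - dist x y) / 4"
    then have e: "e > 0" "4 * e + dist x y = r" using * by auto
    obtain q where q: "q \<in> D" "dist x q < e" using D(2)[OF e(1)] by blast
    obtain s where s: "s \<in> \<rat>" "e < s" "s < 2 * e" using Rats_dense_in_real[of e "2 * e"] e by auto
    obtain t where t: "t \<in> \<rat>" "dist x y + e < t" "t < dist x y + 2 * e"
      using Rats_dense_in_real[of "dist x y + e" "dist x y + 2 * e"] e by auto
    have "dist q y < t" using dist_triangle[of q y x] q t by (simp add: dist_commute)
    then show "(x, y) \<in> ?R" using q s t e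
      by (intro UN_I[of q] UN_I[of s] UN_I[of t]) (auto simp: dist_commute)
  next
    fix x y q s t assume "s + t \<le> r" "x \<in> ball q s" "y \<in> ball q t"
    then show "dist (fst (x, y)) (snd (x, y)) < r"
      using dist_triangle[of x y q] by (auto simp: dist_commute)
  qed
  moreover have "?R \<in> sets (M \<Otimes>\<^sub>M M)"
  proof -
    have "(\<Union>t\<in>{t\<in>\<rat>. s + t \<le> r}. ball q s \<times> ball q t) \<in> sets (M \<Otimes>\<^sub>M M)" for q s
      by (intro sets.countable_UN' countable_subset[OF _ countable_rat, of "{t\<in>\<rat>. s + t \<le> r}"])
         (auto intro!: pair_measureI simp: sets_M)
    then have "(\<Union>s\<in>\<rat>. \<Union>t\<in>{t\<in>\<rat>. s + t \<le> r}. ball q s \<times> ball q t) \<in> sets (M \<Otimes>\<^sub>M M)" for q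
      by (intro sets.countable_UN' countable_rat) auto
    then show ?thesis by (intro sets.countable_UN' D(1)) auto
  qed
  ultimately show ?thesis by simp
qed

lemma measurable_in_ball[measurable]:
  assumes [measurable]: "f \<in> N \<rightarrow>\<^sub>M M" "g \<in> N \<rightarrow>\<^sub>M M"
  shows "Measurable.pred N (\<lambda>x. g x \<in> ball (f x) r)"
proof -
  have "Measurable.pred (M \<Otimes>\<^sub>M M) (\<lambda>p. dist (fst p) (snd p) < r)"
    using dist_less_in_sets_pair[of r] by (simp add: pred_def space_pair_measure)
  then have "Measurable.pred N (\<lambda>x. (\<lambda>p. dist (fst p) (snd p) < r) (f x, g x))"
    by (rule measurable_compose[rotated]) measurable
  then show ?thesis by simp
qed

lemma measurable_indicator_ball[measurable]:
  assumes [measurable]: "f \<in> N \<rightarrow>\<^sub>M M" "g \<in> N \<rightarrow>\<^sub>M M"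
  shows "(\<lambda>x. indicator (ball (f x) r) (g x) :: ennreal) \<in> borel_measurable N"
  unfolding indicator_def by measurable

lemma sigma_finite_M: "sigma_finite_measure M"
proof
  show "\<exists>A. countable A \<and> A \<subseteq> sets M \<and> \<Union>A = space M \<and> (\<forall>a\<in>A. emeasure M a \<noteq> \<infinity>)"
  proof (intro exI[of _ "range (\<lambda>n. ball base_point (real n))"] conjI)
    show "\<Union>(range (\<lambda>n. ball base_point (real n))) = space M"
      using reals_Archimedean2 by (auto, blast)
  qed (use emeasure_ball_finite in \<open>auto simp: sets_M less_top\<close>)
qed

sublocale sigma_finite_measure M by (rule sigma_finite_M)
sublocale MM: pair_sigma_finite M M ..

lemma measurable_vol[measurable]: "f \<in> N \<rightarrow>\<^sub>M M \<Longrightarrow> (\<lambda>x. emeasure M (ball (f x) r)) \<in> borel_measurable N"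
proof -
  assume [measurable]: "f \<in> N \<rightarrow>\<^sub>M M"
  have "(\<lambda>x. \<integral>\<^sup>+y. indicator (ball (f x) r) y \<partial>M) \<in> borel_measurable N" by measurable
  then show ?thesis by (simp add: sets_M)
qed

section \<open>Averages over balls\<close>

lemma inverse_emeasure_ball: "0 < r \<Longrightarrow> 1 / emeasure M (ball x r) = ennreal (1 / vol x r)"
  using vol_pos[of r x] by (simp add: emeasure_ball divide_ennreal flip: ennreal_1)

lemma inverse_vol_compare:
  assumes "dist x y + s \<le> 2 ^ k * t" "0 < t" "0 < s"
  shows "1 / emeasure M (ball y t) \<le> ennreal (C ^ k) * (1 / emeasure M (ball x s))"
proof -
  have "1 / vol y t \<le> C ^ k * (1 / vol x s)"
    using vol_compare[OF assms(1,2)] vol_pos[OF assms(2), of y] vol_pos[OF assms(3), of x]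
    by (simp add: field_simps)
  then show ?thesis using assms C_ge_1
    by (simp add: inverse_emeasure_ball ennreal_mult[symmetric] ennreal_leI del: times_divide_eq_right)
qed

lemma emeasure_ball_cancel: "0 < r \<Longrightarrow> (1 / emeasure M (ball x r)) * emeasure M (ball x r) = 1"
  by (subst inverse_emeasure_ball, simp, subst emeasure_ball)
     (use vol_pos[of r x] in \<open>simp add: ennreal_mult[symmetric]\<close>)

text \<open>After exchanging the integrals, each \<open>y\<close> is weighted by the integral of
  \<open>1 / emeasure M (ball x s)\<close> over \<open>x\<close> in \<open>ball y t\<close>. Since
  \<open>dist x y + t \<le> 2 * t \<le> 2 ^ k * s\<close>, doubling bounds this weight by
  \<open>C ^ k\<close>.\<close>

lemma average_le:
  fixes h :: "'a \<Rightarrow> ennreal"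
  assumes [measurable]: "h \<in> borel_measurable M" "A \<in> sets M" "B \<in> sets M"
    and AB: "\<And>x y. x \<in> A \<Longrightarrow> dist x y < t \<Longrightarrow> y \<in> B"
    and st: "0 < s" "0 < t" "2 * t \<le> 2 ^ k * s"
  shows "(\<integral>\<^sup>+x\<in>A. (1 / emeasure M (ball x s)) * (\<integral>\<^sup>+y\<in>ball x t. h y \<partial>M) \<partial>M)
      \<le> ennreal (C ^ k) * (\<integral>\<^sup>+y\<in>B. h y \<partial>M)"
proof -
  have "(\<integral>\<^sup>+x\<in>A. (1 / emeasure M (ball x s)) * (\<integral>\<^sup>+y\<in>ball x t. h y \<partial>M) \<partial>M)
     = (\<integral>\<^sup>+x. \<integral>\<^sup>+y. (1 / emeasure M (ball x s)) * indicator A x * (h y * indicator (ball x t) y) \<partial>M \<partial>M)"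
    by (subst nn_integral_cmult) (auto simp: ac_simps)
  also have "\<dots> = (\<integral>\<^sup>+y. \<integral>\<^sup>+x. (1 / emeasure M (ball x s)) * indicator A x * (h y * indicator (ball x t) y) \<partial>M \<partial>M)"
    by (rule MM.Fubini') measurable
  also have "\<dots> \<le> (\<integral>\<^sup>+y. ennreal (C ^ k) * (h y * indicator B y) \<partial>M)"
  proof (rule nn_integral_mono)
    fix y
    have "(\<integral>\<^sup>+x. (1 / emeasure M (ball x s)) * indicator A x * (h y * indicator (ball x t) y) \<partial>M)
      \<le> (\<integral>\<^sup>+x. (ennreal (C ^ k) * (1 / emeasure M (ball y t)) * (h y * indicator B y)) * indicator (ball y t) x \<partial>M)"
    proof (rule nn_integral_mono)
      fix x
      show "(1 / emeasure M (ball x s)) * indicator A x * (h y * indicator (ball x t) y)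
        \<le> (ennreal (C ^ k) * (1 / emeasure M (ball y t)) * (h y * indicator B y)) * indicator (ball y t) x"
      proof (cases "x \<in> A \<and> dist x y < t")
        case True
        then have "1 / emeasure M (ball x s) \<le> ennreal (C ^ k) * (1 / emeasure M (ball y t))"
          using st by (intro inverse_vol_compare) (auto simp: dist_commute)
        from mult_right_mono[OF this, of "h y"] show ?thesis using True AB[of x y]
          by (simp add: dist_commute)
      qed auto
    qed
    also have "\<dots> = (ennreal (C ^ k) * (1 / emeasure M (ball y t)) * (h y * indicator B y)) * emeasure M (ball y t)"
      by (rule nn_integral_cmult_indicator) (simp add: sets_M)
    also have "\<dots> = ennreal (C ^ k) * (h y * indicator B y) * ((1 / emeasure M (ball y t)) * emeasure M (ball y t))"
      by (simp only: ac_simps)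
    also have "\<dots> = ennreal (C ^ k) * (h y * indicator B y)"
      by (simp only: emeasure_ball_cancel[OF st(2)] mult_1_right)
    finally show "(\<integral>\<^sup>+x. (1 / emeasure M (ball x s)) * indicator A x * (h y * indicator (ball x t) y) \<partial>M)
      \<le> ennreal (C ^ k) * (h y * indicator B y)" .
  qed
  also have "\<dots> = ennreal (C ^ k) * (\<integral>\<^sup>+y\<in>B. h y \<partial>M)" by (rule nn_integral_cmult) measurable
  finally show ?thesis .
qed

section \<open>Compact neighbourhoods and exhaustions of open sets\<close>

lemma compact_neighbourhood:
  assumes "compact K" "open U" "K \<subseteq> (U :: 'a set)"
  obtains e N where "e > 0" "compact N" "N \<subseteq> U" "(\<Union>x\<in>K. ball x e) \<subseteq> N"
proof (cases "K = {}")
  case False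
  then obtain e where e: "e > 0" "{x. infdist x K \<le> e} \<subseteq> U"
    using infdist_neighbourhood[OF False assms(1,2,3)] by auto
  have "closed {x. infdist x K \<le> e}" by (intro closed_Collect_le continuous_intros)
  moreover have "bounded {x. infdist x K \<le> e}"
  proof -
    obtain a B where B: "\<And>y. y \<in> K \<Longrightarrow> dist a y \<le> B"
      using compact_imp_bounded[OF assms(1)] unfolding bounded_def by blast
    have "dist a x \<le> B + (e + 1)" if "infdist x K \<le> e" for x
    proof -
      have "infdist x K < e + 1" using that by simp
      then obtain y where y: "y \<in> K" "dist x y < e + 1"
        using False by (auto simp: infdist_notempty cINF_less_iff)
      then show ?thesis using B[OF y(1)] dist_triangle[of a x y] by (simp add: dist_commute)
    qed
    then show ?thesis unfolding bounded_def by blast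
  qed
  ultimately have "compact {x. infdist x K \<le> e}" by (rule compact_closed_bounded)
  moreover have "(\<Union>x\<in>K. ball x e) \<subseteq> {x. infdist x K \<le> e}"
    by (auto simp: dist_commute intro: infdist_le2 less_imp_le)
  ultimately show ?thesis using that e by blast
qed (use that[of 1 "{}"] in auto)

text \<open>The compact sets \<open>K i\<close> collect the points at distance at most
  \<open>i\<close> from a base point whose ball of radius \<open>1 / (i + 1)\<close> stays in
  \<open>U\<close>; the exhaustion consists of their interiors.\<close>

lemma exhaustion:
  assumes U: "open (U :: 'a set)"
  obtains W :: "nat \<Rightarrow> 'a set" where "\<And>i. open (W i)" "\<And>i. compactly_in (W i) (W (Suc i))" "(\<Union>i. W i) = U"
proof -
  define K where "K i = cball base_point (real i) \<inter> {x. ball x (1 / real (Suc i)) \<subseteq> U}" for i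
  have "closed {x. ball x e \<subseteq> U}" for e
  proof -
    have "{x. ball x e \<subseteq> U} = (\<Inter>y\<in>-U. {x. e \<le> dist x y})" by (force simp: not_less)
    also have "closed \<dots>" by (intro closed_INT ballI closed_Collect_le continuous_intros)
    finally show ?thesis .
  qed
  then have cK: "compact (K i)" for i
    unfolding K_def using compact_cball by (intro compact_Int_closed) auto
  have KK: "K i \<subseteq> interior (K (Suc i))" for i
  proof
    fix x assume x: "x \<in> K i"
    \<comment> \<open>The difference of consecutive radii: moving a point by less than
      \<open>t\<close> keeps the smaller ball inside the larger one, and \<open>t \<le> 1\<close>
      keeps the point within distance \<open>i + 1\<close> of the base point.\<close>
    define t where "t = 1 / real (Suc i) - 1 / real (Suc (Suc i))"
    have t: "t > 0" unfolding t_def by (simp add: frac_less2)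
    have "1 / real (Suc i) \<le> 1" "0 \<le> 1 / real (Suc (Suc i))" by auto
    then have t1: "t \<le> 1" unfolding t_def by linarith
    have "ball x t \<subseteq> K (Suc i)"
    proof
      fix y assume y: "y \<in> ball x t"
      have "dist base_point y \<le> real (Suc i)" using x y t1 dist_triangle[of base_point y x] by (auto simp: K_def)
      moreover have "ball y (1 / real (Suc (Suc i))) \<subseteq> ball x (1 / real (Suc i))"
      proof
        fix z assume "z \<in> ball y (1 / real (Suc (Suc i)))"
        then show "z \<in> ball x (1 / real (Suc i))"
          using y dist_triangle[of x z y] by (auto simp: t_def)
      qed
      ultimately show "y \<in> K (Suc i)" using x by (auto simp: K_def)
    qed
    then show "x \<in> interior (K (Suc i))" using t interior_maximal by (metis centre_in_ball open_ball subsetD)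
  qed
  have cl: "closure (interior (K i)) \<subseteq> K i" for i
    by (intro closure_minimal interior_subset compact_imp_closed cK)
  show ?thesis
  proof (rule that[of "\<lambda>i. interior (K i)"])
    have "compact (closure (interior (K i)))" for i
      using compact_Int_closed[OF cK[of i] closed_closure, of "interior (K i)"] cl[of i]
      by (simp add: Int_absorb1)
    then show "compactly_in (interior (K i)) (interior (K (Suc i)))" for i
      unfolding compactly_in_def using cl[of i] KK[of i] by blast
    show "(\<Union>i. interior (K i)) = U"
    proof safe
      fix x i assume "x \<in> interior (K i)"
      then have "x \<in> K i" using interior_subset by blast
      then show "x \<in> U" by (auto simp: K_def)
    next
      fix x assume "x \<in> U"
      then obtain e where e: "e > 0" "ball x e \<subseteq> U" using U open_contains_ball by blast
      obtain n where n: "1 / real (Suc n) < e" using e nat_approx_posE by metis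
      obtain m where m: "dist base_point x \<le> real m" using real_arch_simple by blast
      have "1 / real (Suc (max n m)) \<le> 1 / real (Suc n)" by (simp add: field_simps)
      then have "ball x (1 / real (Suc (max n m))) \<subseteq> U" using n e by (meson less_imp_le order_trans subset_ball)
      then have "x \<in> K (max n m)" using m by (auto simp: K_def)
      then show "x \<in> (\<Union>i. interior (K i))" using KK by blast
    qed
  qed auto
qed

lemma exhaustion_mono:
  assumes "\<And>i. compactly_in (W i) (W (Suc i) :: 'a set)" "i \<le> j"
  shows "W i \<subseteq> W j"
  using assms(2) by (rule lift_Suc_mono_le[rotated])
    (use assms(1) closure_subset in \<open>force simp: compactly_in_def\<close>)

text \<open>Exhausting \<open>A\<close> and \<open>B\<close> separately, compactness of
  \<open>closure W\<close> finds one index at which the two exhaustions together cover it.\<close>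

lemma compactly_in_Un:
  assumes W: "compactly_in W (A \<union> B)" and AB: "open A" "open (B :: 'a set)"
  obtains A' B' where "open A'" "open B'" "compactly_in A' A" "compactly_in B' B" "closure W \<subseteq> A' \<union> B'"
proof -
  obtain S where S: "\<And>i. open (S i)" "\<And>i. compactly_in (S i) (S (Suc i))" "(\<Union>i. S i) = A"
    using exhaustion[OF AB(1)] by blast
  obtain T where T: "\<And>i. open (T i)" "\<And>i. compactly_in (T i) (T (Suc i))" "(\<Union>i. T i) = B"
    using exhaustion[OF AB(2)] by blast
  obtain I where I: "finite I" "closure W \<subseteq> (\<Union>i\<in>I. S i \<union> T i)"
  proof (rule compactE_image[of "closure W" UNIV "\<lambda>i. S i \<union> T i"])
    show "compact (closure W)" using W by (simp add: compactly_in_def)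
    show "closure W \<subseteq> (\<Union>i. S i \<union> T i)" using W S(3) T(3) unfolding compactly_in_def by blast
  qed (use S T in auto)
  obtain n where n: "\<And>i. i \<in> I \<Longrightarrow> i \<le> n" using I(1) Max_ge by metis
  have "closure W \<subseteq> S n \<union> T n"
  proof
    fix x assume "x \<in> closure W"
    then obtain i where i: "i \<in> I" "x \<in> S i \<union> T i" using I(2) by blast
    have "S i \<subseteq> S n" "T i \<subseteq> T n"
      using exhaustion_mono[of S, OF S(2) n[OF i(1)]] exhaustion_mono[of T, OF T(2) n[OF i(1)]] by auto
    then show "x \<in> S n \<union> T n" using i(2) by blast
  qed
  moreover have "compactly_in (S n) A" "compactly_in (T n) B"
    using S(2,3) T(2,3) unfolding compactly_in_def by blast+
  ultimately show ?thesis using that S T by blast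
qed

end

section \<open>The pointwise Lipschitz constant\<close>

lemma ennreal_thirds: "0 < e \<Longrightarrow> ennreal (e / 3) + ennreal (e / 3) + ennreal (e / 3) = ennreal e"
  by (simp add: ennreal_plus[symmetric] del: ennreal_plus)

lemma ennreal_less_add: "x < top \<Longrightarrow> 0 < e \<Longrightarrow> x < x + ennreal e"
  using ennreal_add_left_cancel_less[of x 0 "ennreal e"] by auto

lemma ennreal_abs_triangle: "ennreal \<bar>a - b\<bar> \<le> ennreal \<bar>a - c\<bar> + ennreal \<bar>b - c\<bar>"
  by (simp add: ennreal_plus[symmetric] ennreal_leI del: ennreal_plus)

lemma tendsto_0_le_ennreal:
  fixes f g :: "nat \<Rightarrow> ennreal"
  assumes "g \<longlonglongrightarrow> 0" "\<forall>\<^sub>F n in sequentially. f n \<le> g n"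
  shows "f \<longlonglongrightarrow> 0"
  by (rule tendsto_sandwich[OF always_eventually assms(2) tendsto_const assms(1)]) simp

lemma liminf_add_le_ennreal:
  fixes a b :: "nat \<Rightarrow> ennreal"
  shows "liminf a + liminf b \<le> liminf (\<lambda>n. a n + b n)"
proof -
  have "liminf a + liminf b = (SUP n. (INF m\<in>{n..}. a m) + (INF m\<in>{n..}. b m))"
    unfolding liminf_SUP_INF
    by (intro ennreal_SUP_add[symmetric] incseq_SucI INF_superset_mono) auto
  also have "\<dots> \<le> liminf (\<lambda>n. a n + b n)"
    unfolding liminf_SUP_INF
    by (intro SUP_mono) (auto intro!: INF_greatest add_mono INF_lower)
  finally show ?thesis .
qed

text \<open>Difference quotients with the actual distance in the denominator: for fixed \<open>y\<close> they are
  continuous in \<open>x\<close>, which makes the pointwise Lipschitz constant measurable.\<close>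

definition slope :: "nat \<Rightarrow> ('a::metric_space \<Rightarrow> real) \<Rightarrow> 'a \<Rightarrow> ennreal" where
  "slope n g x = (SUP y\<in>{y. 0 < dist x y \<and> dist x y < 1 / real (Suc n)}. ennreal (\<bar>g y - g x\<bar> / dist x y))"

lemma slope_upper:
  "0 < dist x y \<Longrightarrow> dist x y < 1 / real (Suc n) \<Longrightarrow> ennreal (\<bar>g y - g x\<bar> / dist x y) \<le> slope n g x"
  unfolding slope_def by (intro SUP_upper) auto

lemma decseq_slope: "decseq (\<lambda>n. slope n g x)"
proof (rule decseq_SucI)
  fix n
  have "1 / real (Suc (Suc n)) \<le> 1 / real (Suc n)" by (simp add: frac_le)
  then show "slope (Suc n) g x \<le> slope n g x"
    unfolding slope_def by (intro SUP_subset_mono) (auto simp del: of_nat_Suc)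
qed

text \<open>The two normalisations agree in the limit: dividing by \<open>dist x y\<close> instead
  of \<open>r\<close> can only increase a quotient over \<open>cball x r\<close>, and conversely
  \<open>r = dist x y\<close> is an admissible radius.\<close>

lemma Lip_const_eq_slope: "Lip_const g x = (INF n. slope n g x)"
proof (rule antisym)
  show "Lip_const g x \<le> (INF n. slope n g x)"
  proof (rule INF_greatest)
    fix n
    have "(SUP y\<in>cball x r. ennreal (\<bar>g y - g x\<bar> / r)) \<le> slope n g x"
      if r: "0 < r" "r < 1 / real (Suc n)" for r
    proof (rule SUP_least)
      fix y assume y: "y \<in> cball x r"
      show "ennreal (\<bar>g y - g x\<bar> / r) \<le> slope n g x"
      proof (cases "x = y")
        case False
        have "ennreal (\<bar>g y - g x\<bar> / r) \<le> ennreal (\<bar>g y - g x\<bar> / dist x y)"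
          using y False r by (intro ennreal_leI divide_left_mono) auto
        also have "\<dots> \<le> slope n g x" using y r False by (intro slope_upper) auto
        finally show ?thesis .
      qed simp
    qed
    then show "Lip_const g x \<le> slope n g x"
      unfolding Lip_const_def
      by (intro Limsup_bounded) (auto simp: eventually_at_right_field simp del: of_nat_Suc intro!: exI[of _ "1 / real (Suc n)"])
  qed
  show "(INF n. slope n g x) \<le> Lip_const g x"
    unfolding Lip_const_def Limsup_def
  proof (rule INF_greatest, clarify)
    fix P :: "real \<Rightarrow> bool" assume "eventually P (at_right 0)"
    then obtain b where b: "b > 0" "\<And>r. 0 < r \<Longrightarrow> r < b \<Longrightarrow> P r"
      unfolding eventually_at_right_field by auto
    obtain n where n: "1 / real (Suc n) < b" using b nat_approx_posE by metis
    show "(INF n. slope n g x) \<le> (SUP r\<in>{r. P r}. SUP y\<in>cball x r. ennreal (\<bar>g y - g x\<bar> / r))"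
    proof (rule INF_lower2[of n])
      show "slope n g x \<le> (SUP r\<in>{r. P r}. SUP y\<in>cball x r. ennreal (\<bar>g y - g x\<bar> / r))"
        unfolding slope_def
      proof (rule SUP_least)
        fix y assume y: "y \<in> {y. 0 < dist x y \<and> dist x y < 1 / real (Suc n)}"
        then have "P (dist x y)" using b(2)[of "dist x y"] n by auto
        then show "ennreal (\<bar>g y - g x\<bar> / dist x y) \<le> (SUP r\<in>{r. P r}. SUP y\<in>cball x r. ennreal (\<bar>g y - g x\<bar> / r))"
          by (intro SUP_upper2[of "dist x y"] SUP_upper) auto
      qed
    qed simp
  qed
qed

lemma slope_tendsto: "(\<lambda>n. slope n g x) \<longlonglongrightarrow> Lip_const g x"
  unfolding Lip_const_eq_slope by (intro LIMSEQ_INF decseq_slope)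

text \<open>The common source of the pointwise estimates. With \<open>u\<close> and \<open>v\<close>
  constant it gives an upper bound, with \<open>K = 0\<close> and \<open>v\<close> constant locality
  on open sets, and with \<open>K\<close> proportional to \<open>\<bar>u x - v x\<bar>\<close> the
  Leibniz rule for \<open>glue\<close>.\<close>

lemma Lip_const_le_add:
  assumes e: "0 < e" and K: "0 \<le> K"
    and le: "\<And>y. dist x y < e \<Longrightarrow> \<bar>w y - w x\<bar> \<le> \<bar>u y - u x\<bar> + \<bar>v y - v x\<bar> + K * dist x y"
  shows "Lip_const w x \<le> Lip_const u x + Lip_const v x + ennreal K"
proof (rule LIMSEQ_le[OF slope_tendsto])
  show "(\<lambda>n. slope n u x + slope n v x + ennreal K) \<longlonglongrightarrow> Lip_const u x + Lip_const v x + ennreal K"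
    by (intro tendsto_add slope_tendsto tendsto_const)
  obtain N where N: "1 / real (Suc N) < e" using e nat_approx_posE by metis
  have "slope n w x \<le> slope n u x + slope n v x + ennreal K" if n: "N \<le> n" for n
    unfolding slope_def[of n w]
  proof (rule SUP_least)
    fix y assume y: "y \<in> {y. 0 < dist x y \<and> dist x y < 1 / real (Suc n)}"
    have "1 / real (Suc n) \<le> 1 / real (Suc N)" using n by (simp add: frac_le)
    then have "\<bar>w y - w x\<bar> \<le> \<bar>u y - u x\<bar> + \<bar>v y - v x\<bar> + K * dist x y"
      using y N by (intro le) auto
    then have "\<bar>w y - w x\<bar> / dist x y \<le> (\<bar>u y - u x\<bar> + \<bar>v y - v x\<bar> + K * dist x y) / dist x y"
      using y by (intro divide_right_mono) auto
    also have "\<dots> = \<bar>u y - u x\<bar> / dist x y + \<bar>v y - v x\<bar> / dist x y + K"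
      using y by (simp add: add_divide_distrib)
    finally have "ennreal (\<bar>w y - w x\<bar> / dist x y)
       \<le> ennreal (\<bar>u y - u x\<bar> / dist x y + \<bar>v y - v x\<bar> / dist x y + K)" by (rule ennreal_leI)
    also have "\<dots> = ennreal (\<bar>u y - u x\<bar> / dist x y) + ennreal (\<bar>v y - v x\<bar> / dist x y) + ennreal K"
      using K by (simp add: ennreal_plus)
    also have "\<dots> \<le> slope n u x + slope n v x + ennreal K"
      using y by (intro add_mono slope_upper order_refl) auto
    finally show "ennreal (\<bar>w y - w x\<bar> / dist x y) \<le> slope n u x + slope n v x + ennreal K" .
  qed
  then show "\<exists>N. \<forall>n\<ge>N. slope n w x \<le> slope n u x + slope n v x + ennreal K" by blast
qed

lemma Lip_const_const[simp]: "Lip_const (\<lambda>_. c) x = 0"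
proof -
  have "Lip_const (\<lambda>_. c) x \<le> slope 0 (\<lambda>_. c) x" unfolding Lip_const_eq_slope by (rule INF_lower) simp
  also have "\<dots> \<le> 0" unfolding slope_def by (rule SUP_least) simp
  finally show ?thesis by simp
qed

lemma Lip_const_le_bound:
  assumes "0 < e" "0 \<le> K" "\<And>y. dist x y < e \<Longrightarrow> \<bar>w y - w x\<bar> \<le> K * dist x y"
  shows "Lip_const w x \<le> ennreal K"
  using Lip_const_le_add[of e K x w "\<lambda>_. 0" "\<lambda>_. 0"] assms by simp

lemma Lip_const_le_eq:
  assumes "open A" "x \<in> A" "\<And>y. y \<in> A \<Longrightarrow> w y = u y"
  shows "Lip_const w x \<le> Lip_const u x"
proof -
  obtain e where e: "e > 0" "ball x e \<subseteq> A" using assms open_contains_ball by blast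
  have "\<bar>w y - w x\<bar> \<le> \<bar>u y - u x\<bar>" if "dist x y < e" for y
    using assms(3)[of y] assms(3)[of x] assms(2) e that by (auto simp: subset_eq)
  then show ?thesis using Lip_const_le_add[of e 0 x w u "\<lambda>_. 0"] e by simp
qed

lemma Lip_const_cong:
  assumes "open A" "x \<in> A" "\<And>y. y \<in> A \<Longrightarrow> w y = u y"
  shows "Lip_const w x = Lip_const u x"
  using assms by (intro antisym Lip_const_le_eq[of A]) auto

text \<open>The superlevel sets of \<open>slope n g\<close> in \<open>U\<close> are unions over all
  \<open>y\<close> of open sets, hence open although the union need not be countable. The countable
  infimum over \<open>n\<close> then preserves measurability.\<close>

lemma borel_measurable_Lip_const:
  assumes U: "open U" and g: "continuous_on U g"
  shows "(\<lambda>x. Lip_const g x * indicator U x) \<in> borel_measurable borel"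
proof -
  have "(\<lambda>x. slope n g x * indicator U x) \<in> borel_measurable borel" for n
  proof (rule borel_measurableI_greater)
    fix t :: ennreal
    let ?A = "\<lambda>y. U \<inter> {x. 0 < dist x y} \<inter> {x. dist x y < 1 / real (Suc n)}"
    let ?h = "\<lambda>y x. ennreal (\<bar>g y - g x\<bar> / dist x y)"
    have op: "open (?A y)" for y
      using U by (intro open_Int open_Collect_less continuous_intros) auto
    have "open (?A y \<inter> ?h y -` {t<..})" for y
    proof (rule continuous_open_preimage[OF _ op])
      show "continuous_on (?A y) (?h y)"
        by (intro continuous_on_ennreal continuous_intros continuous_on_subset[OF g]) auto
    qed simp
    then have "open (\<Union>y. ?A y \<inter> ?h y -` {t<..})" by blast
    moreover have "{x \<in> space borel. t < slope n g x * indicator U x} = (\<Union>y. ?A y \<inter> ?h y -` {t<..})"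
      by (auto simp: slope_def less_SUP_iff indicator_def simp del: of_nat_Suc split: if_splits)
    ultimately show "{x \<in> space borel. t < slope n g x * indicator U x} \<in> sets borel" by simp
  qed
  then have "(\<lambda>x. INF n. slope n g x * indicator U x) \<in> borel_measurable borel" by measurable
  moreover have "(INF n. slope n g x * indicator U x) = Lip_const g x * indicator U x" for x
    by (cases "x \<in> U") (simp_all add: Lip_const_eq_slope)
  ultimately show ?thesis by simp
qed

section \<open>Locally Lipschitz functions\<close>

text \<open>For open \<open>U\<close> this pointwise form of \<open>locally_lipschitz_on\<close> no
  longer mentions \<open>U\<close>, so a glued function can be examined near one point at a time, by
  whichever formula is valid there.\<close>

definition lipschitz_near :: "('a::metric_space \<Rightarrow> real) \<Rightarrow> 'a \<Rightarrow> bool" where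
  "lipschitz_near g x \<longleftrightarrow> (\<exists>e>0. \<exists>L. L-lipschitz_on (ball x e) g)"

lemma locally_lipschitz_on_iff:
  assumes "open U"
  shows "locally_lipschitz_on U g \<longleftrightarrow> (\<forall>x\<in>U. lipschitz_near g x)"
proof
  assume l: "locally_lipschitz_on U g"
  show "\<forall>x\<in>U. lipschitz_near g x"
  proof
    fix x assume x: "x \<in> U"
    then obtain e L where e: "e > 0" "L-lipschitz_on (ball x e \<inter> U) g"
      using l unfolding locally_lipschitz_on_def by blast
    obtain e' where e': "e' > 0" "ball x e' \<subseteq> U" using assms x open_contains_ball by blast
    have "L-lipschitz_on (ball x (min e e')) g"
      by (rule lipschitz_on_subset[OF e(2)]) (use e' in auto)
    then show "lipschitz_near g x" unfolding lipschitz_near_def using e e'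
      by (intro exI[of _ "min e e'"]) auto
  qed
next
  assume "\<forall>x\<in>U. lipschitz_near g x"
  then show "locally_lipschitz_on U g"
    unfolding locally_lipschitz_on_def lipschitz_near_def
    by (meson Int_lower1 lipschitz_on_subset)
qed

lemma lipschitz_near_imp_isCont:
  assumes "lipschitz_near g x" shows "isCont g x"
proof -
  obtain e L where "e > 0" "L-lipschitz_on (ball x e) g"
    using assms unfolding lipschitz_near_def by blast
  then show ?thesis
    using lipschitz_on_continuous_on[of L "ball x e" g] by (simp add: continuous_on_eq_continuous_at)
qed

lemma locally_lipschitz_on_continuous:
  "open U \<Longrightarrow> locally_lipschitz_on U g \<Longrightarrow> continuous_on U g"
  by (intro continuous_at_imp_continuous_on)
     (auto simp: locally_lipschitz_on_iff intro: lipschitz_near_imp_isCont)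

lemma locally_lipschitz_on_subset: "locally_lipschitz_on U g \<Longrightarrow> V \<subseteq> U \<Longrightarrow> locally_lipschitz_on V g"
  unfolding locally_lipschitz_on_def by (meson Int_mono lipschitz_on_subset order_refl subsetD)

lemma lipschitz_near_cong:
  assumes "open A" "x \<in> A" "\<And>y. y \<in> A \<Longrightarrow> w y = u y" "lipschitz_near u x"
  shows "lipschitz_near w x"
proof -
  obtain e L where e: "e > 0" "L-lipschitz_on (ball x e) u"
    using assms(4) unfolding lipschitz_near_def by blast
  obtain e' where e': "e' > 0" "ball x e' \<subseteq> A" using assms open_contains_ball by blast
  have "L-lipschitz_on (ball x (min e e')) u"
    by (rule lipschitz_on_subset[OF e(2)]) auto
  then have "L-lipschitz_on (ball x (min e e')) w"
    by (rule lipschitz_on_transform) (use e' assms(3) in auto)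
  then show ?thesis unfolding lipschitz_near_def using e e' by (intro exI[of _ "min e e'"]) auto
qed

section \<open>Gluing two functions with a cutoff\<close>

definition glue :: "('a \<Rightarrow> real) \<Rightarrow> ('a \<Rightarrow> real) \<Rightarrow> ('a \<Rightarrow> real) \<Rightarrow> 'a \<Rightarrow> real" where
  "glue \<phi> u v x = \<phi> x * u x + (1 - \<phi> x) * v x"

lemma glue_simps: "\<phi> x = 1 \<Longrightarrow> glue \<phi> u v x = u x" "\<phi> x = 0 \<Longrightarrow> glue \<phi> u v x = v x"
  by (simp_all add: glue_def)

text \<open>The weights are taken at \<open>y\<close> and the mismatch of \<open>u\<close> and
  \<open>v\<close> at \<open>x\<close>, so that the coefficient of the cutoff increment stays fixed
  while \<open>y\<close> tends to \<open>x\<close>.\<close>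

lemma glue_diff:
  assumes "0 \<le> \<phi> y" "\<phi> y \<le> 1"
  shows "\<bar>glue \<phi> u v y - glue \<phi> u v x\<bar> \<le> \<bar>u y - u x\<bar> + \<bar>v y - v x\<bar> + \<bar>\<phi> y - \<phi> x\<bar> * \<bar>u x - v x\<bar>"
proof -
  have "glue \<phi> u v y - glue \<phi> u v x
      = \<phi> y * (u y - u x) + (1 - \<phi> y) * (v y - v x) + (\<phi> y - \<phi> x) * (u x - v x)"
    by (simp add: glue_def algebra_simps)
  also have "\<bar>\<dots>\<bar> \<le> \<bar>\<phi> y * (u y - u x)\<bar> + \<bar>(1 - \<phi> y) * (v y - v x)\<bar> + \<bar>(\<phi> y - \<phi> x) * (u x - v x)\<bar>"
    by linarith
  also have "\<dots> \<le> \<bar>u y - u x\<bar> + \<bar>v y - v x\<bar> + \<bar>\<phi> y - \<phi> x\<bar> * \<bar>u x - v x\<bar>"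
    using assms by (intro add_mono) (auto simp: abs_mult intro!: mult_left_le_one_le)
  finally show ?thesis .
qed

lemma glue_error:
  assumes "0 \<le> \<phi> x" "\<phi> x \<le> 1"
  shows "\<bar>glue \<phi> u v x - c\<bar> \<le> \<phi> x * \<bar>u x - c\<bar> + (1 - \<phi> x) * \<bar>v x - c\<bar>"
proof -
  have "glue \<phi> u v x - c = \<phi> x * (u x - c) + (1 - \<phi> x) * (v x - c)"
    by (simp add: glue_def algebra_simps)
  also have "\<bar>\<dots>\<bar> \<le> \<bar>\<phi> x * (u x - c)\<bar> + \<bar>(1 - \<phi> x) * (v x - c)\<bar>" by linarith
  finally show ?thesis using assms by (simp add: abs_mult)
qed

text \<open>The convex weights are dropped and both Lipschitz constants enter in full. This double
  count on the transition region is affordable because the variation bounds add the contributions of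
  both pieces anyway.\<close>

lemma Lip_const_glue:
  assumes \<phi>: "L-lipschitz_on UNIV \<phi>" "\<And>x. 0 \<le> \<phi> x" "\<And>x. \<phi> x \<le> 1"
  shows "Lip_const (glue \<phi> u v) x \<le> Lip_const u x + Lip_const v x + ennreal L * ennreal \<bar>u x - v x\<bar>"
proof -
  have L: "0 \<le> L" using \<phi>(1) by (rule lipschitz_on_nonneg)
  have "Lip_const (glue \<phi> u v) x \<le> Lip_const u x + Lip_const v x + ennreal (L * \<bar>u x - v x\<bar>)"
  proof (rule Lip_const_le_add[of 1])
    fix y
    have "\<bar>\<phi> y - \<phi> x\<bar> \<le> L * dist x y"
      using lipschitz_onD[OF \<phi>(1), of y x] by (simp add: dist_real_def dist_commute)
    then have "\<bar>\<phi> y - \<phi> x\<bar> * \<bar>u x - v x\<bar> \<le> L * dist x y * \<bar>u x - v x\<bar>"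
      by (rule mult_right_mono) simp
    then show "\<bar>glue \<phi> u v y - glue \<phi> u v x\<bar> \<le> \<bar>u y - u x\<bar> + \<bar>v y - v x\<bar> + L * \<bar>u x - v x\<bar> * dist x y"
      using glue_diff[of \<phi> y u v x] \<phi>(2,3)[of y] by (simp add: algebra_simps)
  qed (use L in auto)
  then show ?thesis using L by (simp add: ennreal_mult)
qed

lemma lipschitz_near_glue:
  assumes \<phi>: "L-lipschitz_on UNIV \<phi>" "\<And>x. 0 \<le> \<phi> x" "\<And>x. \<phi> x \<le> 1"
    and u: "lipschitz_near u x" and v: "lipschitz_near v x"
  shows "lipschitz_near (glue \<phi> u v) x"
proof -
  have L: "0 \<le> L" using \<phi>(1) by (rule lipschitz_on_nonneg)
  obtain e1 A where e1: "e1 > 0" "A-lipschitz_on (ball x e1) u"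
    using u unfolding lipschitz_near_def by blast
  obtain e2 B where e2: "e2 > 0" "B-lipschitz_on (ball x e2) v"
    using v unfolding lipschitz_near_def by blast
  define e where "e = min 1 (min e1 e2)"
  have e: "e > 0" "e \<le> 1" "e \<le> e1" "e \<le> e2" using e1 e2 by (auto simp: e_def)
  have AB: "0 \<le> A" "0 \<le> B" using e1 e2 lipschitz_on_nonneg by blast+
  \<comment> \<open>A bound for \<open>\<bar>u - v\<bar>\<close> on the whole ball: the radius is at
    most 1, so \<open>u\<close> and \<open>v\<close> differ from their values at \<open>x\<close> by
    at most \<open>A\<close> and \<open>B\<close>.\<close>
  define D where "D = A + B + \<bar>u x - v x\<bar>"
  have D: "\<bar>u z - v z\<bar> \<le> D" if z: "z \<in> ball x e" for z
  proof -
    have d: "dist z x \<le> 1" using z e by (simp add: dist_commute)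
    have "\<bar>u z - u x\<bar> \<le> A * dist z x"
      using lipschitz_onD[OF e1(2), of z x] z e by (auto simp: dist_real_def)
    also have "\<dots> \<le> A" using mult_left_le[OF d AB(1)] .
    finally have 1: "\<bar>u z - u x\<bar> \<le> A" .
    have "\<bar>v z - v x\<bar> \<le> B * dist z x"
      using lipschitz_onD[OF e2(2), of z x] z e by (auto simp: dist_real_def)
    also have "\<dots> \<le> B" using mult_left_le[OF d AB(2)] .
    finally show ?thesis using 1 by (simp add: D_def)
  qed
  have "(A + B + L * D)-lipschitz_on (ball x e) (glue \<phi> u v)"
  proof (rule lipschitz_onI)
    fix y z assume yz: "y \<in> ball x e" "z \<in> ball x e"
    have "\<bar>u y - u z\<bar> \<le> A * dist y z"
      using lipschitz_onD[OF e1(2), of y z] yz e by (auto simp: dist_real_def)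
    moreover have "\<bar>v y - v z\<bar> \<le> B * dist y z"
      using lipschitz_onD[OF e2(2), of y z] yz e by (auto simp: dist_real_def)
    moreover have "\<bar>\<phi> y - \<phi> z\<bar> * \<bar>u z - v z\<bar> \<le> (L * dist y z) * D"
      using lipschitz_onD[OF \<phi>(1), of y z] D[OF yz(2)] L
      by (intro mult_mono) (auto simp: dist_real_def)
    ultimately have "\<bar>glue \<phi> u v y - glue \<phi> u v z\<bar> \<le> A * dist y z + B * dist y z + (L * dist y z) * D"
      using glue_diff[of \<phi> y u v z] \<phi>(2,3)[of y] by linarith
    then show "dist (glue \<phi> u v y) (glue \<phi> u v z) \<le> (A + B + L * D) * dist y z"
      by (simp add: dist_real_def algebra_simps)
  qed (use AB L in \<open>auto simp: D_def\<close>)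
  then show ?thesis unfolding lipschitz_near_def using e by blast
qed

section \<open>The total variation as an open set function\<close>

context doubling_space
begin

abbreviation TV :: "('a \<Rightarrow> real) \<Rightarrow> 'a set \<Rightarrow> ennreal" where
  "TV \<equiv> total_variation M"

abbreviation lip_energy :: "'a set \<Rightarrow> ('a \<Rightarrow> real) \<Rightarrow> ennreal" where
  "lip_energy A u \<equiv> \<integral>\<^sup>+x\<in>A. Lip_const u x \<partial>M"

abbreviation L1_error :: "'a set \<Rightarrow> ('a \<Rightarrow> real) \<Rightarrow> ('a \<Rightarrow> real) \<Rightarrow> ennreal" where
  "L1_error A u f \<equiv> \<integral>\<^sup>+x\<in>A. ennreal \<bar>u x - f x\<bar> \<partial>M"

abbreviation L1_dist :: "('a \<Rightarrow> real) \<Rightarrow> ('a \<Rightarrow> real) \<Rightarrow> ennreal" where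
  "L1_dist u v \<equiv> \<integral>\<^sup>+x. ennreal \<bar>u x - v x\<bar> \<partial>M"

lemma borel_measurable_M: "borel_measurable M = (borel_measurable borel :: ('a \<Rightarrow> 'b::topological_space) set)"
  by (rule measurable_cong_sets) (simp_all add: sets_M)

lemma measurable_lipschitz: "L-lipschitz_on UNIV F \<Longrightarrow> F \<in> borel_measurable M"
  unfolding borel_measurable_M by (intro borel_measurable_continuous_onI lipschitz_on_continuous_on)

lemma measurable_Lip_const:
  assumes "open U" "locally_lipschitz_on U g"
  shows "(\<lambda>x. Lip_const g x * indicator U x) \<in> borel_measurable M"
  unfolding borel_measurable_M
  using assms by (intro borel_measurable_Lip_const locally_lipschitz_on_continuous)

lemma measurable_diff_on:
  assumes U: "open U" "locally_lipschitz_on U g" and A: "A \<in> sets M" "A \<subseteq> U" and f: "f \<in> borel_measurable M"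
  shows "(\<lambda>x. ennreal \<bar>g x - f x\<bar> * indicator A x) \<in> borel_measurable M"
proof -
  have [measurable]: "f \<in> borel_measurable borel" "A \<in> sets borel"
    using A f by (auto simp: borel_measurable_M sets_M)
  have "continuous_on U g" using U by (intro locally_lipschitz_on_continuous)
  then have [measurable]: "(\<lambda>x. indicator U x *\<^sub>R g x) \<in> borel_measurable borel"
    using U by (intro borel_measurable_continuous_on_indicator) auto
  have "(\<lambda>x. ennreal \<bar>indicator U x *\<^sub>R g x - f x\<bar> * indicator A x) \<in> borel_measurable borel"
    by measurable
  moreover have "(\<lambda>x. ennreal \<bar>indicator U x *\<^sub>R g x - f x\<bar> * indicator A x)
      = (\<lambda>x. ennreal \<bar>g x - f x\<bar> * indicator A x)"
    using A by (auto simp: indicator_def fun_eq_iff)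
  ultimately show ?thesis by (simp add: borel_measurable_M)
qed

text \<open>A liminf below \<open>t\<close> gives infinitely many members of a sequence with energy
  below \<open>t\<close>, while the error on the compact set is eventually below \<open>d\<close>;
  some member has both properties.\<close>

lemma total_variation_lessD:
  assumes V: "TV f U < t" and K: "compact K" "K \<subseteq> U" and d: "0 < d"
  obtains u where "locally_lipschitz_on U u" "lip_energy U u \<le> t"
    "L1_error K u f < ennreal d"
proof -
  from V obtain fn where fn: "\<And>n. locally_lipschitz_on U (fn n)" "L1_loc_converges M U fn f"
     and l: "liminf (\<lambda>n. lip_energy U (fn n)) < t"
    unfolding total_variation_def Inf_less_iff by blast
  have 1: "\<forall>\<^sub>F n in sequentially. L1_error K (fn n) f < ennreal d"
    using fn(2) K d unfolding L1_loc_converges_def by (intro order_tendstoD(2)[of _ 0]) auto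
  have 2: "\<not> (\<forall>\<^sub>F n in sequentially. t \<le> lip_energy U (fn n))"
    using l by (auto dest!: Liminf_bounded)
  have "\<exists>n. L1_error K (fn n) f < ennreal d \<and> lip_energy U (fn n) < t"
  proof (rule ccontr)
    assume *: "\<not> ?thesis"
    from 1 have "\<forall>\<^sub>F n in sequentially. t \<le> lip_energy U (fn n)"
    proof eventually_elim
      case (elim n)
      then show ?case using * by (metis not_less)
    qed
    then show False using 2 by blast
  qed
  then show ?thesis using that fn(1) by (blast intro: less_imp_le)
qed

text \<open>Converse of the preceding extraction: functions chosen for the \<open>n\<close>-th
  compact set of an exhaustion and tolerance \<open>1 / (n + 1)\<close> form an admissible sequence,
  since a compact subset of \<open>U\<close> lies in all late ones. The two lemmas let single
  functions replace sequences in the gluing arguments.\<close>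

lemma total_variation_leI:
  assumes U: "open U"
    and ex: "\<And>K d. compact K \<Longrightarrow> K \<subseteq> U \<Longrightarrow> 0 < d \<Longrightarrow> \<exists>u. locally_lipschitz_on U u \<and>
      lip_energy U u \<le> t \<and> L1_error K u f \<le> ennreal d"
  shows "TV f U \<le> t"
proof -
  obtain W where W: "\<And>i. open (W i)" "\<And>i. compactly_in (W i) (W (Suc i))" "(\<Union>i. W i) = U"
    using exhaustion[OF U] by blast
  have "\<exists>u. locally_lipschitz_on U u \<and> lip_energy U u \<le> t \<and>
      L1_error (closure (W n)) u f \<le> ennreal (1 / real (Suc n))" for n
    using W(2)[of n] W(3) by (intro ex) (auto simp: compactly_in_def)
  then obtain u where u: "\<And>n. locally_lipschitz_on U (u n)" "\<And>n. lip_energy U (u n) \<le> t"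
    "\<And>n. L1_error (closure (W n)) (u n) f \<le> ennreal (1 / real (Suc n))" by metis
  have "L1_loc_converges M U u f"
    unfolding L1_loc_converges_def
  proof (intro allI impI)
    fix K assume K: "compact K \<and> K \<subseteq> U"
    obtain I where I: "finite I" "K \<subseteq> (\<Union>i\<in>I. W i)"
      using K W by (auto intro: compactE_image[of K UNIV W])
    obtain N where N: "\<And>i. i \<in> I \<Longrightarrow> i \<le> N" using I(1) Max_ge by metis
    have KW: "K \<subseteq> closure (W n)" if n: "N \<le> n" for n
    proof
      fix x assume "x \<in> K"
      then obtain i where i: "i \<in> I" "x \<in> W i" using I(2) by blast
      have "W i \<subseteq> W n" using exhaustion_mono[of W, OF W(2)] N[OF i(1)] n by simp
      then show "x \<in> closure (W n)" using i(2) closure_subset by blast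
    qed
    have le: "L1_error K (u n) f \<le> ennreal (1 / real (Suc n))" if n: "N \<le> n" for n
    proof -
      have "L1_error K (u n) f \<le> L1_error (closure (W n)) (u n) f"
        using KW[OF n] by (intro nn_integral_mono) (auto simp: indicator_def)
      then show ?thesis using u(3)[of n] by (rule order_trans)
    qed
    have "(\<lambda>n. ennreal (1 / real (Suc n))) \<longlonglongrightarrow> ennreal 0"
      by (intro tendsto_ennrealI LIMSEQ_Suc[of "\<lambda>n. 1 / real n"] lim_1_over_n)
    then have lim: "(\<lambda>n. ennreal (1 / real (Suc n))) \<longlonglongrightarrow> 0" by simp
    have "\<forall>\<^sub>F n in sequentially. L1_error K (u n) f \<le> ennreal (1 / real (Suc n))"
      using le unfolding eventually_sequentially by blast
    then show "(\<lambda>n. L1_error K (u n) f) \<longlonglongrightarrow> 0"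
      by (intro tendsto_0_le_ennreal[OF lim])
  qed
  moreover have "liminf (\<lambda>n. lip_energy U (u n)) \<le> t"
    by (intro Liminf_le) (auto simp: u)
  ultimately show ?thesis unfolding total_variation_def using u(1)
    by (intro Inf_lower2[of "liminf (\<lambda>n. lip_energy U (u n))"]) auto
qed

lemma total_variation_le_liminf:
  assumes "\<And>n. locally_lipschitz_on U (fn n)" "L1_loc_converges M U fn f"
  shows "TV f U \<le> liminf (\<lambda>n. lip_energy U (fn n))"
  unfolding total_variation_def using assms by (intro Inf_lower CollectI exI[of _ fn] conjI) auto

lemma L1_loc_converges_subset: "L1_loc_converges M V fn f \<Longrightarrow> U \<subseteq> V \<Longrightarrow> L1_loc_converges M U fn f"
  unfolding L1_loc_converges_def by (meson order_trans)

lemma total_variation_mono: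
  assumes "U \<subseteq> V"
  shows "TV f U \<le> TV f V"
  unfolding total_variation_def[of M f V]
proof (rule Inf_greatest, safe)
  fix fn assume fn: "\<forall>n. locally_lipschitz_on V (fn n)" "L1_loc_converges M V fn f"
  have "TV f U \<le> liminf (\<lambda>n. lip_energy U (fn n))"
    using fn locally_lipschitz_on_subset[OF _ assms] L1_loc_converges_subset[OF _ assms]
    by (intro total_variation_le_liminf) auto
  also have "\<dots> \<le> liminf (\<lambda>n. lip_energy V (fn n))"
    using assms by (intro Liminf_mono always_eventually allI nn_integral_mono) (auto simp: indicator_def)
  finally show "TV f U \<le> liminf (\<lambda>n. lip_energy V (fn n))" .
qed

lemma total_variation_empty: "TV f {} = 0"
proof -
  have "TV f {} \<le> 0"
    by (rule total_variation_leI) (auto intro!: exI[of _ "\<lambda>_. 0"] simp: locally_lipschitz_on_def)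
  then show ?thesis by simp
qed

text \<open>A sequence admissible on the union is admissible on each part, its energies add up, and
  the liminf is superadditive.\<close>

lemma total_variation_superadd:
  assumes UV: "open U" "open V" "U \<inter> V = {}"
  shows "TV f U + TV f V \<le> TV f (U \<union> V)"
  unfolding total_variation_def[of M f "U \<union> V"]
proof (rule Inf_greatest, safe)
  fix fn assume fn: "\<forall>n. locally_lipschitz_on (U \<union> V) (fn n)" "L1_loc_converges M (U \<union> V) fn f"
  have le: "TV f W \<le> liminf (\<lambda>n. lip_energy W (fn n))" if W: "W \<subseteq> U \<union> V" for W
    using fn locally_lipschitz_on_subset[OF _ W] L1_loc_converges_subset[OF _ W]
    by (intro total_variation_le_liminf) auto
  have "lip_energy (U \<union> V) (fn n)
      = lip_energy U (fn n) + lip_energy V (fn n)" for n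
  proof -
    have "locally_lipschitz_on U (fn n)" "locally_lipschitz_on V (fn n)"
      using fn(1) locally_lipschitz_on_subset[of "U \<union> V"] by auto
    then have "lip_energy U (fn n) + lip_energy V (fn n)
      = (\<integral>\<^sup>+x. Lip_const (fn n) x * indicator U x + Lip_const (fn n) x * indicator V x \<partial>M)"
      using UV by (intro nn_integral_add[symmetric] measurable_Lip_const)
    also have "\<dots> = lip_energy (U \<union> V) (fn n)"
      using UV(3) by (intro nn_integral_cong) (auto simp: indicator_def)
    finally show ?thesis by simp
  qed
  then have "liminf (\<lambda>n. lip_energy (U \<union> V) (fn n)) \<ge>
      liminf (\<lambda>n. lip_energy U (fn n)) + liminf (\<lambda>n. lip_energy V (fn n))"
    using liminf_add_le_ennreal by simp
  then show "TV f U + TV f V \<le> liminf (\<lambda>n. lip_energy (U \<union> V) (fn n))"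
    using le[of U] le[of V] by (meson add_mono order_trans sup_ge1 sup_ge2)
qed

end

section \<open>Subadditivity and inner regularity of the total variation\<close>

text \<open>The mismatch of \<open>u\<close> and \<open>v\<close> is split through \<open>c\<close>,
  which will be \<open>f x\<close>: only the distances of \<open>u\<close> and \<open>v\<close> to
  the limit function are under control.\<close>

lemma Lip_const_glue_via:
  assumes \<phi>: "L-lipschitz_on UNIV \<phi>" "\<And>x. 0 \<le> \<phi> x" "\<And>x. \<phi> x \<le> 1"
  shows "Lip_const (glue \<phi> u v) x
    \<le> Lip_const u x + Lip_const v x + ennreal L * (ennreal \<bar>u x - c\<bar> + ennreal \<bar>v x - c\<bar>)"
proof (rule order_trans[OF Lip_const_glue[OF \<phi>]])
  show "Lip_const u x + Lip_const v x + ennreal L * ennreal \<bar>u x - v x\<bar>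
    \<le> Lip_const u x + Lip_const v x + ennreal L * (ennreal \<bar>u x - c\<bar> + ennreal \<bar>v x - c\<bar>)"
    by (intro add_left_mono mult_left_mono ennreal_abs_triangle) auto
qed

context doubling_space
begin

text \<open>Subadditivity with a loss of domain. Near-optimal functions are close to
  \<open>f\<close> only on compact subsets of \<open>A\<close> and \<open>B\<close>, so the
  transition and the error estimate must take place on such sets, which the passage to
  \<open>A'\<close> and \<open>B'\<close> ensures.\<close>

lemma total_variation_glue:
  assumes f: "f \<in> borel_measurable M"
    and A: "open A" "open A'" "compactly_in A' A" and B: "open B" "open B'" "compactly_in B' B"
  shows "TV f (A' \<union> B') \<le> TV f A + TV f B"
proof (rule ennreal_le_epsilon)
  fix e :: real assume e: "0 < e" and fin: "TV f A + TV f B < top"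
  have cA: "compact (closure A')" "closure A' \<subseteq> A" and cB: "compact (closure B')" "closure B' \<subseteq> B"
    using A B by (auto simp: compactly_in_def)
  obtain \<phi> L P F where cut: "cutoff (closure A') A \<phi> L P F"
    using cutoff_exists[OF cA(1) A(1) cA(2)] by blast
  note \<phi> = cutoffD(1-3)[OF cut] and P = cutoffD(4-6)[OF cut] and F = cutoffD(7-9)[OF cut]
    and L = cutoffD(10)[OF cut]
  \<comment> \<open>\<open>K2\<close> contains the part of the transition region that meets
    \<open>B'\<close>; \<open>K1\<close> is a compact subset of \<open>A\<close> that contains every
    point of \<open>A' \<union> B'\<close> at which \<open>u\<close> has positive weight.\<close>
  define K2 where "K2 = F \<inter> closure B'"
  define K1 where "K1 = closure A' \<union> K2"
  have K: "compact K1" "compact K2" "K1 \<subseteq> A" "K2 \<subseteq> K1" "K2 \<subseteq> closure B'"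
    using cA cB F closed_Int_compact[OF F(1) cB(1)] by (auto simp: K1_def K2_def)
  have smeas: "K1 \<in> sets M" "closure B' \<in> sets M" "K2 \<in> sets M"
    using K cB by (auto simp: sets_M intro: borel_compact)
  have A'F: "A' \<subseteq> F" using P F(3) closure_subset[of A'] by force
  show "TV f (A' \<union> B') \<le> TV f A + TV f B + ennreal e"
  proof (rule total_variation_leI)
    show "open (A' \<union> B')" using A B by auto
    fix K :: "'a set" and d :: real assume Kd: "compact K" "K \<subseteq> A' \<union> B'" "0 < d"
    \<comment> \<open>\<open>2 * \<delta> \<le> d\<close> serves the error budget and
      \<open>L * (2 * \<delta>) \<le> e / 3\<close> the cutoff term; \<open>L + 1\<close> keeps the
      denominator positive.\<close>
    define \<delta> where "\<delta> = min (d / 2) (e / (6 * (L + 1)))"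
    have "0 < \<delta>" using Kd e L by (simp add: \<delta>_def)
    moreover have "\<delta> \<le> d / 2" unfolding \<delta>_def by (rule min.cobounded1)
    ultimately have \<delta>: "0 < \<delta>" "2 * \<delta> \<le> d" by auto
    have L\<delta>: "L * (2 * \<delta>) \<le> e / 3"
    proof -
      have "L * (2 * \<delta>) \<le> (L + 1) * (2 * (e / (6 * (L + 1))))"
        using L \<delta>(1) by (intro mult_mono) (auto simp: \<delta>_def)
      also have "\<dots> = e / 3" using L by (simp add: field_simps)
      finally show ?thesis .
    qed
    have lt: "TV f S < TV f S + ennreal (e / 3)" if "TV f S < top" for S
      using that e by (intro ennreal_less_add) auto
    have fA: "TV f A < top" and fB: "TV f B < top"
      using fin by (auto simp: less_top)
    obtain u where u: "locally_lipschitz_on A u"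
       "lip_energy A u \<le> TV f A + ennreal (e / 3)"
       "L1_error K1 u f < ennreal \<delta>"
      using total_variation_lessD[OF lt[OF fA] K(1,3) \<delta>(1)] by blast
    obtain v where v: "locally_lipschitz_on B v"
       "lip_energy B v \<le> TV f B + ennreal (e / 3)"
       "L1_error (closure B') v f < ennreal \<delta>"
      using total_variation_lessD[OF lt[OF fB] cB \<delta>(1)] by blast
    note [measurable] = measurable_diff_on[OF A(1) u(1) smeas(1) K(3) f]
      measurable_diff_on[OF B(1) v(1) smeas(2) cB(2) f]
      measurable_Lip_const[OF A(1) u(1)] measurable_Lip_const[OF B(1) v(1)]
    let ?E = "\<lambda>x. ennreal \<bar>u x - f x\<bar> * indicator K1 x + ennreal \<bar>v x - f x\<bar> * indicator (closure B') x"
    have sumdiff: "(\<integral>\<^sup>+x. ?E x \<partial>M)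
        \<le> ennreal (2 * \<delta>)"
    proof -
      have "(\<integral>\<^sup>+x. ?E x \<partial>M)
       = L1_error K1 u f + L1_error (closure B') v f"
        by (rule nn_integral_add) measurable
      also have "\<dots> \<le> ennreal \<delta> + ennreal \<delta>" using u(3) v(3) by (intro add_mono) auto
      also have "\<dots> = ennreal (2 * \<delta>)" using \<delta> by (simp add: ennreal_plus[symmetric] del: ennreal_plus)
      finally show ?thesis .
    qed
    let ?w = "glue \<phi> u v"
    have B'I: "x \<in> B'" "x \<in> B" if "x \<in> A' \<union> B'" "x \<notin> P \<or> x \<notin> F" for x
      using that P(2) A'F closure_subset[of A'] closure_subset[of B'] cB(2) by auto
    have w: "locally_lipschitz_on (A' \<union> B') ?w"
      unfolding locally_lipschitz_on_iff[OF open_Un[OF A(2) B(2)]]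
    proof
      fix x assume x: "x \<in> A' \<union> B'"
      have u': "lipschitz_near u x" if "x \<in> A" using that u(1) A(1) by (simp add: locally_lipschitz_on_iff)
      have v': "lipschitz_near v x" if "x \<in> B" using that v(1) B(1) by (simp add: locally_lipschitz_on_iff)
      \<comment> \<open>Off \<open>F\<close> the glued function is \<open>v\<close> on an open set,
        on \<open>P\<close> it is \<open>u\<close>; a point of the remaining ring lies in both
        \<open>A\<close> and \<open>B\<close>, so both pieces may be used.\<close>
      consider "x \<notin> F" | "x \<in> P" "x \<in> F" | "x \<in> F" "x \<notin> P" by blast
      then show "lipschitz_near ?w x"
      proof cases
        case 1
        then show ?thesis using F B'I[OF x] v'
          by (intro lipschitz_near_cong[of "- F" x ?w v]) (auto simp: glue_simps)
      next
        case 2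
        then show ?thesis using P u' F(2)
          by (intro lipschitz_near_cong[of P x ?w u]) (auto simp: glue_simps)
      next
        case 3
        then show ?thesis using \<phi> u' v' F(2) B'I[OF x] by (intro lipschitz_near_glue[of L]) auto
      qed
    qed
    have Lw: "Lip_const ?w x \<le> Lip_const u x * indicator A x + Lip_const v x * indicator B x
        + ennreal L * ?E x"
      if x: "x \<in> A' \<union> B'" for x
    proof -
      consider "x \<notin> F" | "x \<in> P" "x \<in> F" | "x \<in> F" "x \<notin> P" by blast
      then show ?thesis
      proof cases
        case 1
        then have "Lip_const ?w x = Lip_const v x" using F
          by (intro Lip_const_cong[of "- F"]) (auto simp: glue_simps)
        also have "\<dots> = Lip_const v x * indicator B x" using B'I[OF x] 1 by simp
        finally show ?thesis by (simp add: add_increasing add_increasing2)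
      next
        case 2
        then have "Lip_const ?w x = Lip_const u x" using P
          by (intro Lip_const_cong[of P]) (auto simp: glue_simps)
        also have "\<dots> = Lip_const u x * indicator A x" using 2 F(2) by auto
        finally show ?thesis by (simp add: add_increasing add_increasing2 add.assoc)
      next
        case 3
        then have x': "x \<in> A" "x \<in> B" "x \<in> K1" "x \<in> closure B'"
          using F(2) B'I[OF x] closure_subset[of B'] by (auto simp: K1_def K2_def)
        show ?thesis using Lip_const_glue_via[OF \<phi>, where u = u and v = v and x = x and c = "f x"] x' by simp
      qed
    qed
    have "(\<integral>\<^sup>+x\<in>A' \<union> B'. Lip_const ?w x \<partial>M) \<le> (\<integral>\<^sup>+x. (Lip_const u x * indicator A x + Lip_const v x * indicator B x)
        + ennreal L * ?E x \<partial>M)"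
      using Lw by (intro nn_integral_mono) (auto simp: indicator_def[of "A' \<union> B'"])
    also have "\<dots> = lip_energy A u + lip_energy B v
       + ennreal L * (\<integral>\<^sup>+x. ?E x \<partial>M)"
      by (subst nn_integral_add, measurable, subst nn_integral_add, measurable, subst nn_integral_cmult, measurable)
    also have "\<dots> \<le> (TV f A + ennreal (e / 3)) + (TV f B + ennreal (e / 3))
        + ennreal L * ennreal (2 * \<delta>)"
      using u(2) v(2) sumdiff by (intro add_mono mult_left_mono) auto
    also have "ennreal L * ennreal (2 * \<delta>) \<le> ennreal (e / 3)"
      using L\<delta> L \<delta>(1) by (subst ennreal_mult[symmetric]) (auto intro: ennreal_leI)
    also have "(TV f A + ennreal (e / 3)) + (TV f B + ennreal (e / 3)) + ennreal (e / 3)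
       = TV f A + TV f B + (ennreal (e / 3) + ennreal (e / 3) + ennreal (e / 3))"
      by (simp only: ac_simps)
    also have "ennreal (e / 3) + ennreal (e / 3) + ennreal (e / 3) = ennreal e" using e by (rule ennreal_thirds)
    finally have I: "(\<integral>\<^sup>+x\<in>A' \<union> B'. Lip_const ?w x \<partial>M) \<le> TV f A + TV f B + ennreal e"
      by (simp add: add_left_mono)
    have "ennreal \<bar>?w x - f x\<bar> * indicator K x
      \<le> ?E x" for x
    proof (cases "x \<in> K")
      case True
      then have x: "x \<in> A' \<union> B'" using Kd by auto
      have "\<bar>?w x - f x\<bar> \<le> \<phi> x * \<bar>u x - f x\<bar> + (1 - \<phi> x) * \<bar>v x - f x\<bar>"
        using \<phi> by (intro glue_error) auto
      also have "\<dots> \<le> \<bar>u x - f x\<bar> * indicator K1 x + \<bar>v x - f x\<bar> * indicator (closure B') x"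
      proof (rule add_mono)
        have "x \<in> K1" if "\<phi> x \<noteq> 0" using that F(3)[of x] x closure_subset[of A'] closure_subset[of B']
          by (auto simp: K1_def K2_def)
        then show "\<phi> x * \<bar>u x - f x\<bar> \<le> \<bar>u x - f x\<bar> * indicator K1 x"
          using \<phi>(2,3)[of x] by (cases "\<phi> x = 0") (auto intro: mult_left_le_one_le)
        have "x \<in> closure B'" if "\<phi> x \<noteq> 1" using that P(3)[of x] B'I[OF x] closure_subset[of B'] by auto
        then show "(1 - \<phi> x) * \<bar>v x - f x\<bar> \<le> \<bar>v x - f x\<bar> * indicator (closure B') x"
          using \<phi>(2,3)[of x] by (cases "\<phi> x = 1") (auto intro: mult_left_le_one_le)
      qed
      finally have "ennreal \<bar>?w x - f x\<bar> \<le> ennreal (\<bar>u x - f x\<bar> * indicator K1 x + \<bar>v x - f x\<bar> * indicator (closure B') x)"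
        by (rule ennreal_leI)
      then show ?thesis using True by (simp add: ennreal_plus ennreal_mult ennreal_indicator)
    qed simp
    then have "(\<integral>\<^sup>+x\<in>K. ennreal \<bar>?w x - f x\<bar> \<partial>M)
      \<le> (\<integral>\<^sup>+x. ?E x \<partial>M)"
      by (rule nn_integral_mono)
    also have "\<dots> \<le> ennreal (2 * \<delta>)" by (rule sumdiff)
    also have "\<dots> \<le> ennreal d" using \<delta> by (intro ennreal_leI) auto
    finally have "(\<integral>\<^sup>+x\<in>K. ennreal \<bar>?w x - f x\<bar> \<partial>M) \<le> ennreal d" .
    from w I this show "\<exists>u. locally_lipschitz_on (A' \<union> B') u \<and>
      lip_energy (A' \<union> B') u \<le> TV f A + TV f B + ennreal e \<and>
      L1_error K u f \<le> ennreal d" by (intro exI[of _ ?w] conjI)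
  qed
qed

text \<open>Near-optimal functions on overlapping rings are glued along cutoffs. The factor 2 is harmless
  because the lemma is applied to tails of an exhaustion, where the sum is small.\<close>

lemma total_variation_exhaustion:
  assumes f: "f \<in> borel_measurable M"
    and W: "\<And>i. open (W i)" "\<And>i. compactly_in (W i) (W (Suc i))" "(\<Union>i. W i) = U"
  shows "TV f U \<le> TV f (W 3)
     + 2 * (\<Sum>i. TV f (W (i + 4) - closure (W i)))"
proof (rule ennreal_le_epsilon)
  let ?T = "\<Sum>i. TV f (W (i + 4) - closure (W i))"
  fix e :: real assume e: "0 < e"
    and fin: "TV f (W 3) + 2 * ?T < top"
  have Wmono: "W i \<subseteq> W j" if "i \<le> j" for i j using exhaustion_mono[of W, OF W(2) that] .
  have Wcl: "compact (closure (W i))" "closure (W i) \<subseteq> W (Suc i)" "W i \<subseteq> closure (W i)" for i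
    using W(2)[of i] closure_subset[of "W i"] by (auto simp: compactly_in_def)
  have U: "open U" using W by blast
  \<comment> \<open>\<open>u i\<close> will live on the open ring \<open>Q i\<close> and be
    controlled on the compact ring \<open>K i\<close>, while the \<open>D i\<close> partition
    \<open>U\<close>. On \<open>D i\<close> the glued function passes from \<open>u i\<close> to
    \<open>u (Suc i)\<close>, between \<open>W (i + 1)\<close> and the complement of
    \<open>W (i + 2)\<close>.\<close>
  define Q where "Q i = (case i of 0 \<Rightarrow> W 3 | Suc j \<Rightarrow> W (j + 4) - closure (W j))" for i
  define K where "K i = (case i of 0 \<Rightarrow> closure (W 2) | Suc j \<Rightarrow> closure (W (j + 3)) - W (j + 1))" for i
  define D where "D i = (case i of 0 \<Rightarrow> W 2 | Suc j \<Rightarrow> W (j + 3) - W (j + 2))" for i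
  have Qop: "open (Q i)" for i using W by (auto simp: Q_def split: nat.split)
  have Kc: "compact (K i)" for i
    using W Wcl by (auto simp: K_def compact_diff split: nat.split)
  have KQ: "K i \<subseteq> Q i" for i
    using Wcl(2)[of 2] Wcl(2)[of "_ + 3"] Wcl(2) 
    by (auto simp: K_def Q_def numeral_eq_Suc split: nat.split)
  have Km: "K i \<in> sets M" for i using Kc by (auto simp: sets_M intro: borel_compact)
  have Dm: "D i \<in> sets M" for i using W by (auto simp: D_def sets_M split: nat.split)
  have DK: "D i \<subseteq> K i" for i
  proof (cases i)
    case (Suc j)
    show ?thesis using Wcl(3)[of "j + 3"] Wmono[of "j + 1" "j + 2"] by (auto simp: D_def K_def Suc)
  qed (use Wcl(3)[of 2] in \<open>auto simp: D_def K_def\<close>)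
  have DW: "D i \<subseteq> W (i + 2)" for i by (auto simp: D_def numeral_eq_Suc split: nat.split)
  have DK': "x \<in> K (Suc i)" if "x \<in> D i" "x \<notin> W (Suc i)" for i x
    using that Wcl(3)[of "i + 3"] Wmono[of "i + 2" "i + 3"] DW[of i] by (auto simp: K_def)
  have DU: "(\<Union>i. D i) = U"
  proof
    show "(\<Union>i. D i) \<subseteq> U" using DW W(3) by blast
    have "W (i + 2) \<subseteq> (\<Union>i. D i)" for i
    proof (induction i)
      case 0
      have "D 0 = W 2" by (simp add: D_def)
      then show ?case by (metis UN_upper UNIV_I add_0)
    next
      case (Suc i)
      have "D (Suc i) = W (Suc i + 2) - W (i + 2)" by (simp add: D_def numeral_eq_Suc)
      then show ?case using Suc by blast
    qed
    then show "U \<subseteq> (\<Union>i. D i)" using W(3) Wmono[of _ "_ + 2"] by (metis (no_types, lifting) SUP_le_iff le_add1 order_trans)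
  qed
  have Ddisj: "disjoint_family D"
  proof -
    have *: "D i \<inter> D j = {}" if ij: "i < j" for i j
    proof -
      obtain k where k: "j = Suc k" "i \<le> k" using ij by (cases j) auto
      have "D i \<subseteq> W (k + 2)" using DW[of i] Wmono[of "i + 2" "k + 2"] k by auto
      then show ?thesis unfolding k D_def[of "Suc k"] by auto
    qed
    then show ?thesis unfolding disjoint_family_on_def
      by (metis Int_commute linorder_neqE_nat)
  qed
  have "\<forall>i. \<exists>\<phi> L P F. cutoff (closure (W (i + 1))) (W (i + 2)) \<phi> L P F"
    using cutoff_exists[OF Wcl(1) W(1)] Wcl(2)[of "_ + 1"] by simp
  then obtain \<phi> L P F where cut: "\<And>i. cutoff (closure (W (i + 1))) (W (i + 2)) (\<phi> i) (L i) (P i) (F i)"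
    by metis
  note \<phi> = cutoffD(1-3)[OF cut] and P = cutoffD(4-6)[OF cut] and F = cutoffD(7-9)[OF cut]
    and L = cutoffD(10)[OF cut] and PF = cutoffD(11)[OF cut]
  have WP: "W (i + 1) \<subseteq> P i" for i using P(2)[of i] Wcl(3)[of "i + 1"] by blast
  \<comment> \<open>\<open>N i\<close> is an open set around \<open>D i\<close> on which one formula
    describes the glued function: removing \<open>F j\<close> leaves only points at which the
    preceding cutoff vanishes.\<close>
  define N where "N i = (case i of 0 \<Rightarrow> W 2 | Suc j \<Rightarrow> W (j + 3) - F j)" for i
  have Nop: "open (N i)" for i using W F(1) by (auto simp: N_def split: nat.split)
  have DN: "D i \<subseteq> N i" for i using F(2) by (force simp: D_def N_def split: nat.split)
  have NW: "N i \<subseteq> W (i + 2)" for i by (auto simp: N_def numeral_eq_Suc split: nat.split)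
  define \<epsilon> where "\<epsilon> i = e / 3 * (1 / 2) ^ Suc i" for i
  \<comment> \<open>\<open>u (Suc i)\<close> takes part in the transitions of both
    \<open>\<phi> i\<close> and \<open>\<phi> (Suc i)\<close>, so its tolerance must beat both
    Lipschitz constants; a running sum bounds them at once.\<close>
  define \<Lambda> where "\<Lambda> i = 1 + (\<Sum>j\<le>i. L j)" for i :: nat
  have \<Lambda>: "1 \<le> \<Lambda> i" "L i \<le> \<Lambda> i" "L i \<le> \<Lambda> (Suc i)" for i
  proof -
    show "1 \<le> \<Lambda> i" using L by (simp add: \<Lambda>_def sum_nonneg)
    have 1: "L i \<le> (\<Sum>j\<le>i. L j)" using L by (intro member_le_sum) auto
    then show "L i \<le> \<Lambda> i" by (simp add: \<Lambda>_def)
    show "L i \<le> \<Lambda> (Suc i)" using 1 L[of "Suc i"] by (simp add: \<Lambda>_def)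
  qed
  have \<epsilon>: "0 < \<epsilon> i" for i using e by (simp add: \<epsilon>_def)
  have \<epsilon>_sum: "(\<Sum>i. ennreal (\<epsilon> i)) = ennreal (e / 3)"
  proof -
    have "(\<lambda>i. e / 3 * (1 / 2) ^ Suc i) sums (e / 3 * 1)" by (intro sums_mult power_half_series)
    then show ?thesis using \<epsilon> unfolding \<epsilon>_def[symmetric]
      by (intro suminf_ennreal_eq) (auto simp: less_imp_le)
  qed
  have sum_fin: "TV f (W 3) < top" "?T < top"
    using fin by (auto simp: mult_2 less_top)
  have Qfin: "TV f (Q i) < top" for i
  proof (cases i)
    case (Suc j)
    have "TV f (W (j + 4) - closure (W j)) \<le> ?T"
      using sum_le_suminf[of "\<lambda>i. TV f (W (i + 4) - closure (W i))" "{j}"] by auto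
    then show ?thesis using sum_fin Suc by (simp add: Q_def)
  qed (simp add: Q_def sum_fin)
  show "TV f U \<le> TV f (W 3)
     + 2 * ?T + ennreal e"
  proof (rule total_variation_leI[OF U])
    fix K0 :: "'a set" and d :: real assume Kd: "compact K0" "K0 \<subseteq> U" "0 < d"
    \<comment> \<open>The factor 2 leaves half of \<open>\<epsilon> i\<close> for each of the two
      functions mixed by \<open>\<phi> i\<close>; the second entry of the minimum keeps the sum of
      all errors at most \<open>d\<close>.\<close>
    define \<delta> where "\<delta> i = min (\<epsilon> i) (d * (1 / 2) ^ Suc i) / (2 * \<Lambda> i)" for i
    have \<delta>: "0 < \<delta> i" for i using \<epsilon>[of i] Kd(3) \<Lambda>(1)[of i] by (simp add: \<delta>_def)
    have \<delta>d: "2 * \<delta> i \<le> d * (1 / 2) ^ Suc i" for i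
    proof -
      have "2 * \<delta> i = min (\<epsilon> i) (d * (1 / 2) ^ Suc i) / \<Lambda> i" by (simp add: \<delta>_def)
      also have "\<dots> \<le> min (\<epsilon> i) (d * (1 / 2) ^ Suc i) / 1"
        using \<Lambda>(1)[of i] \<epsilon>[of i] Kd(3) by (intro divide_left_mono) auto
      finally show ?thesis by simp
    qed
    have \<delta>\<epsilon>: "l * \<delta> i \<le> \<epsilon> i / 2" if "0 \<le> l" "l \<le> \<Lambda> i" for l i
    proof -
      have "l * \<delta> i \<le> \<Lambda> i * \<delta> i" using \<delta>[of i] that by (intro mult_right_mono) auto
      also have "\<dots> = min (\<epsilon> i) (d * (1 / 2) ^ Suc i) / 2" using \<Lambda>(1)[of i] by (simp add: \<delta>_def)
      also have "\<dots> \<le> \<epsilon> i / 2" by simp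
      finally show ?thesis .
    qed
    have "\<exists>u. locally_lipschitz_on (Q i) u \<and>
       lip_energy (Q i) u \<le> TV f (Q i) + ennreal (\<epsilon> i) \<and>
       L1_error (K i) u f \<le> ennreal (\<delta> i)" for i
    proof -
      have "TV f (Q i) < TV f (Q i) + ennreal (\<epsilon> i)" by (rule ennreal_less_add[OF Qfin \<epsilon>])
      from total_variation_lessD[OF this Kc[of i] KQ[of i] \<delta>[of i]] show ?thesis
        by (blast intro: less_imp_le)
    qed
    then have "\<forall>i. \<exists>u. locally_lipschitz_on (Q i) u \<and>
       lip_energy (Q i) u \<le> TV f (Q i) + ennreal (\<epsilon> i) \<and>
       L1_error (K i) u f \<le> ennreal (\<delta> i)" by (rule allI)
    from choice[OF this] obtain u where u: "\<And>i. locally_lipschitz_on (Q i) (u i)"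
       "\<And>i. lip_energy (Q i) (u i) \<le> TV f (Q i) + ennreal (\<epsilon> i)"
       "\<And>i. L1_error (K i) (u i) f \<le> ennreal (\<delta> i)" by blast
    have un: "lipschitz_near (u i) x" if "x \<in> Q i" for i x
      using u(1)[of i] that by (simp add: locally_lipschitz_on_iff Qop)
    let ?g = "\<lambda>i. glue (\<phi> i) (u i) (u (Suc i))"
    \<comment> \<open>The index of the piece \<open>D i\<close> that contains \<open>x\<close>. On
      \<open>N i\<close> it is \<open>i\<close> or one less; in the latter case the preceding cutoff
      vanishes and \<open>\<phi> i\<close> equals 1, so both formulas give
      \<open>u i\<close>.\<close>
    define idx where "idx x = (LEAST i. x \<in> W (i + 2))" for x
    define w where "w x = ?g (idx x) x" for x
    have wg: "w x = ?g i x" if x: "x \<in> N i" for x i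
    proof -
      have xW: "x \<in> W (i + 2)" using x NW by blast
      then have idx: "x \<in> W (idx x + 2)" "idx x \<le> i"
        unfolding idx_def by (auto intro: LeastI Least_le)
      show ?thesis
      proof (cases "idx x = i")
        case False
        then obtain j where j: "i = Suc j" "idx x \<le> j" using idx by (cases i) auto
        have xF: "x \<notin> F j" using x by (simp add: N_def j)
        then have "x \<notin> W (j + 1)" using WP[of j] PF[of j] by blast
        then have "idx x = j" using idx(1) j Wmono[of "idx x + 2" "j + 1"] by (cases "idx x = j") auto
        then have "w x = u i x" using F(3)[OF xF] by (simp add: w_def glue_simps j)
        moreover have "x \<in> P i" using idx(1) WP[of i] \<open>idx x = j\<close> j by auto
        ultimately show ?thesis using P(3) by (simp add: glue_simps)
      qed (simp add: w_def)
    qed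
    have DQ: "x \<in> Q i" if "x \<in> D i" for x i using that DK KQ by blast
    have near: "x \<in> P i \<or> (x \<in> Q (Suc i) \<and> x \<in> K (Suc i))" if "x \<in> D i" for x i
      using that DK'[of x i] WP[of i] KQ[of "Suc i"] by auto
    have wl: "locally_lipschitz_on U w"
    proof (unfold locally_lipschitz_on_iff[OF U], rule ballI)
      fix x assume "x \<in> U"
      then obtain i where i: "x \<in> D i" using DU by blast
      have "lipschitz_near (?g i) x"
      proof (cases "x \<in> P i")
        case True
        then show ?thesis using P un[OF DQ[OF i]]
          by (intro lipschitz_near_cong[of "P i" x "?g i" "u i"]) (auto simp: glue_simps)
      next
        case False
        then show ?thesis using \<phi> un[OF DQ[OF i]] un[of x "Suc i"] near[OF i]
          by (intro lipschitz_near_glue[of "L i"]) auto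
      qed
      then show "lipschitz_near w x"
        using wg DN i by (intro lipschitz_near_cong[OF Nop, of x i w "?g i"]) auto
    qed
    let ?E = "\<lambda>i x. ennreal \<bar>u i x - f x\<bar> * indicator (K i) x"
    let ?I = "\<lambda>i x. Lip_const (u i) x * indicator (Q i) x"
    have [measurable]: "?E i \<in> borel_measurable M" "?I i \<in> borel_measurable M" for i
      using measurable_diff_on[OF Qop u(1) Km KQ f] measurable_Lip_const[OF Qop u(1)] by auto
    have Lw: "Lip_const w x \<le> ?I i x + ?I (Suc i) x + ennreal (L i) * (?E i x + ?E (Suc i) x)"
      if x: "x \<in> D i" for x i
    proof -
      have "Lip_const w x = Lip_const (?g i) x"
        using wg DN x by (intro Lip_const_cong[OF Nop, of x i]) auto
      also have "\<dots> \<le> ?I i x + ?I (Suc i) x + ennreal (L i) * (?E i x + ?E (Suc i) x)"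
      proof (cases "x \<in> P i")
        case True
        have "Lip_const (?g i) x = Lip_const (u i) x" using P True
          by (intro Lip_const_cong[of "P i"]) (auto simp: glue_simps)
        then show ?thesis using DQ[OF x] by (simp add: add_increasing2 add.assoc)
      next
        case False
        then have x': "x \<in> Q i" "x \<in> Q (Suc i)" "x \<in> K i" "x \<in> K (Suc i)"
          using near[OF x] DQ[OF x] DK[of i] x by auto
        show ?thesis using Lip_const_glue_via[OF \<phi>, where u = "u i" and v = "u (Suc i)" and x = x and c = "f x"] x' by simp
      qed
      finally show ?thesis .
    qed
    define J where "J i = (\<integral>\<^sup>+x. ?I i x \<partial>M)" for i
    have J: "J i \<le> TV f (Q i) + ennreal (\<epsilon> i)" for i using u(2)[of i] by (simp add: J_def)
    have LE: "ennreal (L i) * ((\<integral>\<^sup>+x. ?E i x \<partial>M) + (\<integral>\<^sup>+x. ?E (Suc i) x \<partial>M)) \<le> ennreal (\<epsilon> i)" for i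
    proof -
      have "ennreal (L i) * ((\<integral>\<^sup>+x. ?E i x \<partial>M) + (\<integral>\<^sup>+x. ?E (Suc i) x \<partial>M))
        \<le> ennreal (L i) * (ennreal (\<delta> i) + ennreal (\<delta> (Suc i)))"
        using u(3) by (intro mult_left_mono add_mono) auto
      also have "\<dots> = ennreal (L i * \<delta> i + L i * \<delta> (Suc i))"
        using L[of i] \<delta>[of i] \<delta>[of "Suc i"]
        by (simp add: distrib_left ennreal_mult less_imp_le)
      also have "\<dots> \<le> ennreal (\<epsilon> i)"
      proof (rule ennreal_leI)
        have "\<epsilon> (Suc i) \<le> \<epsilon> i" using e by (simp add: \<epsilon>_def)
        then show "L i * \<delta> i + L i * \<delta> (Suc i) \<le> \<epsilon> i"
          using \<delta>\<epsilon>[of "L i" i] \<delta>\<epsilon>[of "L i" "Suc i"] L[of i] \<Lambda>[of i] by auto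
      qed
      finally show ?thesis .
    qed
    have decomp: "(\<integral>\<^sup>+x\<in>U. h x \<partial>M) = (\<Sum>i. \<integral>\<^sup>+x\<in>D i. h x \<partial>M)"
      if h: "(\<lambda>x. h x * indicator U x) \<in> borel_measurable M" for h :: "'a \<Rightarrow> ennreal"
    proof -
      have "(\<integral>\<^sup>+x\<in>(\<Union>i. D i). (h x * indicator U x) \<partial>M) = (\<Sum>i. \<integral>\<^sup>+x\<in>D i. (h x * indicator U x) \<partial>M)"
        by (rule nn_integral_disjoint_family[OF h Dm Ddisj])
      moreover have "h x * indicator U x * indicator (\<Union>i. D i) x = h x * indicator U x" for x
        by (simp add: DU indicator_def)
      moreover have "h x * indicator U x * indicator (D i) x = h x * indicator (D i) x" for x i
        using DU by (auto simp: indicator_def)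
      ultimately show ?thesis by simp
    qed
    have "lip_energy U w = (\<Sum>i. lip_energy (D i) w)"
      by (rule decomp[OF measurable_Lip_const[OF U wl]])
    also have "\<dots> \<le> (\<Sum>i. J i + J (Suc i) + ennreal (\<epsilon> i))"
    proof (intro suminf_le)
      fix i
      have "lip_energy (D i) w \<le> (\<integral>\<^sup>+x. ?I i x + ?I (Suc i) x + ennreal (L i) * (?E i x + ?E (Suc i) x) \<partial>M)"
        using Lw[of _ i] by (intro nn_integral_mono) (auto simp: indicator_def[of "D i"])
      also have "\<dots> = J i + J (Suc i) + ennreal (L i) * ((\<integral>\<^sup>+x. ?E i x \<partial>M) + (\<integral>\<^sup>+x. ?E (Suc i) x \<partial>M))"
        unfolding J_def
        by (subst nn_integral_add, measurable, subst nn_integral_add, measurable, subst nn_integral_cmult, measurable,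
            subst nn_integral_add, measurable)
      also have "\<dots> \<le> J i + J (Suc i) + ennreal (\<epsilon> i)" by (intro add_left_mono LE)
      finally show "lip_energy (D i) w \<le> J i + J (Suc i) + ennreal (\<epsilon> i)" .
    qed auto
    also have "\<dots> = (\<Sum>i. J i) + (\<Sum>i. J (Suc i)) + ennreal (e / 3)"
      by (simp add: suminf_add[symmetric] \<epsilon>_sum)
    \<comment> \<open>Each \<open>J (Suc i)\<close> occurs for two neighbouring pieces,
      \<open>J 0\<close> for one only: this is the origin of the factor 2.\<close>
    also have "(\<Sum>i. J i) = J 0 + (\<Sum>i. J (Suc i))"
      using suminf_offset[of J 1] by (simp add: add.commute)
    also have "J 0 + (\<Sum>i. J (Suc i)) + (\<Sum>i. J (Suc i)) + ennreal (e / 3) \<le> 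
       (TV f (W 3) + ennreal (\<epsilon> 0))
       + (?T + (\<Sum>i. ennreal (\<epsilon> (Suc i))))
       + (?T + (\<Sum>i. ennreal (\<epsilon> (Suc i)))) + ennreal (e / 3)"
    proof (intro add_mono order_refl)
      show "J 0 \<le> TV f (W 3) + ennreal (\<epsilon> 0)" using J[of 0] by (simp add: Q_def)
      have "(\<Sum>i. J (Suc i)) \<le> (\<Sum>i. TV f (W (i + 4) - closure (W i)) + ennreal (\<epsilon> (Suc i)))"
        using J[of "Suc _"] by (intro suminf_le) (auto simp: Q_def)
      then show "(\<Sum>i. J (Suc i)) \<le> ?T + (\<Sum>i. ennreal (\<epsilon> (Suc i)))"
        by (simp add: suminf_add[symmetric])
      then show "(\<Sum>i. J (Suc i)) \<le> ?T + (\<Sum>i. ennreal (\<epsilon> (Suc i)))" .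
    qed
    also have "\<dots> = TV f (W 3) + 2 * ?T
       + (ennreal (\<epsilon> 0) + (\<Sum>i. ennreal (\<epsilon> (Suc i))) + (\<Sum>i. ennreal (\<epsilon> (Suc i))) + ennreal (e / 3))"
      by (simp only: mult_2 ac_simps)
    also have "\<dots> \<le> TV f (W 3) + 2 * ?T + ennreal e"
    proof (rule add_left_mono)
      have "ennreal (\<epsilon> 0) + (\<Sum>i. ennreal (\<epsilon> (Suc i))) = ennreal (e / 3)"
        using suminf_offset[of "\<lambda>i. ennreal (\<epsilon> i)" 1] by (simp add: \<epsilon>_sum add.commute)
      moreover from this have "(\<Sum>i. ennreal (\<epsilon> (Suc i))) \<le> ennreal (e / 3)"
        by (metis le_add2 order_refl zero_le add_increasing)
      ultimately have "ennreal (\<epsilon> 0) + (\<Sum>i. ennreal (\<epsilon> (Suc i))) + (\<Sum>i. ennreal (\<epsilon> (Suc i))) + ennreal (e / 3)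
         \<le> ennreal (e / 3) + ennreal (e / 3) + ennreal (e / 3)" by (intro add_mono) auto
      also have "\<dots> = ennreal e" using e by (simp add: ennreal_plus[symmetric] del: ennreal_plus)
      finally show "ennreal (\<epsilon> 0) + (\<Sum>i. ennreal (\<epsilon> (Suc i))) + (\<Sum>i. ennreal (\<epsilon> (Suc i))) + ennreal (e / 3) \<le> ennreal e" .
    qed
    finally have I: "lip_energy U w \<le> TV f (W 3)
      + 2 * ?T + ennreal e" .
    have werr: "ennreal \<bar>w x - f x\<bar> \<le> ?E i x + ?E (Suc i) x" if x: "x \<in> D i" for x i
    proof -
      have ph: "0 \<le> \<phi> i x" "\<phi> i x \<le> 1" using \<phi> by auto
      have "w x = ?g i x" using wg DN x by blast
      then have "\<bar>w x - f x\<bar> \<le> \<phi> i x * \<bar>u i x - f x\<bar> + (1 - \<phi> i x) * \<bar>u (Suc i) x - f x\<bar>"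
        using \<phi> by (simp add: glue_error)
      also have "\<dots> \<le> \<bar>u i x - f x\<bar> * indicator (K i) x + \<bar>u (Suc i) x - f x\<bar> * indicator (K (Suc i)) x"
      proof (rule add_mono)
        show "\<phi> i x * \<bar>u i x - f x\<bar> \<le> \<bar>u i x - f x\<bar> * indicator (K i) x"
          using ph subsetD[OF DK x] by (simp add: mult_left_le_one_le)
        have "x \<in> K (Suc i)" if "\<phi> i x \<noteq> 1" using that P(3) near[OF x] by auto
        then show "(1 - \<phi> i x) * \<bar>u (Suc i) x - f x\<bar> \<le> \<bar>u (Suc i) x - f x\<bar> * indicator (K (Suc i)) x"
          using ph by (cases "\<phi> i x = 1") (auto intro: mult_left_le_one_le)
      qed
      finally have "ennreal \<bar>w x - f x\<bar>
        \<le> ennreal (\<bar>u i x - f x\<bar> * indicator (K i) x + \<bar>u (Suc i) x - f x\<bar> * indicator (K (Suc i)) x)"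
        by (rule ennreal_leI)
      then show ?thesis by (simp add: ennreal_plus ennreal_mult ennreal_indicator)
    qed
    have "L1_error K0 w f \<le> L1_error U w f"
      using Kd by (intro nn_integral_mono) (auto simp: indicator_def)
    also have "\<dots> = (\<Sum>i. L1_error (D i) w f)"
      using U by (intro decomp measurable_diff_on[OF U wl _ _ f]) (auto simp: sets_M)
    also have "\<dots> \<le> (\<Sum>i. ennreal (\<delta> i) + ennreal (\<delta> (Suc i)))"
    proof (intro suminf_le)
      fix i
      have "L1_error (D i) w f \<le> (\<integral>\<^sup>+x. ?E i x + ?E (Suc i) x \<partial>M)"
        using werr[of _ i] by (intro nn_integral_mono) (auto simp: indicator_def[of "D i"])
      also have "\<dots> = (\<integral>\<^sup>+x. ?E i x \<partial>M) + (\<integral>\<^sup>+x. ?E (Suc i) x \<partial>M)" by (rule nn_integral_add) measurable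
      also have "\<dots> \<le> ennreal (\<delta> i) + ennreal (\<delta> (Suc i))" using u(3) by (intro add_mono) auto
      finally show "L1_error (D i) w f \<le> ennreal (\<delta> i) + ennreal (\<delta> (Suc i))" .
    qed auto
    also have "\<dots> \<le> (\<Sum>i. ennreal (d * (1 / 2) ^ Suc i))"
    proof (intro suminf_le)
      fix i
      have "\<delta> i + \<delta> (Suc i) \<le> d * (1 / 2) ^ Suc i"
      proof -
        have "0 \<le> d * (1 / 2) ^ i" using Kd(3) by simp
        then show ?thesis using \<delta>d[of i] \<delta>d[of "Suc i"] by simp
      qed
      then show "ennreal (\<delta> i) + ennreal (\<delta> (Suc i)) \<le> ennreal (d * (1 / 2) ^ Suc i)"
        using \<delta>[of i] \<delta>[of "Suc i"] by (simp add: ennreal_plus[symmetric] ennreal_leI del: ennreal_plus)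
    qed auto
    also have "\<dots> = ennreal (d * 1)"
      using Kd(3) by (intro suminf_ennreal_eq sums_mult power_half_series) auto
    finally have "L1_error K0 w f \<le> ennreal d" by simp
    from wl I this show "\<exists>u. locally_lipschitz_on U u \<and> lip_energy U u \<le> TV f (W 3)
      + 2 * ?T + ennreal e \<and>
      L1_error K0 u f \<le> ennreal d" by (intro exI[of _ w] conjI)
  qed
qed

text \<open>Rings whose indices differ by a multiple of 4 are disjoint, so superadditivity makes the
  variations of the rings summable as soon as the supremum on the right is finite.\<close>

lemma total_variation_inner_regular:
  assumes f: "f \<in> borel_measurable M" and U: "open U"
  shows "TV f U \<le> (SUP W\<in>{W. open W \<and> compactly_in W U}. TV f W)"
    (is "_ \<le> ?S")
proof (cases "?S < top")
  case True
  let ?V = "TV f"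
  obtain W where W: "\<And>i. open (W i)" "\<And>i. compactly_in (W i) (W (Suc i))" "(\<Union>i. W i) = U"
    using exhaustion[OF U] by blast
  have WS: "?V (W i) \<le> ?S" for i
    using W(1)[of i] W(2)[of i] W(3) by (intro SUP_upper) (auto simp: compactly_in_def)
  define a where "a i = ?V (W (i + 4) - closure (W i))" for i
  have step: "?V (W i) + a i \<le> ?V (W (i + 4))" for i
  proof -
    have "?V (W i) + a i \<le> ?V (W i \<union> (W (i + 4) - closure (W i)))"
      unfolding a_def using W(1) closure_subset[of "W i"] by (intro total_variation_superadd) auto
    also have "\<dots> \<le> ?V (W (i + 4))"
      using exhaustion_mono[of W, OF W(2), of i "i + 4"] by (intro total_variation_mono) auto
    finally show ?thesis .
  qed
  \<comment> \<open>Four telescoping sums, one per residue class modulo 4, advance together by one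
    block of four terms.\<close>
  have part: "(\<Sum>j<4 * n. a j) \<le> ?V (W (4 * n)) + ?V (W (4 * n + 1)) + ?V (W (4 * n + 2)) + ?V (W (4 * n + 3))" for n
  proof (induction n)
    case (Suc n)
    have "(\<Sum>j<4 * Suc n. a j) = (\<Sum>j<4 * n. a j) + a (4 * n) + a (4 * n + 1) + a (4 * n + 2) + a (4 * n + 3)"
      by (simp add: numeral_eq_Suc)
    also have "\<dots> \<le> (?V (W (4 * n)) + ?V (W (4 * n + 1)) + ?V (W (4 * n + 2)) + ?V (W (4 * n + 3)))
       + a (4 * n) + a (4 * n + 1) + a (4 * n + 2) + a (4 * n + 3)"
      by (intro add_right_mono Suc)
    also have "\<dots> = (?V (W (4 * n)) + a (4 * n)) + (?V (W (4 * n + 1)) + a (4 * n + 1))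
       + (?V (W (4 * n + 2)) + a (4 * n + 2)) + (?V (W (4 * n + 3)) + a (4 * n + 3))"
      by (simp only: ac_simps)
    also have "\<dots> \<le> ?V (W (4 * n + 4)) + ?V (W (4 * n + 1 + 4)) + ?V (W (4 * n + 2 + 4)) + ?V (W (4 * n + 3 + 4))"
      by (intro add_mono step)
    finally show ?case by (simp add: add.commute)
  qed simp
  have sum_le: "(\<Sum>j. a j) \<le> ?S + ?S + ?S + ?S"
  proof (rule suminf_le_const[OF summableI])
    fix n
    have "(\<Sum>j<n. a j) \<le> (\<Sum>j<4 * n. a j)" by (intro sum_mono2) auto
    also note part
    also have "?V (W (4 * n)) + ?V (W (4 * n + 1)) + ?V (W (4 * n + 2)) + ?V (W (4 * n + 3)) \<le> ?S + ?S + ?S + ?S"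
      by (intro add_mono WS)
    finally show "(\<Sum>j<n. a j) \<le> ?S + ?S + ?S + ?S" .
  qed
  have fin: "(\<Sum>j. a j) < top" using le_less_trans[OF sum_le, of top] True by simp
  show ?thesis
  proof (rule ennreal_le_epsilon)
    fix e :: real assume e: "0 < e"
    have "(\<Sum>j. a j) < (\<Sum>j. a j) + ennreal (e / 2)" using fin e by (intro ennreal_less_add) auto
    moreover have "(\<lambda>p. (\<Sum>j<p. a j) + ennreal (e / 2)) \<longlonglongrightarrow> (\<Sum>j. a j) + ennreal (e / 2)"
      by (intro tendsto_add tendsto_const summable_LIMSEQ summableI)
    ultimately have "\<forall>\<^sub>F p in sequentially. (\<Sum>j. a j) < (\<Sum>j<p. a j) + ennreal (e / 2)"
      by (intro order_tendstoD) auto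
    then obtain p where p: "(\<Sum>j. a j) < (\<Sum>j<p. a j) + ennreal (e / 2)"
      unfolding eventually_sequentially by blast
    have split: "(\<Sum>j. a j) = (\<Sum>j<p. a j) + (\<Sum>j. a (j + p))"
      using suminf_offset[OF summableI, of a p] by (simp add: add.commute)
    then have tail: "(\<Sum>j. a (j + p)) \<le> ennreal (e / 2)"
      using p fin by (auto simp: ennreal_add_left_cancel_less intro: less_imp_le)
    \<comment> \<open>The exhaustion shifted by \<open>p\<close> again exhausts \<open>U\<close>;
      its ring sum is the tail, and a tail of at most \<open>e / 2\<close> absorbs the factor
      2.\<close>
    have "?V U \<le> ?V (W (3 + p)) + 2 * (\<Sum>i. ?V (W (i + 4 + p) - closure (W (i + p))))"
    proof (rule total_variation_exhaustion[OF f, where W = "\<lambda>i. W (i + p)"])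
      show "(\<Union>i. W (i + p)) = U"
      proof -
        have "W i \<subseteq> W (i + p)" for i by (intro exhaustion_mono[of W, OF W(2)]) simp
        then show ?thesis using W(3) by blast
      qed
    qed (use W in auto)
    also have "\<dots> = ?V (W (3 + p)) + 2 * (\<Sum>j. a (j + p))" by (simp add: a_def ac_simps)
    also have "\<dots> \<le> ?S + 2 * ennreal (e / 2)" using WS tail by (intro add_mono mult_left_mono) auto
    also have "2 * ennreal (e / 2) = ennreal e" using e
      by (simp add: mult_2 ennreal_plus[symmetric] del: ennreal_plus)
    finally show "?V U \<le> ?S + ennreal e" .
  qed
next
  case False
  then have "?S = top" by (simp only: less_top[symmetric] not_not)
  then show ?thesis by (simp only: top_greatest)
qed

text \<open>A set compactly contained in the union is covered by slightly smaller \<open>A'\<close>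
  and \<open>B'\<close>, to which the gluing lemma applies; inner regularity then passes from such
  sets to the whole union.\<close>

lemma total_variation_subadd:
  assumes f: "f \<in> borel_measurable M" and AB: "open A" "open B"
  shows "TV f (A \<union> B) \<le> TV f A + TV f B"
proof (rule order_trans[OF total_variation_inner_regular[OF f open_Un[OF AB]]], rule SUP_least, clarify)
  fix W assume W: "open W" "compactly_in W (A \<union> B)"
  obtain A' B' where A'B': "open A'" "open B'" "compactly_in A' A" "compactly_in B' B" "closure W \<subseteq> A' \<union> B'"
    using compactly_in_Un[OF W(2) AB] by blast
  have "TV f W \<le> TV f (A' \<union> B')"
    using A'B'(5) closure_subset[of W] by (intro total_variation_mono) auto
  also have "\<dots> \<le> TV f A + TV f B"
    using A'B' AB by (intro total_variation_glue f)
  finally show "TV f W \<le> TV f A + TV f B" .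
qed

text \<open>Miranda's theorem in the form used here: a function of finite total variation has a
  variation that extends to a finite Radon measure.\<close>

lemma open_set_function_total_variation:
  assumes "f \<in> borel_measurable M" "TV f UNIV < \<infinity>"
  shows "open_set_function (TV f)"
  using assms
  by unfold_locales (auto intro: total_variation_mono total_variation_superadd total_variation_subadd
     total_variation_inner_regular simp: total_variation_empty)

end

section \<open>Smoothing at a fixed scale\<close>

context doubling_space
begin

text \<open>\<open>4 * C ^ 3\<close> comes from the lower bound on the mass of the averaging kernel,
  \<open>1 + 2 * C ^ 3\<close> from measuring the oscillation about \<open>h x\<close> instead of
  the average \<open>g x\<close>.\<close>

definition C\<^sub>S :: real where "C\<^sub>S = 4 * C ^ 3 * (1 + 2 * C ^ 3)"

lemma C\<^sub>S_pos: "0 < C\<^sub>S"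
  using C_ge_1 unfolding C\<^sub>S_def by (intro mult_pos_pos add_pos_pos) auto

definition osc :: "('a \<Rightarrow> real) \<Rightarrow> real \<Rightarrow> 'a \<Rightarrow> ennreal" where
  "osc h R x = (\<integral>\<^sup>+y\<in>ball x R. ennreal \<bar>h y - h x\<bar> \<partial>M)"

lemma measurable_osc[measurable]:
  assumes [measurable]: "h \<in> borel_measurable M"
  shows "osc h R \<in> borel_measurable M"
  unfolding osc_def by measurable

lemma energy_1_osc:
  "energy_1 M R h U = ennreal (1 / R) * (\<integral>\<^sup>+x\<in>U. (1 / emeasure M (ball x R)) * osc h R x \<partial>M)"
  by (simp add: energy_1_def osc_def)

lemma average_osc_integral:
  assumes "0 < R"
  shows "(\<integral>\<^sup>+x\<in>U. (1 / emeasure M (ball x R)) * osc h R x \<partial>M) = ennreal R * energy_1 M R h U"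
proof -
  have "ennreal R * ennreal (1 / R) = 1" using assms by (simp add: ennreal_mult[symmetric])
  then show ?thesis by (simp add: energy_1_osc mult.assoc[symmetric])
qed

text \<open>In the proof, \<open>g\<close> is the average of \<open>h\<close> with weight \<open>k x\<close>. Since \<open>h - g x\<close> has mean zero for the
  weight \<open>k x\<close>, the increment \<open>g x' - g x\<close> only sees \<open>k x' - k x\<close>, which is at most \<open>dist x x'\<close>.\<close>

lemma smoothing:
  assumes h: "integrable M h" and R: "0 < R"
  shows "\<exists>g. locally_lipschitz_on UNIV g \<and>
    (\<forall>x. Lip_const g x \<le> ennreal C\<^sub>S *
        (ennreal (1 / R) * ((1 / emeasure M (ball x R)) * osc h R x))) \<and>
    (\<forall>x. ennreal \<bar>g x - h x\<bar> \<le> ennreal (2 * C ^ 3) * ((1 / emeasure M (ball x R)) * osc h R x))"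
proof -
  have [measurable]: "h \<in> borel_measurable M" using h by simp
  \<comment> \<open>A tent of height and radius \<open>R / 2\<close>, 1-Lipschitz in
    \<open>x\<close>. The radius is halved so that the kernels of \<open>x\<close> and of any
    \<open>x'\<close> closer than \<open>R / 2\<close> both vanish outside
    \<open>ball x R\<close>.\<close>
  define k where "k x y = max 0 (R / 2 - dist x y)" for x y :: 'a
  have k0: "0 \<le> k x y" "k x y \<le> R / 2" for x y using R by (auto simp: k_def max_def)
  have ind_int: "integrable M (indicator (ball x s) :: 'a \<Rightarrow> real)" for x s
    using emeasure_ball_finite[of x s] by (simp add: sets_M)
  have km[measurable]: "k x \<in> borel_measurable M" for x
    unfolding k_def borel_measurable_M by (intro borel_measurable_continuous_onI continuous_intros)
  have kb: "k x y \<le> R / 2 * indicator (ball x R) y" for x y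
    using R by (auto simp: k_def indicator_def max_def)
  have k_int: "integrable M (k x)" for x
  proof (rule Bochner_Integration.integrable_bound[OF integrable_mult_right[OF ind_int[of x R], of "R / 2"]])
    show "AE y in M. norm (k x y) \<le> norm (R / 2 * indicator (ball x R) y)"
      using k0(1)[of x] order_trans[OF kb[of x] abs_ge_self] by (intro AE_I2) simp
  qed measurable
  have kh_int: "integrable M (\<lambda>y. k x y * h y)" for x
  proof (rule Bochner_Integration.integrable_bound[OF integrable_mult_right[OF h, of "R / 2"]])
    show "AE y in M. norm (k x y * h y) \<le> norm (R / 2 * h y)"
      using mult_right_mono[OF k0(2)[of x] abs_ge_zero] k0(1)[of x] R by (intro AE_I2) (simp add: abs_mult)
  qed measurable
  have khc_int: "integrable M (\<lambda>y. k x y * (h y - c))" for x c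
    using k_int[of x] kh_int[of x] by (simp add: right_diff_distrib)
  define N where "N x = (\<integral>y. k x y \<partial>M)" for x
  \<comment> \<open>The tent is at least \<open>R / 4\<close> on the ball of radius
    \<open>R / 4\<close>.\<close>
  have N_ge: "(R / 4) * vol x' (R / 4) \<le> N x'" for x'
  proof -
    have "(R / 4) * vol x' (R / 4) = (\<integral>y. (R / 4) * indicator (ball x' (R / 4)) y \<partial>M)"
      by (simp add: vol_def sets_M)
    also have "\<dots> \<le> N x'" unfolding N_def
      by (intro integral_mono integrable_mult_right ind_int k_int) (auto simp: k_def indicator_def max_def)
    finally show ?thesis .
  qed
  have N_lower: "R * vol x R / (4 * C ^ 3) \<le> N x'" if "dist x x' \<le> R / 2" for x x'
  proof -
    \<comment> \<open>\<open>R / 2 + R\<close> is at most \<open>8 * (R / 4)\<close>, hence three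
      doublings.\<close>
    have "vol x R \<le> C ^ 3 * vol x' (R / 4)" using that R by (intro vol_compare) auto
    then have "R * vol x R / (4 * C ^ 3) \<le> R * (C ^ 3 * vol x' (R / 4)) / (4 * C ^ 3)"
      using R C_ge_1 by (intro divide_right_mono mult_left_mono) auto
    also have "\<dots> = (R / 4) * vol x' (R / 4)" using C_ge_1 by simp
    finally show ?thesis using N_ge[of x'] by simp
  qed
  have N_pos: "0 < N x" for x
  proof -
    have "0 < R / 4 * vol x (R / 4)" using R vol_pos[of "R / 4" x] by simp
    then show ?thesis using N_ge[of x] by linarith
  qed
  define g where "g x = (\<integral>y. k x y * h y \<partial>M) / N x" for x
  have g_diff: "N x * (g x - c) = (\<integral>y. k x y * (h y - c) \<partial>M)" for x c
  proof -
    have "(\<integral>y. k x y * (h y - c) \<partial>M) = (\<integral>y. k x y * h y \<partial>M) - c * N x"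
      unfolding N_def using k_int[of x] kh_int[of x] by (simp add: right_diff_distrib mult.commute)
    also have "\<dots> = N x * (g x - c)" using N_pos[of x] by (simp add: g_def right_diff_distrib)
    finally show ?thesis by simp
  qed
  define D where "D c x = (\<integral>y. indicator (ball x R) y * \<bar>h y - c\<bar> \<partial>M)" for c x
  have D_int: "integrable M (\<lambda>y. indicator (ball x R) y * \<bar>h y - c\<bar>)" for c x
  proof (rule Bochner_Integration.integrable_bound)
    show "integrable M (\<lambda>y. \<bar>h y\<bar> + \<bar>c\<bar> * indicator (ball x R) y)"
      using h ind_int by (intro Bochner_Integration.integrable_add integrable_mult_right) auto
    show "AE y in M. norm (indicator (ball x R) y * \<bar>h y - c\<bar>) \<le> norm (\<bar>h y\<bar> + \<bar>c\<bar> * indicator (ball x R) y)"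
      by (intro AE_I2) (auto simp: indicator_def)
  qed measurable
  have D_nonneg: "0 \<le> D c x" for c x unfolding D_def by (intro integral_nonneg_AE AE_I2) auto
  have D_change: "D c x \<le> D c' x + \<bar>c' - c\<bar> * vol x R" for c c' x
  proof -
    have "D c x \<le> (\<integral>y. indicator (ball x R) y * \<bar>h y - c'\<bar> + \<bar>c' - c\<bar> * indicator (ball x R) y \<partial>M)"
      unfolding D_def by (intro integral_mono D_int Bochner_Integration.integrable_add integrable_mult_right ind_int)
        (auto simp: indicator_def)
    also have "\<dots> = D c' x + \<bar>c' - c\<bar> * vol x R"
      unfolding D_def by (subst Bochner_Integration.integral_add)
        (use D_int ind_int in \<open>auto simp: vol_def sets_M\<close>)
    finally show ?thesis .
  qed
  have D_norm: "D c x \<le> (\<integral>y. \<bar>h y\<bar> \<partial>M) + \<bar>c\<bar> * vol x R" for c x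
  proof -
    have "D 0 x \<le> (\<integral>y. \<bar>h y\<bar> \<partial>M)"
      unfolding D_def using D_int[of x 0] h by (intro integral_mono) (auto simp: indicator_def)
    then show ?thesis using D_change[of c x 0] by simp
  qed
  have g_err: "\<bar>g x - c\<bar> \<le> (R / 2) * D c x / N x" for x c
  proof -
    have "N x * \<bar>g x - c\<bar> = \<bar>\<integral>y. k x y * (h y - c) \<partial>M\<bar>"
      using N_pos[of x] by (subst g_diff[symmetric]) (simp add: abs_mult)
    also have "\<dots> \<le> (\<integral>y. \<bar>k x y * (h y - c)\<bar> \<partial>M)" by (rule integral_abs_bound)
    also have "\<dots> \<le> (\<integral>y. (R / 2) * (indicator (ball x R) y * \<bar>h y - c\<bar>) \<partial>M)"
    proof (intro integral_mono integrable_mult_right D_int integrable_abs khc_int)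
      fix y
      have "\<bar>k x y * (h y - c)\<bar> = k x y * \<bar>h y - c\<bar>" using k0[of x y] by (simp add: abs_mult)
      also have "\<dots> \<le> (R / 2 * indicator (ball x R) y) * \<bar>h y - c\<bar>" by (intro mult_right_mono kb) simp
      finally show "\<bar>k x y * (h y - c)\<bar> \<le> (R / 2) * (indicator (ball x R) y * \<bar>h y - c\<bar>)" by (simp add: mult.assoc)
    qed
    also have "\<dots> = (R / 2) * D c x" unfolding D_def using D_int by simp
    finally show ?thesis using N_pos[of x] by (simp add: field_simps)
  qed
  have g_lip: "\<bar>g x' - g x\<bar> \<le> dist x x' * D (g x) x / N x'" if d: "dist x x' < R / 2" for x x'
  proof -
    have "N x' * (g x' - g x) = (\<integral>y. k x' y * (h y - g x) \<partial>M) - (\<integral>y. k x y * (h y - g x) \<partial>M)"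
      using g_diff[of x' "g x"] g_diff[of x "g x"] by simp
    also have "\<dots> = (\<integral>y. k x' y * (h y - g x) - k x y * (h y - g x) \<partial>M)"
      by (rule Bochner_Integration.integral_diff[symmetric, OF khc_int khc_int])
    finally have "N x' * \<bar>g x' - g x\<bar> = \<bar>\<integral>y. k x' y * (h y - g x) - k x y * (h y - g x) \<partial>M\<bar>"
      using N_pos[of x'] by (metis abs_mult abs_of_pos)
    also have "\<dots> \<le> (\<integral>y. \<bar>k x' y * (h y - g x) - k x y * (h y - g x)\<bar> \<partial>M)" by (rule integral_abs_bound)
    also have "\<dots> \<le> (\<integral>y. dist x x' * (indicator (ball x R) y * \<bar>h y - g x\<bar>) \<partial>M)"
    proof (intro integral_mono integrable_mult_right D_int integrable_abs Bochner_Integration.integrable_diff khc_int)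
      fix y
      have "\<bar>k x' y - k x y\<bar> \<le> dist x x' * indicator (ball x R) y"
      proof (cases "dist x y < R")
        case True
        have "\<bar>dist x' y - dist x y\<bar> \<le> dist x x'"
          using dist_triangle[of x y x'] dist_triangle[of x' y x] by (simp add: dist_commute)
        then have "\<bar>k x' y - k x y\<bar> \<le> dist x x'" unfolding k_def by linarith
        then show ?thesis using True by simp
      next
        case False
        then have "R / 2 \<le> dist x' y" "R / 2 \<le> dist x y" using d dist_triangle[of x y x'] R by auto
        then show ?thesis by (simp add: k_def)
      qed
      then have "\<bar>k x' y - k x y\<bar> * \<bar>h y - g x\<bar> \<le> (dist x x' * indicator (ball x R) y) * \<bar>h y - g x\<bar>"
        by (rule mult_right_mono) simp
      then show "\<bar>k x' y * (h y - g x) - k x y * (h y - g x)\<bar> \<le> dist x x' * (indicator (ball x R) y * \<bar>h y - g x\<bar>)"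
        by (simp add: left_diff_distrib[symmetric] abs_mult mult.assoc)
    qed
    also have "\<dots> = dist x x' * D (g x) x" unfolding D_def using D_int by simp
    finally show ?thesis using N_pos[of x'] by (simp add: field_simps)
  qed
  have osc_D: "(1 / emeasure M (ball x R)) * osc h R x = ennreal (D (h x) x / vol x R)" for x
  proof -
    have "osc h R x = (\<integral>\<^sup>+y. ennreal (indicator (ball x R) y * \<bar>h y - h x\<bar>) \<partial>M)"
      unfolding osc_def by (intro nn_integral_cong) (auto simp: indicator_def)
    also have "\<dots> = ennreal (D (h x) x)"
      unfolding D_def by (intro nn_integral_eq_integral D_int AE_I2) auto
    finally show ?thesis using vol_pos[OF R, of x] D_nonneg[of "h x" x]
      by (simp add: inverse_emeasure_ball[OF R] ennreal_mult[symmetric])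
  qed
  have err: "\<bar>g x - h x\<bar> \<le> 2 * C ^ 3 * (D (h x) x / vol x R)" for x
  proof -
    have "\<bar>g x - h x\<bar> \<le> (R / 2) * D (h x) x / N x" by (rule g_err)
    also have "\<dots> \<le> (R / 2) * D (h x) x / (R * vol x R / (4 * C ^ 3))"
      using N_lower[of x x] N_pos[of x] R D_nonneg[of "h x" x] vol_pos[OF R, of x] C_ge_1
      by (intro divide_left_mono) auto
    also have "\<dots> = 2 * C ^ 3 * (D (h x) x / vol x R)" using R vol_pos[OF R, of x] by simp
    finally show ?thesis .
  qed
  have lip: "\<bar>g x' - g x\<bar> \<le> (C\<^sub>S * (1 / R * (D (h x) x / vol x R))) * dist x x'"
    if d: "dist x x' < R / 2" for x x'
  proof -
    let ?D = "D (h x) x" and ?v = "vol x R"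
    have v: "0 < ?v" by (rule vol_pos[OF R])
    \<comment> \<open>The increment of \<open>g\<close> involves the oscillation about
      \<open>g x\<close>; the error bound trades it for the oscillation about \<open>h x\<close> at
      the cost of a factor.\<close>
    have "D (g x) x \<le> ?D + \<bar>h x - g x\<bar> * ?v" by (rule D_change)
    also have "\<dots> \<le> ?D + (2 * C ^ 3 * (?D / ?v)) * ?v"
      using err[of x] v by (intro add_left_mono mult_right_mono) (auto simp: abs_minus_commute)
    also have "\<dots> = (1 + 2 * C ^ 3) * ?D" using v by (simp add: algebra_simps)
    finally have D: "D (g x) x \<le> (1 + 2 * C ^ 3) * ?D" .
    have "\<bar>g x' - g x\<bar> \<le> dist x x' * D (g x) x / N x'" by (rule g_lip[OF d])
    also have "\<dots> \<le> dist x x' * ((1 + 2 * C ^ 3) * ?D) / (R * ?v / (4 * C ^ 3))"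
      using N_lower[of x x'] d N_pos[of x'] D D_nonneg R v C_ge_1
      by (intro frac_le mult_left_mono) auto
    also have "\<dots> = (C\<^sub>S * (1 / R * (?D / ?v))) * dist x x'"
      using R v by (simp add: C\<^sub>S_def field_simps)
    finally show ?thesis .
  qed
  have "lipschitz_near g x0" for x0
  proof -
    \<comment> \<open>Near \<open>x0\<close> the kernel mass is bounded below by
      \<open>\<nu>\<close> and the oscillation above by \<open>E\<close>, so the increment estimate
      becomes a uniform Lipschitz bound on a ball.\<close>
    define \<nu> where "\<nu> = R * vol x0 R / (4 * C ^ 3)"
    have \<nu>: "0 < \<nu>" using R vol_pos[OF R, of x0] C_ge_1 by (simp add: \<nu>_def)
    define I where "I = (\<integral>y. \<bar>h y\<bar> \<partial>M)"
    have I: "0 \<le> I" by (simp add: I_def)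
    define E where "E = I + ((R / 2) * I / \<nu>) * vol x0 (2 * R)"
    have E: "0 \<le> E" using I R \<nu> by (simp add: E_def)
    have "(E / \<nu>)-lipschitz_on (ball x0 (R / 4)) g"
    proof (rule lipschitz_onI)
      fix x' x assume x: "x' \<in> ball x0 (R / 4)" "x \<in> ball x0 (R / 4)"
      have d: "dist x x' < R / 2" using x dist_triangle_half_r[of x0 x "R / 2" x'] by auto
      have "\<nu> \<le> N x" "\<nu> \<le> N x'" unfolding \<nu>_def using x R by (auto intro!: N_lower)
      have "\<bar>g x\<bar> \<le> (R / 2) * D 0 x / N x" using g_err[of x 0] by simp
      also have "\<dots> \<le> (R / 2) * I / \<nu>"
        using D_norm[of 0 x] D_nonneg[of 0 x] \<open>\<nu> \<le> N x\<close> \<nu> R I by (intro frac_le mult_left_mono) (auto simp: I_def)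
      finally have gx: "\<bar>g x\<bar> \<le> (R / 2) * I / \<nu>" .
      have vx: "vol x R \<le> vol x0 (2 * R)"
      proof (rule vol_mono, rule subsetI)
        fix y assume "y \<in> ball x R"
        then show "y \<in> ball x0 (2 * R)" using x R dist_triangle[of x0 y x] by auto
      qed
      have "D (g x) x \<le> I + \<bar>g x\<bar> * vol x R" using D_norm by (simp add: I_def)
      also have "\<dots> \<le> E" unfolding E_def using gx vx R I \<nu> by (intro add_left_mono mult_mono) auto
      finally have "D (g x) x \<le> E" .
      have "dist (g x') (g x) \<le> dist x x' * D (g x) x / N x'" using g_lip[OF d] by (simp add: dist_real_def)
      also have "\<dots> \<le> dist x x' * E / \<nu>"
        using \<open>D (g x) x \<le> E\<close> \<open>\<nu> \<le> N x'\<close> \<nu> E by (intro frac_le mult_left_mono) auto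
      finally show "dist (g x') (g x) \<le> E / \<nu> * dist x' x" by (simp add: dist_commute mult.commute)
    qed (use E \<nu> in auto)
    then show ?thesis unfolding lipschitz_near_def using R by (intro exI[of _ "R / 4"]) auto
  qed
  then have "locally_lipschitz_on UNIV g" by (simp add: locally_lipschitz_on_iff)
  moreover have "Lip_const g x \<le> ennreal C\<^sub>S *
        (ennreal (1 / R) * ((1 / emeasure M (ball x R)) * osc h R x))" for x
  proof -
    let ?q = "D (h x) x / vol x R"
    have q: "0 \<le> ?q" using D_nonneg by simp
    have C3: "0 \<le> C\<^sub>S" using C\<^sub>S_pos by simp
    have q': "0 \<le> 1 / R * ?q" using R by (intro mult_nonneg_nonneg q) simp
    have "Lip_const g x \<le> ennreal (C\<^sub>S * (1 / R * ?q))"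
      by (rule Lip_const_le_bound[of "R / 2", OF _ mult_nonneg_nonneg[OF C3 q'] lip]) (use R in auto)
    also have "\<dots> = ennreal C\<^sub>S * ennreal (1 / R * ?q)"
      by (rule ennreal_mult[OF C3 q'])
    also have "ennreal (1 / R * ?q) = ennreal (1 / R) * ennreal ?q" by (rule ennreal_mult) (use q R in auto)
    finally show ?thesis by (simp only: osc_D)
  qed
  moreover have "ennreal \<bar>g x - h x\<bar> \<le> ennreal (2 * C ^ 3) * ((1 / emeasure M (ball x R)) * osc h R x)" for x
  proof -
    have "ennreal \<bar>g x - h x\<bar> \<le> ennreal (2 * C ^ 3 * (D (h x) x / vol x R))" by (rule ennreal_leI[OF err])
    also have "\<dots> = ennreal (2 * C ^ 3) * ennreal (D (h x) x / vol x R)"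
      by (rule ennreal_mult) (use C_ge_1 D_nonneg in auto)
    finally show ?thesis by (simp only: osc_D)
  qed
  ultimately show ?thesis by blast
qed

lemma Limsup_cmult_ennreal:
  fixes f :: "'b \<Rightarrow> ennreal"
  assumes "F \<noteq> bot"
  shows "Limsup F (\<lambda>x. ennreal c * f x) = ennreal c * Limsup F f"
  by (rule Limsup_compose_continuous_mono[where f = "\<lambda>t. ennreal c * t"])
     (auto intro!: monoI mult_left_mono ennreal_continuous_on_cmult continuous_on_id assms)

lemma L1_converges_nn:
  assumes "L1_converges M fn f"
  shows "(\<lambda>n. L1_dist (fn n) f) \<longlonglongrightarrow> 0"
proof -
  have "L1_dist (fn n) f = ennreal (\<integral>x. \<bar>fn n x - f x\<bar> \<partial>M)" for n
    using assms unfolding L1_converges_def by (intro nn_integral_eq_integral) auto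
  moreover have "(\<lambda>n. ennreal (\<integral>x. \<bar>fn n x - f x\<bar> \<partial>M)) \<longlonglongrightarrow> ennreal 0"
    using assms unfolding L1_converges_def by (intro tendsto_ennrealI) auto
  ultimately show ?thesis by simp
qed

text \<open>The smoothing error on \<open>U\<close> is at most a multiple of \<open>r n\<close>
  times the energy, so bounded energies make the smoothed functions converge to \<open>f\<close> on
  compact subsets of \<open>U\<close>. They are then admissible for the variation.\<close>

lemma total_variation_le_energy:
  assumes L1: "L1_converges M fn f" and r: "\<And>n. 0 < r n" "r \<longlonglongrightarrow> 0" and U: "open U"
    and fin: "limsup (\<lambda>n. energy_1 M (r n) (fn n) U) < top"
  shows "TV f U
    \<le> ennreal C\<^sub>S * limsup (\<lambda>n. energy_1 M (r n) (fn n) U)"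
proof -
  let ?A = "\<lambda>n x. (1 / emeasure M (ball x (r n))) * osc (fn n) (r n) x"
  have int: "integrable M (fn n)" "integrable M f" for n using L1 by (auto simp: L1_converges_def)
  then have [measurable]: "fn n \<in> borel_measurable M" "f \<in> borel_measurable M" for n by auto
  have [measurable]: "U \<in> sets M" using U by (simp add: sets_M)
  have "\<forall>n. \<exists>g. locally_lipschitz_on UNIV g \<and>
    (\<forall>x. Lip_const g x \<le> ennreal C\<^sub>S * (ennreal (1 / r n) * ?A n x)) \<and>
    (\<forall>x. ennreal \<bar>g x - fn n x\<bar> \<le> ennreal (2 * C ^ 3) * ?A n x)"
    using smoothing[OF int(1) r(1)] by blast
  from choice[OF this] obtain g where g: "\<And>n. locally_lipschitz_on UNIV (g n)"
    "\<And>n x. Lip_const (g n) x \<le> ennreal C\<^sub>S * (ennreal (1 / r n) * ?A n x)"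
    "\<And>n x. ennreal \<bar>g n x - fn n x\<bar> \<le> ennreal (2 * C ^ 3) * ?A n x" by blast
  have LipE: "lip_energy U (g n) \<le> ennreal C\<^sub>S * energy_1 M (r n) (fn n) U" for n
  proof -
    have "lip_energy U (g n) \<le> (\<integral>\<^sup>+x. ennreal C\<^sub>S * (ennreal (1 / r n) * (?A n x * indicator U x)) \<partial>M)"
      using g(2)[of n] by (intro nn_integral_mono) (auto simp: indicator_def)
    also have "\<dots> = ennreal C\<^sub>S * energy_1 M (r n) (fn n) U"
      unfolding energy_1_osc by (subst nn_integral_cmult, measurable, subst nn_integral_cmult, measurable)
    finally show ?thesis .
  qed
  obtain B :: real where B: "0 \<le> B" "limsup (\<lambda>n. energy_1 M (r n) (fn n) U) < ennreal B"
  proof (cases "limsup (\<lambda>n. energy_1 M (r n) (fn n) U)" rule: ennreal_cases)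
    case (real b)
    then show ?thesis using that[of "b + 1"] by (simp add: ennreal_less_iff)
  qed (use fin in auto)
  then have evB: "\<forall>\<^sub>F n in sequentially. energy_1 M (r n) (fn n) U < ennreal B"
    by (intro Limsup_lessD)
  have "L1_loc_converges M U g f"
    unfolding L1_loc_converges_def
  proof (intro allI impI)
    fix K assume K: "compact K \<and> K \<subseteq> U"
    have le: "L1_error K (g n) f
       \<le> ennreal (2 * C ^ 3) * (ennreal (r n) * energy_1 M (r n) (fn n) U) + L1_dist (fn n) f" for n
    proof -
      have "L1_error K (g n) f
        \<le> (\<integral>\<^sup>+x. ennreal (2 * C ^ 3) * (?A n x * indicator U x) + ennreal \<bar>fn n x - f x\<bar> \<partial>M)"
      proof (rule nn_integral_mono)
        fix x
        show "ennreal \<bar>g n x - f x\<bar> * indicator K x \<le> ennreal (2 * C ^ 3) * (?A n x * indicator U x) + ennreal \<bar>fn n x - f x\<bar>"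
        proof (cases "x \<in> K")
          case True
          have "ennreal \<bar>g n x - f x\<bar> \<le> ennreal (\<bar>g n x - fn n x\<bar> + \<bar>fn n x - f x\<bar>)" by (intro ennreal_leI) linarith
          also have "\<dots> = ennreal \<bar>g n x - fn n x\<bar> + ennreal \<bar>fn n x - f x\<bar>" by simp
          also have "\<dots> \<le> ennreal (2 * C ^ 3) * ?A n x + ennreal \<bar>fn n x - f x\<bar>" by (intro add_right_mono g)
          finally show ?thesis using True K by auto
        qed simp
      qed
      also have "\<dots> = ennreal (2 * C ^ 3) * (\<integral>\<^sup>+x\<in>U. ?A n x \<partial>M) + L1_dist (fn n) f"
        by (subst nn_integral_add, measurable, subst nn_integral_cmult, measurable)
      finally show ?thesis by (simp only: average_osc_integral[OF r(1)])
    qed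
    have "\<forall>\<^sub>F n in sequentially. L1_error K (g n) f
       \<le> ennreal (2 * C ^ 3 * (r n * B)) + L1_dist (fn n) f"
      using evB
    proof eventually_elim
      case (elim n)
      have "ennreal (2 * C ^ 3) * (ennreal (r n) * energy_1 M (r n) (fn n) U) \<le> ennreal (2 * C ^ 3) * (ennreal (r n) * ennreal B)"
        using elim by (intro mult_left_mono) auto
      also have "\<dots> = ennreal (2 * C ^ 3 * (r n * B))"
        using B r(1)[of n] C_ge_1 by (simp add: ennreal_mult less_imp_le)
      finally show ?case using le[of n] by (meson add_right_mono order_trans)
    qed
    moreover have "(\<lambda>n. ennreal (2 * C ^ 3 * (r n * B)) + L1_dist (fn n) f) \<longlonglongrightarrow> ennreal (2 * C ^ 3 * (0 * B)) + 0"
      by (intro tendsto_add tendsto_ennrealI tendsto_mult tendsto_const r L1_converges_nn[OF L1])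
    then have lim: "(\<lambda>n. ennreal (2 * C ^ 3 * (r n * B)) + L1_dist (fn n) f) \<longlonglongrightarrow> 0" by simp
    ultimately show "(\<lambda>n. L1_error K (g n) f) \<longlonglongrightarrow> 0"
      by (intro tendsto_0_le_ennreal[OF lim])
  qed
  then have "TV f U \<le> liminf (\<lambda>n. lip_energy U (g n))"
    using locally_lipschitz_on_subset[OF g(1)] by (intro total_variation_le_liminf) auto
  also have "\<dots> \<le> limsup (\<lambda>n. lip_energy U (g n))" by (intro Liminf_le_Limsup) simp
  also have "\<dots> \<le> limsup (\<lambda>n. ennreal C\<^sub>S * energy_1 M (r n) (fn n) U)"
    using LipE by (intro Limsup_mono always_eventually) auto
  also have "\<dots> = ennreal C\<^sub>S * limsup (\<lambda>n. energy_1 M (r n) (fn n) U)"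
    by (rule Limsup_cmult_ennreal) simp
  finally show ?thesis .
qed

end

section \<open>Energy bounds from the Poincare inequality\<close>

text \<open>The classical infimum of cones. It makes the Poincare inequality, available for globally
  Lipschitz functions, applicable to a competitor that is Lipschitz on a compact set.\<close>

lemma mcshane_extension:
  fixes u :: "'a::metric_space \<Rightarrow> real"
  assumes u: "L-lipschitz_on K u"
  obtains F where "L-lipschitz_on UNIV F" "\<And>x. x \<in> K \<Longrightarrow> F x = u x"
proof (cases "K = {}")
  case False
  have L: "0 \<le> L" using u by (rule lipschitz_on_nonneg)
  obtain a0 where a0: "a0 \<in> K" using False by blast
  have ub: "u a - u b \<le> L * dist a b" if "a \<in> K" "b \<in> K" for a b
    using lipschitz_onD[OF u that] by (simp add: dist_real_def)
  define F where "F x = (INF a\<in>K. u a + L * dist x a)" for x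
  have low: "u a0 - L * dist x a0 \<le> u a + L * dist x a" if a: "a \<in> K" for x a
  proof -
    have "u a0 - u a \<le> L * dist a0 a" by (rule ub[OF a0 a])
    also have "\<dots> \<le> L * (dist x a0 + dist x a)"
      using L dist_triangle[of a0 a x] by (intro mult_left_mono) (auto simp: dist_commute)
    finally show ?thesis by (simp add: distrib_left)
  qed
  have bdd: "bdd_below ((\<lambda>a. u a + L * dist x a) ` K)" for x
    unfolding bdd_below_def using low by blast
  have FF: "F x \<le> F y + L * dist x y" for x y
  proof -
    have "F x - L * dist x y \<le> u a + L * dist y a" if a: "a \<in> K" for a
    proof -
      have "F x \<le> u a + L * dist x a" unfolding F_def by (rule cINF_lower[OF bdd a])
      also have "\<dots> \<le> u a + L * (dist x y + dist y a)"
        using L dist_triangle[of x a y] by (intro add_left_mono mult_left_mono) auto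
      finally show ?thesis by (simp add: distrib_left)
    qed
    then have "F x - L * dist x y \<le> F y" unfolding F_def[of y] by (intro cINF_greatest False) auto
    then show ?thesis by simp
  qed
  show ?thesis
  proof (rule that)
    show "L-lipschitz_on UNIV F"
    proof (rule lipschitz_onI)
      fix x y show "dist (F x) (F y) \<le> L * dist x y"
        using FF[of x y] FF[of y x] by (simp add: dist_real_def dist_commute abs_le_iff)
    qed fact
    fix x assume x: "x \<in> K"
    have "F x \<le> u x + L * dist x x" unfolding F_def by (rule cINF_lower[OF bdd x])
    moreover have "u x \<le> F x"
      unfolding F_def using ub[OF x] by (intro cINF_greatest False) (simp add: algebra_simps)
    ultimately show "F x = u x" by simp
  qed
next
  case True
  show ?thesis
    by (rule that[of "\<lambda>_. 0"]) (use True lipschitz_on_nonneg[OF u] in \<open>auto intro!: lipschitz_onI\<close>)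
qed

text \<open>Close points share a ball of a finite cover on which \<open>u\<close> is Lipschitz; for
  points at distance at least \<open>d\<close>, boundedness of \<open>u\<close> suffices and
  contributes \<open>2 * \<bar>B\<bar> / d\<close>.\<close>

lemma locally_lipschitz_on_compact:
  fixes u :: "'a::metric_space \<Rightarrow> real"
  assumes U: "open U" "locally_lipschitz_on U u" and K: "compact K" "K \<subseteq> U"
  shows "\<exists>L. L-lipschitz_on K u"
proof -
  have "\<forall>x\<in>K. \<exists>e L. 0 < e \<and> L-lipschitz_on (ball x e) u"
    using U K unfolding locally_lipschitz_on_iff[OF U(1)] lipschitz_near_def by blast
  then obtain e L where eL: "\<And>x. x \<in> K \<Longrightarrow> 0 < e x" "\<And>x. x \<in> K \<Longrightarrow> (L x)-lipschitz_on (ball x (e x)) u"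
    by metis
  obtain T where T: "T \<subseteq> K" "finite T" "K \<subseteq> (\<Union>x\<in>T. ball x (e x / 2))"
  proof (rule compactE_image[OF K(1), of K "\<lambda>x. ball x (e x / 2)"])
    show "K \<subseteq> (\<Union>x\<in>K. ball x (e x / 2))" using eL(1) by force
  qed (auto intro: that)
  \<comment> \<open>A Lebesgue number: the cover uses half radii, which leaves room for the second
    point. The inserted 1 keeps the minimum meaningful for empty \<open>T\<close>.\<close>
  define d where "d = Min (insert 1 ((\<lambda>x. e x / 2) ` T))"
  have d: "0 < d" unfolding d_def using T eL(1) by (subst Min_gr_iff) auto
  have de: "d \<le> e x / 2" if "x \<in> T" for x unfolding d_def using T that by (intro Min_le) auto
  define L1 where "L1 = Max (insert 0 (L ` T))"
  have L1: "0 \<le> L1" "\<And>x. x \<in> T \<Longrightarrow> L x \<le> L1" unfolding L1_def using T by (auto intro!: Max_ge)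
  have "continuous_on K u"
    using locally_lipschitz_on_continuous[OF U] K(2) by (rule continuous_on_subset)
  then have "bounded (u ` K)" using K(1) by (intro compact_imp_bounded compact_continuous_image)
  then obtain B where B: "\<And>x. x \<in> K \<Longrightarrow> \<bar>u x\<bar> \<le> B" unfolding bounded_real by blast
  have "(L1 + 2 * \<bar>B\<bar> / d)-lipschitz_on K u"
  proof (rule lipschitz_onI)
    fix x y assume xy: "x \<in> K" "y \<in> K"
    show "dist (u x) (u y) \<le> (L1 + 2 * \<bar>B\<bar> / d) * dist x y"
    proof (cases "dist x y < d")
      case True
      obtain t where t: "t \<in> T" "dist t x < e t / 2" using T(3) xy(1) by auto
      have "x \<in> ball t (e t)" "y \<in> ball t (e t)"
        using t de[OF t(1)] True dist_triangle[of t y x] eL(1)[of t] T(1) by auto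
      then have "dist (u x) (u y) \<le> L t * dist x y" using lipschitz_onD[OF eL(2)] t T(1) by blast
      also have "\<dots> \<le> (L1 + 2 * \<bar>B\<bar> / d) * dist x y"
        using L1(2)[OF t(1)] d by (intro mult_right_mono) (auto intro: add_increasing2)
      finally show ?thesis .
    next
      case False
      have "dist (u x) (u y) \<le> 2 * \<bar>B\<bar>" using B[OF xy(1)] B[OF xy(2)] by (simp add: dist_real_def)
      also have "\<dots> = 2 * \<bar>B\<bar> / d * d" using d by simp
      also have "\<dots> \<le> 2 * \<bar>B\<bar> / d * dist x y" using d False by (intro mult_left_mono) auto
      also have "\<dots> \<le> (L1 + 2 * \<bar>B\<bar> / d) * dist x y" using L1(1) by (intro mult_right_mono) auto
      finally show ?thesis .
    qed
  qed (use L1 d in auto)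
  then show ?thesis by blast
qed

context doubling_space
begin

text \<open>At a fixed scale the energy is continuous in L1: the error at the centre contributes 1
  and the error in the ball, after averaging, \<open>C\<close>. The factor \<open>1 / R\<close>
  blows up as \<open>R\<close> tends to 0, so approximation has to come before the limit in
  \<open>R\<close>.\<close>

lemma energy_perturb:
  assumes [measurable]: "f \<in> borel_measurable M" "F \<in> borel_measurable M" "W \<in> sets M" "N \<in> sets M"
    and R: "0 < R" and WN: "\<And>x y. x \<in> W \<Longrightarrow> dist x y < R \<Longrightarrow> y \<in> N"
  shows "energy_1 M R f W \<le> energy_1 M R F W
    + ennreal (1 / R) * (ennreal (C + 1) * L1_error N F f)"
proof -
  let ?a = "\<lambda>x. 1 / emeasure M (ball x R)"
  let ?d = "\<lambda>y. ennreal \<bar>F y - f y\<bar>"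
  have osc: "osc f R x \<le> osc F R x + (\<integral>\<^sup>+y\<in>ball x R. ?d y \<partial>M) + ?d x * emeasure M (ball x R)" for x
  proof -
    have "osc f R x \<le> (\<integral>\<^sup>+y. ennreal \<bar>F y - F x\<bar> * indicator (ball x R) y + ?d y * indicator (ball x R) y
        + ?d x * indicator (ball x R) y \<partial>M)"
      unfolding osc_def
    proof (rule nn_integral_mono)
      fix y
      have "ennreal \<bar>f y - f x\<bar> \<le> ennreal (\<bar>F y - F x\<bar> + \<bar>F y - f y\<bar> + \<bar>F x - f x\<bar>)"
        by (intro ennreal_leI) linarith
      also have "\<dots> = ennreal \<bar>F y - F x\<bar> + ?d y + ?d x" by simp
      finally show "ennreal \<bar>f y - f x\<bar> * indicator (ball x R) y \<le> ennreal \<bar>F y - F x\<bar> * indicator (ball x R) y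
        + ?d y * indicator (ball x R) y + ?d x * indicator (ball x R) y"
        by (cases "y \<in> ball x R") simp_all
    qed
    also have "\<dots> = osc F R x + (\<integral>\<^sup>+y\<in>ball x R. ?d y \<partial>M) + ?d x * emeasure M (ball x R)"
      unfolding osc_def
      by (subst nn_integral_add, measurable, subst nn_integral_add, measurable,
          subst nn_integral_cmult_indicator) (simp_all add: sets_M)
    finally show ?thesis .
  qed
  have "(\<integral>\<^sup>+x\<in>W. ?a x * osc f R x \<partial>M) \<le> (\<integral>\<^sup>+x. ?a x * osc F R x * indicator W x
      + ?a x * (\<integral>\<^sup>+y\<in>ball x R. ?d y \<partial>M) * indicator W x + ?d x * indicator W x \<partial>M)"
  proof (rule nn_integral_mono)
    fix x
    have "?a x * osc f R x \<le> ?a x * (osc F R x + (\<integral>\<^sup>+y\<in>ball x R. ?d y \<partial>M) + ?d x * emeasure M (ball x R))"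
      by (intro mult_left_mono osc) simp
    also have "\<dots> = ?a x * osc F R x + ?a x * (\<integral>\<^sup>+y\<in>ball x R. ?d y \<partial>M) + ?d x * (?a x * emeasure M (ball x R))"
      by (simp only: distrib_left ac_simps)
    also have "\<dots> = ?a x * osc F R x + ?a x * (\<integral>\<^sup>+y\<in>ball x R. ?d y \<partial>M) + ?d x"
      by (simp only: emeasure_ball_cancel[OF R] mult_1_right)
    finally show "?a x * osc f R x * indicator W x \<le> ?a x * osc F R x * indicator W x
      + ?a x * (\<integral>\<^sup>+y\<in>ball x R. ?d y \<partial>M) * indicator W x + ?d x * indicator W x"
      by (cases "x \<in> W") simp_all
  qed
  also have "\<dots> = (\<integral>\<^sup>+x\<in>W. ?a x * osc F R x \<partial>M) + (\<integral>\<^sup>+x\<in>W. ?a x * (\<integral>\<^sup>+y\<in>ball x R. ?d y \<partial>M) \<partial>M)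
      + (\<integral>\<^sup>+x\<in>W. ?d x \<partial>M)"
    by (subst nn_integral_add, measurable, subst nn_integral_add, measurable)
  also have "\<dots> \<le> (\<integral>\<^sup>+x\<in>W. ?a x * osc F R x \<partial>M) + ennreal (C ^ 1) * (\<integral>\<^sup>+x\<in>N. ?d x \<partial>M) + (\<integral>\<^sup>+x\<in>N. ?d x \<partial>M)"
  proof (intro add_mono order_refl)
    show "(\<integral>\<^sup>+x\<in>W. ?a x * (\<integral>\<^sup>+y\<in>ball x R. ?d y \<partial>M) \<partial>M) \<le> ennreal (C ^ 1) * (\<integral>\<^sup>+x\<in>N. ?d x \<partial>M)"
      using R WN by (intro average_le) auto
    have "W \<subseteq> N" using WN R by (force intro: WN)
    then show "(\<integral>\<^sup>+x\<in>W. ?d x \<partial>M) \<le> (\<integral>\<^sup>+x\<in>N. ?d x \<partial>M)"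
      by (intro nn_integral_mono) (auto simp: indicator_def)
  qed
  also have "\<dots> = (\<integral>\<^sup>+x\<in>W. ?a x * osc F R x \<partial>M) + ennreal (C + 1) * (\<integral>\<^sup>+x\<in>N. ?d x \<partial>M)"
    using C_ge_1 by (simp add: distrib_right ennreal_plus add.assoc)
  finally have "energy_1 M R f W \<le> ennreal (1 / R) * ((\<integral>\<^sup>+x\<in>W. ?a x * osc F R x \<partial>M) + ennreal (C + 1) * (\<integral>\<^sup>+x\<in>N. ?d x \<partial>M))"
    unfolding energy_1_osc by (intro mult_left_mono) auto
  then show ?thesis by (simp add: distrib_left energy_1_osc)
qed

end

locale poincare_space = doubling_space +
  fixes P \<kappa> :: real
  assumes P_pos: "0 < P" and \<kappa>_ge_1: "1 \<le> \<kappa>"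
    and poincare: "L-lipschitz_on UNIV F \<Longrightarrow> 0 < R \<Longrightarrow>
      (\<integral>\<^sup>+y\<in>ball x R. ennreal \<bar>F y - mean_on M (ball x R) F\<bar> \<partial>M)
           \<le> ennreal (P * R) * (\<integral>\<^sup>+y\<in>ball x (\<kappa> * R). Lip_const F y \<partial>M)"
begin

text \<open>Inserting the mean \<open>m\<close> splits the integrand into two terms; each integrates
  to the volume of the ball times the integral of \<open>\<bar>F - m\<bar>\<close>, whence the
  factor 2.\<close>

lemma double_oscillation_le:
  assumes F: "L-lipschitz_on UNIV F" and R: "0 < R"
  shows "(\<integral>\<^sup>+x\<in>ball z R. (\<integral>\<^sup>+y\<in>ball z R. ennreal \<bar>F y - F x\<bar> \<partial>M) \<partial>M)
    \<le> emeasure M (ball z R) * (2 * (ennreal (P * R) * (\<integral>\<^sup>+y\<in>ball z (\<kappa> * R). Lip_const F y \<partial>M)))"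
proof -
  have [measurable]: "F \<in> borel_measurable M"
    by (rule measurable_lipschitz[OF F])
  have [measurable]: "ball z R \<in> sets M" by (simp add: sets_M)
  define m where "m = mean_on M (ball z R) F"
  let ?d = "\<lambda>y. ennreal \<bar>F y - m\<bar>"
  let ?I = "\<integral>\<^sup>+y\<in>ball z R. ?d y \<partial>M"
  let ?V = "emeasure M (ball z R)"
  have inner: "(\<integral>\<^sup>+y\<in>ball z R. ennreal \<bar>F y - F x\<bar> \<partial>M) \<le> ?I + ?d x * ?V" for x
  proof -
    have "(\<integral>\<^sup>+y\<in>ball z R. ennreal \<bar>F y - F x\<bar> \<partial>M) \<le> (\<integral>\<^sup>+y. ?d y * indicator (ball z R) y + ?d x * indicator (ball z R) y \<partial>M)"
    proof (rule nn_integral_mono)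
      fix y
      show "ennreal \<bar>F y - F x\<bar> * indicator (ball z R) y \<le> ?d y * indicator (ball z R) y + ?d x * indicator (ball z R) y"
        using ennreal_abs_triangle[of "F y" "F x" m] by (cases "y \<in> ball z R") simp_all
    qed
    also have "\<dots> = ?I + ?d x * ?V"
      by (subst nn_integral_add, measurable, subst nn_integral_cmult_indicator) simp_all
    finally show ?thesis .
  qed
  have "(\<integral>\<^sup>+x\<in>ball z R. (\<integral>\<^sup>+y\<in>ball z R. ennreal \<bar>F y - F x\<bar> \<partial>M) \<partial>M)
    \<le> (\<integral>\<^sup>+x. ?I * indicator (ball z R) x + ?V * (?d x * indicator (ball z R) x) \<partial>M)"
  proof (rule nn_integral_mono)
    fix x
    show "(\<integral>\<^sup>+y\<in>ball z R. ennreal \<bar>F y - F x\<bar> \<partial>M) * indicator (ball z R) x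
      \<le> ?I * indicator (ball z R) x + ?V * (?d x * indicator (ball z R) x)"
      using inner[of x] by (cases "x \<in> ball z R") (simp_all add: mult.commute)
  qed
  also have "\<dots> = ?I * ?V + ?V * ?I"
    by (subst nn_integral_add, measurable, subst nn_integral_cmult_indicator, measurable, subst nn_integral_cmult, measurable)
  also have "\<dots> = ?V * (2 * ?I)" by (simp add: mult_2 distrib_left mult.commute)
  also have "\<dots> \<le> ?V * (2 * (ennreal (P * R) * (\<integral>\<^sup>+y\<in>ball z (\<kappa> * R). Lip_const F y \<partial>M)))"
    unfolding m_def by (intro mult_left_mono poincare[OF F R]) auto
  finally show ?thesis .
qed

text \<open>Averaging over an auxiliary centre \<open>z\<close> in \<open>ball x R\<close> and exchanging the integrals replaces the
  oscillation around \<open>x\<close> by the double oscillation over \<open>ball z (2 * R)\<close>; no covering by balls of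
  bounded overlap is needed.\<close>

lemma energy_lipschitz_le:
  assumes F: "L-lipschitz_on UNIV F" and [measurable]: "W \<in> sets M" "N \<in> sets M"
    and R: "0 < R" and WN: "\<And>x y. x \<in> W \<Longrightarrow> dist x y < (1 + 2 * \<kappa>) * R \<Longrightarrow> y \<in> N"
    and k: "2 * \<kappa> \<le> 2 ^ k"
  shows "energy_1 M R F W \<le> ennreal (4 * P * C ^ 4 * C ^ k) * lip_energy N F"
proof -
  have [measurable]: "F \<in> borel_measurable M"
    by (rule measurable_lipschitz[OF F])
  have "locally_lipschitz_on UNIV F"
    using F unfolding locally_lipschitz_on_def by (meson UNIV_I lipschitz_on_subset subset_UNIV zero_less_one)
  from measurable_Lip_const[OF open_UNIV this] have [measurable]: "Lip_const F \<in> borel_measurable M" by simp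
  let ?a = "\<lambda>x. 1 / emeasure M (ball x R)"
  let ?b = "\<lambda>z. 1 / emeasure M (ball z (2 * R))"
  let ?J = "\<lambda>z. \<integral>\<^sup>+y\<in>ball z (\<kappa> * (2 * R)). Lip_const F y \<partial>M"
  define A where "A = (\<Union>x\<in>W. ball x R)"
  have [measurable]: "A \<in> sets M" unfolding A_def sets_M by (intro borel_open) auto
  \<comment> \<open>The product \<open>?a x * emeasure M (ball x R)\<close>, which equals 1, is
    written as an integral over the auxiliary centre \<open>z\<close>.\<close>
  have "(\<integral>\<^sup>+x\<in>W. ?a x * osc F R x \<partial>M)
    = (\<integral>\<^sup>+x. \<integral>\<^sup>+z. ?a x * ?a x * osc F R x * indicator W x * indicator (ball x R) z \<partial>M \<partial>M)"
  proof (rule nn_integral_cong)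
    fix x
    have "(\<integral>\<^sup>+z. ?a x * ?a x * osc F R x * indicator W x * indicator (ball x R) z \<partial>M)
      = ?a x * ?a x * osc F R x * indicator W x * emeasure M (ball x R)"
      by (rule nn_integral_cmult_indicator) (simp add: sets_M)
    also have "\<dots> = ?a x * osc F R x * indicator W x * (?a x * emeasure M (ball x R))" by (simp only: ac_simps)
    also have "\<dots> = ?a x * osc F R x * indicator W x" by (simp only: emeasure_ball_cancel[OF R] mult_1_right)
    finally show "?a x * osc F R x * indicator W x
       = (\<integral>\<^sup>+z. ?a x * ?a x * osc F R x * indicator W x * indicator (ball x R) z \<partial>M)" by simp
  qed
  also have "\<dots> = (\<integral>\<^sup>+z. \<integral>\<^sup>+x. ?a x * ?a x * osc F R x * indicator W x * indicator (ball x R) z \<partial>M \<partial>M)"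
    by (rule MM.Fubini') measurable
  also have "\<dots> \<le> (\<integral>\<^sup>+z. ennreal (C ^ 4 * (4 * P * R)) * (?b z * ?J z * indicator A z) \<partial>M)"
  proof (rule nn_integral_mono)
    fix z
    show "(\<integral>\<^sup>+x. ?a x * ?a x * osc F R x * indicator W x * indicator (ball x R) z \<partial>M)
       \<le> ennreal (C ^ 4 * (4 * P * R)) * (?b z * ?J z * indicator A z)"
    proof (cases "z \<in> A")
      case False
      then have "(\<integral>\<^sup>+x. ?a x * ?a x * osc F R x * indicator W x * indicator (ball x R) z \<partial>M) = (\<integral>\<^sup>+x. 0 \<partial>M)"
        by (intro nn_integral_cong) (auto simp: A_def indicator_def)
      also have "\<dots> \<le> ennreal (C ^ 4 * (4 * P * R)) * (?b z * ?J z * indicator A z)" by simp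
      finally show ?thesis .
    next
      case True
      let ?B = "ball z (2 * R)"
      let ?c = "ennreal (C ^ 2) * ?b z * (ennreal (C ^ 2) * ?b z)"
      have "(\<integral>\<^sup>+x. ?a x * ?a x * osc F R x * indicator W x * indicator (ball x R) z \<partial>M)
         \<le> (\<integral>\<^sup>+x. ?c * ((\<integral>\<^sup>+y\<in>?B. ennreal \<bar>F y - F x\<bar> \<partial>M) * indicator ?B x) \<partial>M)"
      proof (rule nn_integral_mono)
        fix x
        show "?a x * ?a x * osc F R x * indicator W x * indicator (ball x R) z
          \<le> ?c * ((\<integral>\<^sup>+y\<in>?B. ennreal \<bar>F y - F x\<bar> \<partial>M) * indicator ?B x)"
        proof (cases "dist x z < R")
          case d: True
          \<comment> \<open>\<open>R + 2 * R\<close> is at most \<open>4 * R\<close>, hence two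
            doublings; the weight occurs twice and yields \<open>C ^ 4\<close>.\<close>
          have a: "?a x \<le> ennreal (C ^ 2) * ?b z"
            using d R by (intro inverse_vol_compare) (auto simp: dist_commute)
          have o: "osc F R x \<le> (\<integral>\<^sup>+y\<in>?B. ennreal \<bar>F y - F x\<bar> \<partial>M)"
            unfolding osc_def
          proof (rule nn_integral_mono)
            fix y
            have "y \<in> ?B" if "y \<in> ball x R" using that d dist_triangle[of z y x] by (auto simp: dist_commute)
            then show "ennreal \<bar>F y - F x\<bar> * indicator (ball x R) y \<le> ennreal \<bar>F y - F x\<bar> * indicator ?B y"
              by (auto simp: indicator_def)
          qed
          have "?a x * ?a x * osc F R x \<le> ?c * (\<integral>\<^sup>+y\<in>?B. ennreal \<bar>F y - F x\<bar> \<partial>M)"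
            by (intro mult_mono a o) auto
          moreover have "x \<in> ?B" using d R by (auto simp: dist_commute)
          ultimately show ?thesis by (simp add: indicator_def)
        qed simp
      qed
      also have "\<dots> = ?c * (\<integral>\<^sup>+x\<in>?B. (\<integral>\<^sup>+y\<in>?B. ennreal \<bar>F y - F x\<bar> \<partial>M) \<partial>M)"
        by (rule nn_integral_cmult) measurable
      also have "\<dots> \<le> ?c * (emeasure M ?B * (2 * (ennreal (P * (2 * R)) * ?J z)))"
        using R by (intro mult_left_mono double_oscillation_le[OF F]) auto
      also have "\<dots> = (ennreal (C ^ 2) * ennreal (C ^ 2) * 2 * ennreal (P * (2 * R))) * (?b z * ?J z) * (?b z * emeasure M ?B)"
        by (simp only: ac_simps)
      also have "?b z * emeasure M ?B = 1" using R by (intro emeasure_ball_cancel) simp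
      also have "ennreal (C ^ 2) * ennreal (C ^ 2) * 2 * ennreal (P * (2 * R)) = ennreal (C ^ 4 * (4 * P * R))"
      proof -
        have "C ^ 4 * (4 * P * R) = C ^ 2 * C ^ 2 * 2 * (P * (2 * R))" by (simp add: power_numeral_reduce)
        then have "ennreal (C ^ 4 * (4 * P * R)) = ennreal (C ^ 2 * C ^ 2 * 2 * (P * (2 * R)))" by (rule arg_cong)
        also have "\<dots> = ennreal (C ^ 2 * C ^ 2 * 2) * ennreal (P * (2 * R))"
          by (rule ennreal_mult) (use P_pos R in auto)
        also have "ennreal (C ^ 2 * C ^ 2 * 2) = ennreal (C ^ 2 * C ^ 2) * ennreal 2" by (rule ennreal_mult) auto
        also have "ennreal (C ^ 2 * C ^ 2) = ennreal (C ^ 2) * ennreal (C ^ 2)" by (rule ennreal_mult) auto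
        also have "ennreal 2 = 2" by simp
        finally show ?thesis by simp
      qed
      finally show ?thesis using True by simp
    qed
  qed
  also have "\<dots> = ennreal (C ^ 4 * (4 * P * R)) * (\<integral>\<^sup>+z\<in>A. ?b z * ?J z \<partial>M)"
    by (rule nn_integral_cmult) measurable
  also have "\<dots> \<le> ennreal (C ^ 4 * (4 * P * R)) * (ennreal (C ^ k) * lip_energy N F)"
  proof (intro mult_left_mono average_le)
    \<comment> \<open>The reach \<open>(1 + 2 * \<kappa>) * R\<close> in the hypothesis is the sum
      of the distance from \<open>x\<close> to \<open>z\<close> and the radius
      \<open>\<kappa> * (2 * R)\<close> of the ball on the right of the Poincare inequality.\<close>
    fix z y assume z: "z \<in> A" "dist z y < \<kappa> * (2 * R)"
    then obtain x where "x \<in> W" "dist x z < R" by (auto simp: A_def)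
    then show "y \<in> N" using z(2) dist_triangle[of x y z] by (intro WN[of x]) (auto simp: algebra_simps)
  next
    have "2 * (\<kappa> * (2 * R)) = (2 * \<kappa>) * (2 * R)" by simp
    also have "\<dots> \<le> 2 ^ k * (2 * R)" using k R by (intro mult_right_mono) auto
    finally show "2 * (\<kappa> * (2 * R)) \<le> 2 ^ k * (2 * R)" .
  qed (use R \<kappa>_ge_1 in auto)
  finally have "energy_1 M R F W \<le> ennreal (1 / R) * (ennreal (C ^ 4 * (4 * P * R)) * (ennreal (C ^ k) * lip_energy N F))"
    unfolding energy_1_osc by (intro mult_left_mono) auto
  also have "\<dots> = (ennreal (1 / R) * ennreal (C ^ 4 * (4 * P * R)) * ennreal (C ^ k)) * lip_energy N F"
    by (simp only: ac_simps)
  also have "ennreal (1 / R) * ennreal (C ^ 4 * (4 * P * R)) * ennreal (C ^ k) = ennreal (4 * P * C ^ 4 * C ^ k)"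
    using R C_ge_1 P_pos by (simp add: ennreal_mult[symmetric])
  finally show ?thesis .
qed

text \<open>\<open>C ^ 4\<close> stems from two volume comparisons with
  \<open>ball z (2 * R)\<close>, \<open>4 * P\<close> from the Poincare inequality on that ball in
  two variables, and the last power from averaging over balls enlarged by
  \<open>\<kappa>\<close>.\<close>

definition C\<^sub>E :: real where "C\<^sub>E = 4 * P * C ^ 4 * C ^ (LEAST k. 2 * \<kappa> \<le> 2 ^ k)"

lemma C\<^sub>E_pos: "0 < C\<^sub>E" using P_pos C_ge_1 by (simp add: C\<^sub>E_def)

text \<open>If the variation is finite, the threshold \<open>e / (1 + 2 * \<kappa>)\<close> does not
  involve the approximating function. Hence \<open>R\<close> can be fixed and the approximation then
  chosen in dependence on \<open>R\<close>, as the perturbation error demands.\<close>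

lemma energy_le_total_variation:
  assumes f[measurable]: "f \<in> borel_measurable M" and W: "open W" "compactly_in W U" and U: "open U"
  shows "\<exists>r0>0. \<forall>R. 0 < R \<and> R < r0 \<longrightarrow> energy_1 M R f W \<le> ennreal C\<^sub>E * TV f U"
proof (cases "TV f U < top")
  case False
  then have "ennreal C\<^sub>E * TV f U = top"
    using C\<^sub>E_pos by (simp add: ennreal_mult_eq_top_iff less_top[symmetric])
  then show ?thesis by (intro exI[of _ 1]) simp
next
  case fin: True
  define k where "k = (LEAST k. 2 * \<kappa> \<le> 2 ^ k)"
  have "\<exists>k. 2 * \<kappa> \<le> 2 ^ k" using real_arch_pow[of 2 "2 * \<kappa>"] by (auto intro: less_imp_le)
  then have k: "2 * \<kappa> \<le> 2 ^ k" unfolding k_def by (rule LeastI_ex)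
  have cW: "compact (closure W)" "closure W \<subseteq> U" using W by (auto simp: compactly_in_def)
  obtain e K where e: "0 < e" and K: "compact K" "K \<subseteq> U" "(\<Union>x\<in>closure W. ball x e) \<subseteq> K"
    using compact_neighbourhood[OF cW(1) U cW(2)] by blast
  define N where "N = (\<Union>x\<in>W. ball x e)"
  have N: "open N" "N \<subseteq> K" using K(3) closure_subset[of W] by (auto simp: N_def)
  have [measurable]: "W \<in> sets M" "N \<in> sets M" using W N by (auto simp: sets_M)
  have "energy_1 M R f W \<le> ennreal C\<^sub>E * TV f U" if R: "0 < R" "R < e / (1 + 2 * \<kappa>)" for R
  proof (rule ennreal_le_epsilon)
    fix \<eta> :: real assume \<eta>: "0 < \<eta>"
    \<comment> \<open>Two shares of \<open>\<eta> / 2\<close>: \<open>C\<^sub>E * \<epsilon>\<close>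
      for the excess energy and \<open>(C + 1) * d / R\<close> for the perturbation at the fixed
      scale.\<close>
    define \<epsilon> where "\<epsilon> = \<eta> / (2 * C\<^sub>E)"
    define d where "d = \<eta> * R / 2 / (C + 1)"
    have \<epsilon>d: "0 < \<epsilon>" "0 < d" using \<eta> R C_ge_1 C\<^sub>E_pos by (auto simp: \<epsilon>_def d_def)
    have Re: "(1 + 2 * \<kappa>) * R < e" using R \<kappa>_ge_1 by (simp add: field_simps)
    have Re': "R < e"
    proof -
      have "1 * R \<le> (1 + 2 * \<kappa>) * R" using R \<kappa>_ge_1 by (intro mult_right_mono) auto
      then show ?thesis using Re by simp
    qed
    have lt: "TV f U < TV f U + ennreal \<epsilon>" by (rule ennreal_less_add[OF fin \<epsilon>d(1)])
    obtain u where u: "locally_lipschitz_on U u" "lip_energy U u \<le> TV f U + ennreal \<epsilon>"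
      "L1_error K u f < ennreal d"
      using total_variation_lessD[OF lt K(1,2) \<epsilon>d(2)] by blast
    obtain L where "L-lipschitz_on K u" using locally_lipschitz_on_compact[OF U u(1) K(1,2)] by blast
    \<comment> \<open>\<open>F\<close> agrees with \<open>u\<close> on the open set \<open>N\<close>
      inside \<open>K\<close>, so both have the same \<open>Lip_const\<close> there; at this scale
      the estimates on \<open>W\<close> involve \<open>N\<close> only.\<close>
    then obtain F where F: "L-lipschitz_on UNIV F" "\<And>x. x \<in> K \<Longrightarrow> F x = u x"
      using mcshane_extension by blast
    have [measurable]: "F \<in> borel_measurable M"
      by (rule measurable_lipschitz[OF F(1)])
    have 1: "energy_1 M R F W \<le> ennreal C\<^sub>E * lip_energy N F"
      unfolding C\<^sub>E_def k_def[symmetric] using Re R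
    proof (intro energy_lipschitz_le[OF F(1)] k)
      fix x y assume "x \<in> W" "dist x y < (1 + 2 * \<kappa>) * R"
      then show "y \<in> N" using Re by (auto simp: N_def intro!: bexI[of _ x])
    qed auto
    have 2: "lip_energy N F \<le> TV f U + ennreal \<epsilon>"
    proof -
      have "Lip_const F x = Lip_const u x" if "x \<in> N" for x
        using that N F(2) by (intro Lip_const_cong[OF N(1)]) auto
      then have "lip_energy N F \<le> lip_energy U u"
        using N K by (intro nn_integral_mono) (auto simp: indicator_def)
      then show ?thesis using u(2) by (rule order_trans)
    qed
    have 3: "L1_error N F f \<le> ennreal d"
    proof -
      have "L1_error N F f \<le> L1_error K u f"
        using N F(2) by (intro nn_integral_mono) (auto simp: indicator_def)
      then show ?thesis using u(3) by auto
    qed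
    have "energy_1 M R f W \<le> energy_1 M R F W
      + ennreal (1 / R) * (ennreal (C + 1) * L1_error N F f)"
    proof (intro energy_perturb)
      fix x y assume "x \<in> W" "dist x y < R"
      then show "y \<in> N" using Re' by (auto simp: N_def intro!: bexI[of _ x])
    qed (use R in auto)
    also have "\<dots> \<le> ennreal C\<^sub>E * (TV f U + ennreal \<epsilon>) + ennreal (1 / R) * (ennreal (C + 1) * ennreal d)"
      using 2 3 by (intro add_mono mult_left_mono order_trans[OF 1]) auto
    also have "ennreal (1 / R) * (ennreal (C + 1) * ennreal d) = ennreal (\<eta> / 2)"
    proof -
      have cancel: "c * (X / c) = X" if "c \<noteq> 0" for c X :: real using that by simp
      have "(C + 1) * d = \<eta> * R / 2" unfolding d_def by (rule cancel) (use C_ge_1 in simp)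
      then have "1 / R * ((C + 1) * d) = \<eta> / 2" using R by simp
      moreover have "ennreal (1 / R) * (ennreal (C + 1) * ennreal d) = ennreal (1 / R * ((C + 1) * d))"
        using R C_ge_1 \<epsilon>d by (simp add: ennreal_mult[symmetric] del: ennreal_plus)
      ultimately show ?thesis by (simp only:)
    qed
    also have "ennreal C\<^sub>E * (TV f U + ennreal \<epsilon>) = ennreal C\<^sub>E * TV f U + ennreal (\<eta> / 2)"
      using C\<^sub>E_pos \<epsilon>d by (simp add: distrib_left ennreal_mult[symmetric] \<epsilon>_def)
    also have "ennreal C\<^sub>E * TV f U + ennreal (\<eta> / 2) + ennreal (\<eta> / 2)
      = ennreal C\<^sub>E * TV f U + ennreal \<eta>"
      using \<eta> by (simp add: add.assoc ennreal_plus[symmetric] del: ennreal_plus)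
    finally show "energy_1 M R f W \<le> ennreal C\<^sub>E * TV f U + ennreal \<eta>" .
  qed
  moreover have "0 < e / (1 + 2 * \<kappa>)" using e \<kappa>_ge_1 by simp
  ultimately show ?thesis by blast
qed

end

section \<open>The limit of the energies\<close>

text \<open>Here the weights are taken at \<open>x\<close> and the mismatch at \<open>y\<close>. The
  energy integrates over \<open>x\<close>, so the weights localise the two energies to where
  \<open>\<phi>\<close> and \<open>1 - \<phi>\<close> are nonzero, and averaging over balls handles
  the mismatch.\<close>

lemma glue_diff_weighted:
  assumes "0 \<le> \<phi> x" "\<phi> x \<le> 1"
  shows "\<bar>glue \<phi> u v y - glue \<phi> u v x\<bar>
    \<le> \<phi> x * \<bar>u y - u x\<bar> + (1 - \<phi> x) * \<bar>v y - v x\<bar> + \<bar>\<phi> y - \<phi> x\<bar> * \<bar>u y - v y\<bar>"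
proof -
  have "glue \<phi> u v y - glue \<phi> u v x
      = \<phi> x * (u y - u x) + (1 - \<phi> x) * (v y - v x) + (\<phi> y - \<phi> x) * (u y - v y)"
    by (simp add: glue_def algebra_simps)
  also have "\<bar>\<dots>\<bar> \<le> \<bar>\<phi> x * (u y - u x)\<bar> + \<bar>(1 - \<phi> x) * (v y - v x)\<bar> + \<bar>(\<phi> y - \<phi> x) * (u y - v y)\<bar>"
    by linarith
  also have "\<dots> = \<phi> x * \<bar>u y - u x\<bar> + (1 - \<phi> x) * \<bar>v y - v x\<bar> + \<bar>\<phi> y - \<phi> x\<bar> * \<bar>u y - v y\<bar>"
    using assms by (simp add: abs_mult)
  finally show ?thesis .
qed

context doubling_space
begin

lemma energy_1_disjoint:
  assumes [measurable]: "h \<in> borel_measurable M" "A \<in> sets M" "B \<in> sets M" and "A \<inter> B = {}"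
  shows "energy_1 M R h (A \<union> B) = energy_1 M R h A + energy_1 M R h B"
  unfolding energy_1_osc by (subst nn_integral_disjoint_pair) (simp_all add: distrib_left assms)

text \<open>The cutoff varies by at most \<open>L * R\<close> within a ball of radius
  \<open>R\<close>, which cancels the factor \<open>1 / R\<close> of the energy. What remains is an
  L1 distance with a constant independent of \<open>R\<close>, negligible for two sequences with the
  same limit.\<close>

lemma energy_1_glue:
  assumes cut: "cutoff (closure A) S \<phi> L P F" and [measurable]: "u \<in> borel_measurable M" "v \<in> borel_measurable M"
    and W[measurable]: "W \<in> sets M" "S \<in> sets M" "B \<in> sets M" "W \<subseteq> A \<union> B" and R: "0 < R"
  shows "energy_1 M R (glue \<phi> u v) W \<le> energy_1 M R u S + energy_1 M R v B
    + ennreal (L * C) * L1_dist u v"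
proof -
  note \<phi> = cutoffD(1-3)[OF cut] and P = cutoffD(4-6)[OF cut] and F = cutoffD(7-9)[OF cut]
    and L = cutoffD(10)[OF cut]
  have [measurable]: "\<phi> \<in> borel_measurable M"
    by (rule measurable_lipschitz[OF \<phi>(1)])
  let ?w = "glue \<phi> u v"
  have [measurable]: "?w \<in> borel_measurable M" unfolding glue_def[abs_def] by measurable
  let ?a = "\<lambda>x. 1 / emeasure M (ball x R)"
  let ?d = "\<lambda>y. ennreal \<bar>u y - v y\<bar>"
  let ?D = "\<lambda>x. \<integral>\<^sup>+y\<in>ball x R. ?d y \<partial>M"
  have osc: "osc ?w R x \<le> osc u R x * indicator S x + osc v R x * indicator B x + ennreal (L * R) * ?D x"
    if x: "x \<in> W" for x
  proof -
    have ph: "0 \<le> \<phi> x" "\<phi> x \<le> 1" using \<phi> by auto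
    have "osc ?w R x \<le> (\<integral>\<^sup>+y. ennreal \<bar>u y - u x\<bar> * indicator (ball x R) y * indicator S x
       + ennreal \<bar>v y - v x\<bar> * indicator (ball x R) y * indicator B x
       + ennreal (L * R) * (?d y * indicator (ball x R) y) \<partial>M)"
      unfolding osc_def
    proof (rule nn_integral_mono)
      fix y
      show "ennreal \<bar>?w y - ?w x\<bar> * indicator (ball x R) y \<le> ennreal \<bar>u y - u x\<bar> * indicator (ball x R) y * indicator S x
       + ennreal \<bar>v y - v x\<bar> * indicator (ball x R) y * indicator B x
       + ennreal (L * R) * (?d y * indicator (ball x R) y)"
      proof (cases "y \<in> ball x R")
        case True
        have 1: "\<phi> x * \<bar>u y - u x\<bar> \<le> \<bar>u y - u x\<bar> * indicator S x"
        proof (cases "\<phi> x = 0")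
          case False
          then have "x \<in> S" using F by blast
          then show ?thesis using ph by (simp add: mult_left_le_one_le)
        qed simp
        have 2: "(1 - \<phi> x) * \<bar>v y - v x\<bar> \<le> \<bar>v y - v x\<bar> * indicator B x"
        proof (cases "\<phi> x = 1")
          case False
          then have "x \<notin> closure A" using P by blast
          then have "x \<in> B" using x W(4) closure_subset[of A] by blast
          then show ?thesis using ph by (simp add: mult_left_le_one_le)
        qed simp
        have "\<bar>\<phi> y - \<phi> x\<bar> \<le> L * dist y x" using lipschitz_onD[OF \<phi>(1), of y x] by (simp add: dist_real_def)
        also have "\<dots> \<le> L * R" using True L by (intro mult_left_mono) (auto simp: dist_commute)
        finally have "\<bar>\<phi> y - \<phi> x\<bar> * \<bar>u y - v y\<bar> \<le> (L * R) * \<bar>u y - v y\<bar>" by (rule mult_right_mono) simp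
        then have "\<bar>?w y - ?w x\<bar> \<le> \<bar>u y - u x\<bar> * indicator S x + \<bar>v y - v x\<bar> * indicator B x + (L * R) * \<bar>u y - v y\<bar>"
          using 1 2 glue_diff_weighted[where \<phi> = \<phi> and x = x and y = y and u = u and v = v, OF ph] by linarith
        then have "ennreal \<bar>?w y - ?w x\<bar> \<le> ennreal (\<bar>u y - u x\<bar> * indicator S x + \<bar>v y - v x\<bar> * indicator B x + (L * R) * \<bar>u y - v y\<bar>)"
          by (rule ennreal_leI)
        also have "\<dots> = ennreal \<bar>u y - u x\<bar> * indicator S x + ennreal \<bar>v y - v x\<bar> * indicator B x + ennreal (L * R) * ?d y"
        proof -
          have "0 \<le> L * R" using L R by simp
          then show ?thesis
            by (simp add: ennreal_plus ennreal_mult' ennreal_indicator ennreal_mult''[of _ "L * R"] mult.commute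
                split: split_indicator)
        qed
        finally show ?thesis using True by simp
      qed simp
    qed
    also have "\<dots> = osc u R x * indicator S x + osc v R x * indicator B x + ennreal (L * R) * ?D x"
      unfolding osc_def
      by (subst nn_integral_add, measurable, subst nn_integral_add, measurable, subst nn_integral_cmult, measurable,
          subst nn_integral_multc, measurable, subst nn_integral_multc, measurable)
    finally show ?thesis .
  qed
  have "(\<integral>\<^sup>+x\<in>W. ?a x * osc ?w R x \<partial>M) \<le> (\<integral>\<^sup>+x. ?a x * osc u R x * indicator S x + ?a x * osc v R x * indicator B x
     + ennreal (L * R) * (?a x * ?D x * indicator W x) \<partial>M)"
  proof (rule nn_integral_mono)
    fix x
    show "?a x * osc ?w R x * indicator W x \<le> ?a x * osc u R x * indicator S x + ?a x * osc v R x * indicator B x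
     + ennreal (L * R) * (?a x * ?D x * indicator W x)"
    proof (cases "x \<in> W")
      case True
      have "?a x * osc ?w R x \<le> ?a x * (osc u R x * indicator S x + osc v R x * indicator B x + ennreal (L * R) * ?D x)"
        by (intro mult_left_mono osc True) simp
      also have "\<dots> = ?a x * osc u R x * indicator S x + ?a x * osc v R x * indicator B x + ennreal (L * R) * (?a x * ?D x)"
        by (simp only: distrib_left ac_simps)
      finally show ?thesis using True by simp
    qed simp
  qed
  also have "\<dots> = (\<integral>\<^sup>+x\<in>S. ?a x * osc u R x \<partial>M) + (\<integral>\<^sup>+x\<in>B. ?a x * osc v R x \<partial>M)
     + ennreal (L * R) * (\<integral>\<^sup>+x\<in>W. ?a x * ?D x \<partial>M)"
    by (subst nn_integral_add, measurable, subst nn_integral_add, measurable, subst nn_integral_cmult, measurable)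
  also have "\<dots> \<le> (\<integral>\<^sup>+x\<in>S. ?a x * osc u R x \<partial>M) + (\<integral>\<^sup>+x\<in>B. ?a x * osc v R x \<partial>M)
     + ennreal (L * R) * (ennreal (C ^ 1) * (\<integral>\<^sup>+x\<in>UNIV. ?d x \<partial>M))"
    using R W(1) by (intro add_left_mono mult_left_mono average_le) (auto simp: sets_M)
  finally have "energy_1 M R ?w W \<le> ennreal (1 / R) * ((\<integral>\<^sup>+x\<in>S. ?a x * osc u R x \<partial>M)
     + (\<integral>\<^sup>+x\<in>B. ?a x * osc v R x \<partial>M) + ennreal (L * R) * (ennreal (C ^ 1) * (\<integral>\<^sup>+x\<in>UNIV. ?d x \<partial>M)))"
    unfolding energy_1_osc by (intro mult_left_mono) auto
  also have "\<dots> = energy_1 M R u S + energy_1 M R v B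
     + (ennreal (1 / R) * ennreal (L * R) * ennreal (C ^ 1)) * (\<integral>\<^sup>+x. ?d x \<partial>M)"
    by (simp add: energy_1_osc distrib_left mult.assoc)
  also have "ennreal (1 / R) * ennreal (L * R) * ennreal (C ^ 1) = ennreal (L * C)"
    using R L C_ge_1 by (simp add: ennreal_mult[symmetric])
  finally show ?thesis .
qed

lemma L1_converges_glue:
  assumes \<phi>: "L-lipschitz_on UNIV \<phi>" "\<And>x. 0 \<le> \<phi> x" "\<And>x. \<phi> x \<le> 1"
    and u: "L1_converges M u f" and v: "L1_converges M v f"
  shows "L1_converges M (\<lambda>n. glue \<phi> (u n) (v n)) f"
proof -
  have int: "integrable M (u n)" "integrable M (v n)" "integrable M f" for n
    using u v by (auto simp: L1_converges_def)
  then have [measurable]: "u n \<in> borel_measurable M" "v n \<in> borel_measurable M" "f \<in> borel_measurable M" for n by auto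
  have [measurable]: "\<phi> \<in> borel_measurable M"
    by (rule measurable_lipschitz[OF \<phi>(1)])
  have gm[measurable]: "glue \<phi> (u n) (v n) \<in> borel_measurable M" for n unfolding glue_def[abs_def] by measurable
  have bound: "\<bar>glue \<phi> (u n) (v n) x - c\<bar> \<le> \<bar>u n x - c\<bar> + \<bar>v n x - c\<bar>" for n x c
  proof -
    have "\<bar>glue \<phi> (u n) (v n) x - c\<bar> \<le> \<phi> x * \<bar>u n x - c\<bar> + (1 - \<phi> x) * \<bar>v n x - c\<bar>"
      using \<phi> by (intro glue_error) auto
    also have "\<dots> \<le> \<bar>u n x - c\<bar> + \<bar>v n x - c\<bar>" using \<phi>(2,3)[of x] by (intro add_mono mult_left_le_one_le) auto
    finally show ?thesis .
  qed
  have gint: "integrable M (glue \<phi> (u n) (v n))" for n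
  proof (rule Bochner_Integration.integrable_bound)
    show "integrable M (\<lambda>x. \<bar>u n x\<bar> + \<bar>v n x\<bar>)" using int by auto
    show "AE x in M. norm (glue \<phi> (u n) (v n) x) \<le> norm (\<bar>u n x\<bar> + \<bar>v n x\<bar>)"
      using bound[of n _ 0] by (intro AE_I2) simp
  qed (rule gm)
  have "(\<integral>x. \<bar>glue \<phi> (u n) (v n) x - f x\<bar> \<partial>M) \<le> (\<integral>x. \<bar>u n x - f x\<bar> \<partial>M) + (\<integral>x. \<bar>v n x - f x\<bar> \<partial>M)" for n
  proof -
    have "(\<integral>x. \<bar>glue \<phi> (u n) (v n) x - f x\<bar> \<partial>M) \<le> (\<integral>x. \<bar>u n x - f x\<bar> + \<bar>v n x - f x\<bar> \<partial>M)"
      using int gint by (intro integral_mono bound) auto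
    also have "\<dots> = (\<integral>x. \<bar>u n x - f x\<bar> \<partial>M) + (\<integral>x. \<bar>v n x - f x\<bar> \<partial>M)"
      using int by (intro Bochner_Integration.integral_add) auto
    finally show ?thesis .
  qed
  moreover have "(\<lambda>n. (\<integral>x. \<bar>u n x - f x\<bar> \<partial>M) + (\<integral>x. \<bar>v n x - f x\<bar> \<partial>M)) \<longlonglongrightarrow> 0 + 0"
    using u v unfolding L1_converges_def by (intro tendsto_add) auto
  then have lim: "(\<lambda>n. (\<integral>x. \<bar>u n x - f x\<bar> \<partial>M) + (\<integral>x. \<bar>v n x - f x\<bar> \<partial>M)) \<longlonglongrightarrow> 0" by simp
  ultimately have "(\<lambda>n. \<integral>x. \<bar>glue \<phi> (u n) (v n) x - f x\<bar> \<partial>M) \<longlonglongrightarrow> 0"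
    by (intro tendsto_sandwich[OF always_eventually always_eventually tendsto_const lim]) auto
  then show ?thesis using gint int by (auto simp: L1_converges_def)
qed

lemma L1_converges_const: "integrable M f \<Longrightarrow> L1_converges M (\<lambda>_. f) f"
  by (simp add: L1_converges_def)

end

text \<open>The convergence is restated with values in \<open>ennreal\<close>; the passage from the
  extended reals is justified separately, by nonnegativity of the limit.\<close>

locale energy_limit = poincare_space +
  fixes rn :: "nat \<Rightarrow> real" and G :: "('a \<Rightarrow> real) \<Rightarrow> 'a set \<Rightarrow> ennreal"
  assumes rn_pos: "\<And>n. 0 < rn n" and rn_lim: "rn \<longlonglongrightarrow> 0"
    and G_liminf: "\<And>f fn U. open U \<Longrightarrow> L1_converges M fn f \<Longrightarrow> G f U \<le> liminf (\<lambda>n. energy_1 M (rn n) (fn n) U)"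
    and G_limsup: "\<And>f U V. integrable M f \<Longrightarrow> open U \<Longrightarrow> open V \<Longrightarrow> compactly_in U V \<Longrightarrow>
      \<exists>fn. L1_converges M fn f \<and> limsup (\<lambda>n. energy_1 M (rn n) (fn n) U) \<le> G f V"
    and G_inner: "\<And>f V. integrable M f \<Longrightarrow> open V \<Longrightarrow> G f V = (SUP U\<in>{U. open U \<and> compactly_in U V}. G f U)"
begin

lemma G_mono:
  assumes "integrable M f" "open U" "open V" "U \<subseteq> V"
  shows "G f U \<le> G f V"
  unfolding G_inner[OF assms(1,2)] G_inner[OF assms(1,3)]
  using assms(4) by (intro SUP_subset_mono) (auto simp: compactly_in_def)

lemma G_empty: "integrable M f \<Longrightarrow> G f {} = 0"
  using G_liminf[OF open_empty L1_converges_const, of f] by (simp add: energy_1_def Liminf_const)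

text \<open>One recovery sequence for \<open>A' \<union> B'\<close> serves both pieces in the liminf
  inequality, and the energy splits over disjoint sets. The two suprema are then taken one after the
  other.\<close>

lemma G_superadd:
  assumes f: "integrable M f" and AB: "open A" "open B" "A \<inter> B = {}"
  shows "G f A + G f B \<le> G f (A \<union> B)"
proof -
  let ?S = "\<lambda>A. {U. open U \<and> compactly_in U A}"
  have ne: "?S X \<noteq> {}" for X by (auto intro!: exI[of _ "{}"] simp: compactly_in_def)
  have *: "G f A' + G f B' \<le> G f (A \<union> B)" if A': "open A'" "compactly_in A' A" and B': "open B'" "compactly_in B' B" for A' B'
  proof -
    have disj: "A' \<inter> B' = {}" 
    proof -
      have "A' \<subseteq> A" "B' \<subseteq> B" using A' B' closure_subset by (auto simp: compactly_in_def)
      then show ?thesis using AB(3) by blast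
    qed
    have "compactly_in (A' \<union> B') (A \<union> B)" using A' B' by (auto simp: compactly_in_def)
    then obtain fn where fn: "L1_converges M fn f" "limsup (\<lambda>n. energy_1 M (rn n) (fn n) (A' \<union> B')) \<le> G f (A \<union> B)"
      using G_limsup[OF f, of "A' \<union> B'" "A \<union> B"] A' B' AB by blast
    have "G f A' + G f B' \<le> liminf (\<lambda>n. energy_1 M (rn n) (fn n) A') + liminf (\<lambda>n. energy_1 M (rn n) (fn n) B')"
      using A' B' fn by (intro add_mono G_liminf)
    also have "\<dots> \<le> liminf (\<lambda>n. energy_1 M (rn n) (fn n) A' + energy_1 M (rn n) (fn n) B')"
      by (rule liminf_add_le_ennreal)
    also have "(\<lambda>n. energy_1 M (rn n) (fn n) A' + energy_1 M (rn n) (fn n) B') = (\<lambda>n. energy_1 M (rn n) (fn n) (A' \<union> B'))"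
      using A' B' disj fn(1) by (intro ext energy_1_disjoint[symmetric]) (auto simp: sets_M L1_converges_def)
    also have "liminf \<dots> \<le> limsup \<dots>" by (intro Liminf_le_Limsup) simp
    also note fn(2)
    finally show ?thesis .
  qed
  have "G f A + G f B' \<le> G f (A \<union> B)" if B': "open B'" "compactly_in B' B" for B'
  proof -
    have "G f A + G f B' = (SUP A'\<in>?S A. G f A' + G f B')"
      by (subst G_inner[OF f AB(1)], rule ennreal_SUP_add_left[OF ne, symmetric])
    also have "\<dots> \<le> G f (A \<union> B)" using * B' by (intro SUP_least) auto
    finally show ?thesis .
  qed
  then have "(SUP B'\<in>?S B. G f A + G f B') \<le> G f (A \<union> B)" by (intro SUP_least) auto
  moreover have "G f A + G f B = (SUP B'\<in>?S B. G f A + G f B')"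
    by (subst G_inner[OF f AB(2)], rule ennreal_SUP_add_right[OF ne])
  ultimately show ?thesis by simp
qed

text \<open>Recovery sequences for \<open>A\<close> and \<open>B\<close> are glued. The cutoff falls
  from 1 to 0 inside \<open>S\<close>, which lies between \<open>closure A'\<close> and
  \<open>A\<close>, so the energy of \<open>u n\<close> enters only on \<open>S\<close>; points of
  \<open>W\<close> outside \<open>A'\<close> lie in \<open>B'\<close>, where \<open>v n\<close> is
  controlled.\<close>

lemma G_subadd:
  assumes f: "integrable M f" and AB: "open A" "open B"
  shows "G f (A \<union> B) \<le> G f A + G f B"
  unfolding G_inner[OF f open_Un[OF AB]]
proof (rule SUP_least, clarify)
  fix W assume W: "open W" "compactly_in W (A \<union> B)"
  obtain A' B' where A'B': "open A'" "open B'" "compactly_in A' A" "compactly_in B' B" "closure W \<subseteq> A' \<union> B'"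
    using compactly_in_Un[OF W(2) AB] by blast
  \<comment> \<open>With an empty second set the covering lemma yields an intermediate open
    \<open>S\<close> with \<open>closure A' \<subseteq> S\<close>, compactly contained in
    \<open>A\<close>.\<close>
  have A'A: "compactly_in A' (A \<union> {})" using A'B' by simp
  obtain S T where ST: "open S" "open T" "compactly_in S A" "compactly_in T {}" "closure A' \<subseteq> S \<union> T"
    using compactly_in_Un[OF A'A AB(1) open_empty] by blast
  have S: "closure A' \<subseteq> S" using ST closure_subset[of T] by (auto simp: compactly_in_def)
  obtain \<phi> L P F where cut: "cutoff (closure A') S \<phi> L P F"
    using cutoff_exists[OF _ ST(1) S] A'B'(3) by (auto simp: compactly_in_def)
  obtain u where u: "L1_converges M u f" "limsup (\<lambda>n. energy_1 M (rn n) (u n) S) \<le> G f A"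
    using G_limsup[OF f ST(1) AB(1) ST(3)] by blast
  obtain v where v: "L1_converges M v f" "limsup (\<lambda>n. energy_1 M (rn n) (v n) B') \<le> G f B"
    using G_limsup[OF f A'B'(2) AB(2) A'B'(4)] by blast
  let ?w = "\<lambda>n. glue \<phi> (u n) (v n)"
  have int: "integrable M (u n)" "integrable M (v n)" for n
    using u v by (auto simp: L1_converges_def)
  then have [measurable]: "u n \<in> borel_measurable M" "v n \<in> borel_measurable M" for n by auto
  have [measurable]: "f \<in> borel_measurable M" using f by simp
  have w: "L1_converges M ?w f" using L1_converges_glue[OF cutoffD(1-3)[OF cut] u(1) v(1)] .
  have LC: "0 \<le> L * C" using cutoffD(10)[OF cut] C_ge_1 by simp
  have uv: "(\<lambda>n. ennreal (L * C) * L1_dist (u n) (v n)) \<longlonglongrightarrow> 0"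
  proof -
    have le: "L1_dist (u n) (v n) \<le> L1_dist (u n) f + L1_dist (v n) f" for n
    proof -
      have "L1_dist (u n) (v n) \<le> (\<integral>\<^sup>+x. ennreal \<bar>u n x - f x\<bar> + ennreal \<bar>v n x - f x\<bar> \<partial>M)"
        by (intro nn_integral_mono ennreal_abs_triangle)
      also have "\<dots> = L1_dist (u n) f + L1_dist (v n) f"
        by (rule nn_integral_add) measurable
      finally show ?thesis .
    qed
    have "(\<lambda>n. L1_dist (u n) f + L1_dist (v n) f) \<longlonglongrightarrow> 0 + 0"
      by (intro tendsto_add L1_converges_nn u v)
    then have lim: "(\<lambda>n. L1_dist (u n) f + L1_dist (v n) f) \<longlonglongrightarrow> 0" by simp
    have "(\<lambda>n. L1_dist (u n) (v n)) \<longlonglongrightarrow> 0"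
      using le by (intro tendsto_0_le_ennreal[OF lim] always_eventually) auto
    then have "(\<lambda>n. ennreal (L * C) * L1_dist (u n) (v n)) \<longlonglongrightarrow> ennreal (L * C) * 0"
      by (intro ennreal_tendsto_cmult) auto
    then show ?thesis by simp
  qed
  show "G f W \<le> G f A + G f B"
  proof (rule ennreal_le_epsilon)
    fix e :: real assume e: "0 < e" and fin: "G f A + G f B < top"
    have "G f A < G f A + ennreal (e / 3)" "G f B < G f B + ennreal (e / 3)"
      using fin e by (auto intro!: ennreal_less_add simp: less_top)
    then have "\<forall>\<^sub>F n in sequentially. energy_1 M (rn n) (u n) S < G f A + ennreal (e / 3)"
      "\<forall>\<^sub>F n in sequentially. energy_1 M (rn n) (v n) B' < G f B + ennreal (e / 3)"
      using u(2) v(2) by (auto intro!: Limsup_lessD elim: le_less_trans)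
    moreover have "\<forall>\<^sub>F n in sequentially. ennreal (L * C) * L1_dist (u n) (v n) < ennreal (e / 3)"
      using e by (intro order_tendstoD(2)[OF uv]) auto
    ultimately have "\<forall>\<^sub>F n in sequentially. energy_1 M (rn n) (?w n) W \<le> G f A + G f B + ennreal e"
    proof eventually_elim
      case (elim n)
      have "energy_1 M (rn n) (?w n) W \<le> energy_1 M (rn n) (u n) S + energy_1 M (rn n) (v n) B'
         + ennreal (L * C) * L1_dist (u n) (v n)"
        using W(1) ST(1) A'B' closure_subset[of W] rn_pos[of n]
        by (intro energy_1_glue[OF cut]) (auto simp: sets_M)
      also have "\<dots> \<le> (G f A + ennreal (e / 3)) + (G f B + ennreal (e / 3)) + ennreal (e / 3)"
        using elim by (intro add_mono) auto
      also have "\<dots> = G f A + G f B + (ennreal (e / 3) + ennreal (e / 3) + ennreal (e / 3))" by (simp only: ac_simps)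
      also have "ennreal (e / 3) + ennreal (e / 3) + ennreal (e / 3) = ennreal e" using e by (rule ennreal_thirds)
      finally show ?case .
    qed
    then have "liminf (\<lambda>n. energy_1 M (rn n) (?w n) W) \<le> G f A + G f B + ennreal e" by (intro Liminf_le) auto
    then show "G f W \<le> G f A + G f B + ennreal e" using G_liminf[OF W(1) w] by (rule order_trans[rotated])
  qed
qed

text \<open>The recovery sequence is taken on \<open>W\<close> compactly contained in
  \<open>V\<close>; inner regularity of the total variation carries the bound over to
  \<open>V\<close>.\<close>

lemma total_variation_le_G:
  assumes f: "integrable M f" and V: "open V"
  shows "TV f V \<le> ennreal C\<^sub>S * G f V"
proof (cases "G f V < top")
  case True
  have "TV f W \<le> ennreal C\<^sub>S * G f V" if W: "open W" "compactly_in W V" for W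
  proof -
    obtain fn where fn: "L1_converges M fn f" "limsup (\<lambda>n. energy_1 M (rn n) (fn n) W) \<le> G f V"
      using G_limsup[OF f W(1) V W(2)] by blast
    have "TV f W \<le> ennreal C\<^sub>S * limsup (\<lambda>n. energy_1 M (rn n) (fn n) W)"
      using True fn(2) by (intro total_variation_le_energy fn(1) rn_pos rn_lim W(1)) auto
    also have "\<dots> \<le> ennreal C\<^sub>S * G f V" using fn(2) by (intro mult_left_mono) auto
    finally show ?thesis .
  qed
  then have "(SUP W\<in>{W. open W \<and> compactly_in W V}. TV f W) \<le> ennreal C\<^sub>S * G f V"
    by (intro SUP_least) auto
  with total_variation_inner_regular[OF borel_measurable_integrable[OF f] V] show ?thesis by (rule order_trans)
next
  case False
  have "0 < C\<^sub>S" by (rule C\<^sub>S_pos)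
  moreover have "G f V = top" using False by (simp add: less_top[symmetric])
  ultimately have "ennreal C\<^sub>S * G f V = top"
    by (intro iffD2[OF ennreal_mult_eq_top_iff] disjI2 conjI) (simp_all only: ennreal_eq_0_iff not_le)
  then show ?thesis by (simp only: top_greatest)
qed

text \<open>The liminf inequality is applied to the constant sequence \<open>f\<close>: its energies
  on \<open>W\<close> are bounded by the variation on \<open>V\<close> once the scale is small.
  Inner regularity of \<open>G\<close> passes from \<open>W\<close> to \<open>V\<close>.\<close>

lemma G_le_total_variation:
  assumes f: "integrable M f" and V: "open V"
  shows "G f V \<le> ennreal C\<^sub>E * TV f V"
  unfolding G_inner[OF f V]
proof (rule SUP_least, clarify)
  fix W assume W: "open W" "compactly_in W V"
  obtain r0 where r0: "0 < r0" "\<And>R. 0 < R \<Longrightarrow> R < r0 \<Longrightarrow> energy_1 M R f W \<le> ennreal C\<^sub>E * TV f V"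
    using energy_le_total_variation[OF _ W V, of f] f by auto
  have "\<forall>\<^sub>F n in sequentially. rn n < r0" using rn_lim r0(1) by (rule order_tendstoD)
  then have "\<forall>\<^sub>F n in sequentially. energy_1 M (rn n) f W \<le> ennreal C\<^sub>E * TV f V"
    by eventually_elim (use r0(2) rn_pos in blast)
  then have "liminf (\<lambda>n. energy_1 M (rn n) f W) \<le> ennreal C\<^sub>E * TV f V"
    by (intro Liminf_le) auto
  then show "G f W \<le> ennreal C\<^sub>E * TV f V"
    using G_liminf[OF W(1) L1_converges_const[OF f]] by (rule order_trans[rotated])
qed

lemma G_finite:
  assumes f: "f \<in> KS_1_1 M"
  shows "G f UNIV < \<infinity>"
proof -
  have int: "integrable M f" and lim: "Limsup (at_right 0) (\<lambda>R. energy_1 M R f UNIV) < \<infinity>"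
    using f by (auto simp: KS_1_1_def)
  obtain b where b: "Limsup (at_right 0) (\<lambda>R. energy_1 M R f UNIV) < ennreal b"
  proof (cases "Limsup (at_right 0) (\<lambda>R. energy_1 M R f UNIV)" rule: ennreal_cases)
    case (real b)
    then show ?thesis using that[of "b + 1"] by (simp add: ennreal_less_iff)
  qed (use lim in auto)
  have "\<forall>\<^sub>F R in at_right 0. energy_1 M R f UNIV < ennreal b" by (rule Limsup_lessD[OF b])
  moreover have "filterlim rn (at_right 0) sequentially"
    using rn_lim rn_pos by (intro tendsto_imp_filterlim_at_right) auto
  ultimately have "\<forall>\<^sub>F n in sequentially. energy_1 M (rn n) f UNIV < ennreal b"
    by (rule eventually_compose_filterlim)
  then have "liminf (\<lambda>n. energy_1 M (rn n) f UNIV) \<le> ennreal b"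
    by (intro Liminf_le) (auto elim: eventually_mono)
  then have "G f UNIV \<le> ennreal b" using G_liminf[OF open_UNIV L1_converges_const[OF int]] by (rule order_trans[rotated])
  then show ?thesis by (simp add: le_less_trans)
qed

lemma open_set_function_G:
  assumes "f \<in> KS_1_1 M"
  shows "open_set_function (G f)"
proof
  have f: "integrable M f" using assms by (simp add: KS_1_1_def)
  show "G f {} = 0" by (rule G_empty[OF f])
  show "G f UNIV < \<infinity>" by (rule G_finite[OF assms])
  fix U V :: "'a set" assume U: "open U"
  show "G f U \<le> (SUP W\<in>{W. open W \<and> compactly_in W U}. G f W)" by (rule eq_refl[OF G_inner[OF f U]])
  assume V: "open V"
  show "G f (U \<union> V) \<le> G f U + G f V" by (rule G_subadd[OF f U V])
  show "U \<subseteq> V \<Longrightarrow> G f U \<le> G f V" by (rule G_mono[OF f U V])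
  show "U \<inter> V = {} \<Longrightarrow> G f U + G f V \<le> G f (U \<union> V)" by (rule G_superadd[OF f U V])
qed

text \<open>Finiteness of the variation is inherited from \<open>G\<close> through the smoothing
  bound on the whole space.\<close>

lemma open_set_function_variation:
  assumes "f \<in> KS_1_1 M"
  shows "open_set_function (TV f)"
proof (rule open_set_function_total_variation)
  have f: "integrable M f" using assms by (simp add: KS_1_1_def)
  then show "f \<in> borel_measurable M" by simp
  show "TV f UNIV < \<infinity>"
    using total_variation_le_G[OF f open_UNIV] G_finite[OF assms]
    by (simp add: ennreal_mult_less_top le_less_trans)
qed

end

lemma is_radon_extension_outer_extension:
  assumes "open_set_function a" "\<And>U. open U \<Longrightarrow> F U = enn2ereal (a U)"
  shows "is_radon_extension (outer_extension a) F"
  using open_set_function.radon_outer_extension[OF assms(1)]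
    open_set_function.emeasure_outer_extension_open[OF assms(1)] assms(2)
  by (simp add: is_radon_extension_def)

lemma outer_extension_dominated:
  assumes a: "open_set_function a" and b: "open_set_function b" and le: "\<And>U. open U \<Longrightarrow> a U \<le> ennreal K * b U"
  shows "absolutely_continuous (outer_extension b) (outer_extension a)"
    "bounded_RN_deriv (outer_extension b) (outer_extension a)"
proof -
  note sets = open_set_function.sets_outer_extension
  have "emeasure (outer_extension a) A \<le> ennreal K * emeasure (outer_extension b) A"
    if "A \<in> sets (outer_extension b)" for A
    using that outer_extension_le[OF a b le] by (simp add: sets[OF b])
  note bounded_RN_derivI[OF open_set_function.finite_outer_extension[OF b]
      open_set_function.finite_outer_extension[OF a] _ this]
  then show "absolutely_continuous (outer_extension b) (outer_extension a)"
    "bounded_RN_deriv (outer_extension b) (outer_extension a)" by (simp_all only: sets[OF a] sets[OF b])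
qed

section \<open>From extended real values to \<open>ennreal\<close>, and the comparison of the
  measures\<close>

lemma Gamma_bar_liminf:
  "Gamma_bar_converges M En E \<Longrightarrow> open U \<Longrightarrow> L1_converges M fn f \<Longrightarrow> E f U \<le> liminf (\<lambda>n. En n (fn n) U)"
  unfolding Gamma_bar_converges_def by (drule conjunct1) blast

lemma Gamma_bar_limsup:
  "Gamma_bar_converges M En E \<Longrightarrow> integrable M f \<Longrightarrow> open U \<Longrightarrow> open V \<Longrightarrow> compactly_in U V \<Longrightarrow>
    \<exists>fn. L1_converges M fn f \<and> limsup (\<lambda>n. En n (fn n) U) \<le> E f V"
  unfolding Gamma_bar_converges_def by (drule conjunct2, drule conjunct1) blast

lemma Gamma_bar_inner:
  "Gamma_bar_converges M En E \<Longrightarrow> integrable M f \<Longrightarrow> open V \<Longrightarrow>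
    E f V = (SUP U\<in>{U. open U \<and> compactly_in U V}. E f U)"
  unfolding Gamma_bar_converges_def by (drule conjunct2, drule conjunct2) blast

text \<open>The empty set is compactly contained in every \<open>V\<close>, so the limsup of some
  nonnegative energies on the empty set bounds the limit from below.\<close>

lemma Gamma_bar_converges_nonneg:
  assumes "Gamma_bar_converges M (\<lambda>n f U. enn2ereal (E n f U)) \<Gamma>" "integrable M f" "open V"
  shows "0 \<le> \<Gamma> f V"
proof -
  obtain fn where fn: "limsup (\<lambda>n. enn2ereal (E n (fn n) {})) \<le> \<Gamma> f V"
    using Gamma_bar_limsup[OF assms(1,2) open_empty assms(3)] by (auto simp: compactly_in_def)
  have "0 \<le> liminf (\<lambda>n. enn2ereal (E n (fn n) {}))" by (intro Liminf_bounded) simp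
  also have "\<dots> \<le> limsup (\<lambda>n. enn2ereal (E n (fn n) {}))" by (intro Liminf_le_Limsup) simp
  finally show ?thesis using fn by simp
qed

lemma liminf_enn2ereal: "liminf (\<lambda>n. enn2ereal (x n)) = enn2ereal (liminf x)"
  by (rule Liminf_compose_continuous_mono) (auto intro!: monoI continuous_on_enn2ereal simp: less_eq_ennreal.rep_eq[symmetric])

lemma limsup_enn2ereal: "limsup (\<lambda>n. enn2ereal (x n)) = enn2ereal (limsup x)"
  by (rule Limsup_compose_continuous_mono) (auto intro!: monoI continuous_on_enn2ereal simp: less_eq_ennreal.rep_eq[symmetric])

theorem theorem4p1:
  fixes M :: "'a::complete_space measure"
    and r :: "nat \<Rightarrow> real"
    and \<Gamma>\<^sub>1 :: "('a \<Rightarrow> real) \<Rightarrow> 'a set \<Rightarrow> ereal"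
  assumes cheeger: "cheeger_space_1 M"
    and r_pos: "\<And>n. r n > 0"
    and r_lim: "r \<longlonglongrightarrow> 0"
    and Gamma_bar: "Gamma_bar_converges M (\<lambda>n f U. enn2ereal (energy_1 M (r n) f U)) \<Gamma>\<^sub>1"
    and Gamma_global: "\<exists>F. Gamma_converges M (\<lambda>n f. enn2ereal (energy_1 M (r n) f UNIV)) F"
  shows "(\<exists>C\<^sub>1>0. \<exists>C\<^sub>2>0. \<forall>f\<in>KS_1_1 M. \<forall>U. open U \<longrightarrow> compact (closure U) \<longrightarrow>
            ereal C\<^sub>1 * enn2ereal (total_variation M f U) \<le> \<Gamma>\<^sub>1 f U \<and>
            \<Gamma>\<^sub>1 f U \<le> ereal C\<^sub>2 * enn2ereal (total_variation M f U)) \<and>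
         (\<forall>f\<in>KS_1_1 M.
            is_radon_extension (variation_measure M f) (\<lambda>U. enn2ereal (total_variation M f U)) \<and>
            is_radon_extension (Gamma_measure \<Gamma>\<^sub>1 f) (\<Gamma>\<^sub>1 f) \<and>
            finite_measure (Gamma_measure \<Gamma>\<^sub>1 f) \<and>
            absolutely_continuous (variation_measure M f) (Gamma_measure \<Gamma>\<^sub>1 f) \<and>
            absolutely_continuous (Gamma_measure \<Gamma>\<^sub>1 f) (variation_measure M f) \<and>
            bounded_RN_deriv (variation_measure M f) (Gamma_measure \<Gamma>\<^sub>1 f) \<and>
            bounded_RN_deriv (Gamma_measure \<Gamma>\<^sub>1 f) (variation_measure M f))"
proof -
  obtain C0 where C0: "C0 > 0" and vd: "\<And>x R. 0 < R \<Longrightarrow> 0 < emeasure M (ball x (2 * R)) \<and>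
        emeasure M (ball x (2 * R)) \<le> ennreal C0 * emeasure M (ball x R) \<and> ennreal C0 * emeasure M (ball x R) < \<infinity>"
    using cheeger unfolding cheeger_space_1_def volume_doubling_def by blast
  obtain P \<kappa> where P: "P > 0" "\<kappa> \<ge> 1" and pi: "\<And>f x R. (\<exists>L. L-lipschitz_on UNIV f) \<Longrightarrow> 0 < R \<Longrightarrow>
           (\<integral>\<^sup>+y\<in>ball x R. ennreal \<bar>f y - mean_on M (ball x R) f\<bar> \<partial>M)
           \<le> ennreal (P * R) * (\<integral>\<^sup>+y\<in>ball x (\<kappa> * R). Lip_const f y \<partial>M)"
    using cheeger unfolding cheeger_space_1_def poincare_1_def by blast
  define G where "G f U = e2ennreal (\<Gamma>\<^sub>1 f U)" for f :: "'a \<Rightarrow> real" and U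
  have G: "\<Gamma>\<^sub>1 f U = enn2ereal (G f U)" if "integrable M f" "open U" for f U
    using Gamma_bar_converges_nonneg[OF Gamma_bar that] by (simp add: G_def enn2ereal_e2ennreal)
  \<comment> \<open>Enlarging the doubling constant to at least 1 preserves the doubling inequality
    and gives \<open>C_ge_1\<close>.\<close>
  interpret energy_limit M "max C0 1" P \<kappa> r G
  proof
    show "sets M = sets borel" using cheeger by (simp add: cheeger_space_1_def radon_measure_def)
    show "1 \<le> max C0 1" by simp
    show "emeasure M (ball x R) < \<infinity>" for x R
    proof (cases "0 < R")
      case True
      then show ?thesis using vd[of R x] C0 by (auto simp: ennreal_mult_less_top)
    qed (simp add: ball_empty)
    \<comment> \<open>Positivity in \<open>volume_doubling\<close> is stated for the doubled ball,
      hence the radius \<open>R / 2\<close>.\<close>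
    show "0 < emeasure M (ball x R)" if "0 < R" for x R using vd[of "R / 2" x] that by simp
    show "emeasure M (ball x (2 * R)) \<le> ennreal (max C0 1) * emeasure M (ball x R)" if "0 < R" for x R
    proof -
      have "emeasure M (ball x (2 * R)) \<le> ennreal C0 * emeasure M (ball x R)" using vd[OF that] by simp
      also have "\<dots> \<le> ennreal (max C0 1) * emeasure M (ball x R)" by (intro mult_right_mono ennreal_leI) auto
      finally show ?thesis .
    qed
    show "0 < P" "1 \<le> \<kappa>" using P by auto
    show "(\<integral>\<^sup>+y\<in>ball x R. ennreal \<bar>F y - mean_on M (ball x R) F\<bar> \<partial>M)
           \<le> ennreal (P * R) * (\<integral>\<^sup>+y\<in>ball x (\<kappa> * R). Lip_const F y \<partial>M)"
      if "L-lipschitz_on UNIV F" "0 < R" for L F R x using pi that by blast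
    show "0 < r n" for n by (rule r_pos)
    show "r \<longlonglongrightarrow> 0" by (rule r_lim)
    show "G f U \<le> liminf (\<lambda>n. energy_1 M (r n) (fn n) U)" if "open U" "L1_converges M fn f" for f fn U
    proof -
      have "\<Gamma>\<^sub>1 f U \<le> liminf (\<lambda>n. enn2ereal (energy_1 M (r n) (fn n) U))"
        by (rule Gamma_bar_liminf[OF Gamma_bar that])
      then have "enn2ereal (G f U) \<le> enn2ereal (liminf (\<lambda>n. energy_1 M (r n) (fn n) U))"
        using G[of f U] that by (simp add: liminf_enn2ereal L1_converges_def)
      then show ?thesis by (simp add: less_eq_ennreal.rep_eq)
    qed
    show "\<exists>fn. L1_converges M fn f \<and> limsup (\<lambda>n. energy_1 M (r n) (fn n) U) \<le> G f V"
      if "integrable M f" "open U" "open V" "compactly_in U V" for f U V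
    proof -
      have "\<exists>fn. L1_converges M fn f \<and> limsup (\<lambda>n. enn2ereal (energy_1 M (r n) (fn n) U)) \<le> \<Gamma>\<^sub>1 f V"
        by (rule Gamma_bar_limsup[OF Gamma_bar that])
      then show ?thesis using G[OF that(1,3)] by (auto simp: limsup_enn2ereal less_eq_ennreal.rep_eq)
    qed
    show "G f V = (SUP U\<in>{U. open U \<and> compactly_in U V}. G f U)" if f: "integrable M f" and V: "open V" for f V
    proof -
      have S: "\<Gamma>\<^sub>1 f V = (SUP U\<in>{U. open U \<and> compactly_in U V}. \<Gamma>\<^sub>1 f U)"
        by (rule Gamma_bar_inner[OF Gamma_bar f V])
      show ?thesis
      proof (rule antisym)
        have "\<Gamma>\<^sub>1 f V \<le> enn2ereal (SUP U\<in>{U. open U \<and> compactly_in U V}. G f U)"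
          unfolding S by (rule SUP_least) (auto simp: G[OF f] less_eq_ennreal.rep_eq[symmetric] intro!: SUP_upper)
        then show "G f V \<le> (SUP U\<in>{U. open U \<and> compactly_in U V}. G f U)"
          using G[OF f V] by (simp add: less_eq_ennreal.rep_eq)
        have "\<Gamma>\<^sub>1 f U \<le> \<Gamma>\<^sub>1 f V" if "open U" "compactly_in U V" for U
          unfolding S using that by (intro SUP_upper) auto
        then show "(SUP U\<in>{U. open U \<and> compactly_in U V}. G f U) \<le> G f V"
          using G[OF f] V by (intro SUP_least) (auto simp: less_eq_ennreal.rep_eq)
      qed
    qed
  qed
  define c where "c = C\<^sub>S"
  have c: "0 < c" unfolding c_def by (rule C\<^sub>S_pos)
  have int: "integrable M f" if "f \<in> KS_1_1 M" for f using that by (simp add: KS_1_1_def)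
  \<comment> \<open>Both comparisons are kept for every open \<open>U\<close>, because the outer
    extensions take infima over all open supersets.\<close>
  have lower: "total_variation M f U \<le> ennreal c * G f U" if "f \<in> KS_1_1 M" "open U" for f U
    unfolding c_def by (rule total_variation_le_G[OF int[OF that(1)] that(2)])
  have upper: "G f U \<le> ennreal C\<^sub>E * total_variation M f U" if "f \<in> KS_1_1 M" "open U" for f U
    by (rule G_le_total_variation[OF int[OF that(1)] that(2)])
  \<comment> \<open>The lower constant is the reciprocal of the smoothing constant; the upper one is
    that of the Poincare estimate.\<close>
  have "ereal (1 / c) * enn2ereal (total_variation M f U) \<le> \<Gamma>\<^sub>1 f U \<and>
            \<Gamma>\<^sub>1 f U \<le> ereal C\<^sub>E * enn2ereal (total_variation M f U)" if f: "f \<in> KS_1_1 M" and U: "open U" for f U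
  proof
    have "ennreal (1 / c) * total_variation M f U \<le> ennreal (1 / c) * (ennreal c * G f U)"
      by (intro mult_left_mono lower f U) simp
    also have "\<dots> = G f U" using c by (simp add: mult.assoc[symmetric] ennreal_mult[symmetric])
    finally have "enn2ereal (ennreal (1 / c) * total_variation M f U) \<le> enn2ereal (G f U)"
      by (simp add: less_eq_ennreal.rep_eq)
    then show "ereal (1 / c) * enn2ereal (total_variation M f U) \<le> \<Gamma>\<^sub>1 f U"
      using c G[OF int[OF f] U] by (simp add: times_ennreal.rep_eq)
    have "enn2ereal (G f U) \<le> enn2ereal (ennreal C\<^sub>E * total_variation M f U)"
      using upper[OF f U] by (simp add: less_eq_ennreal.rep_eq)
    then show "\<Gamma>\<^sub>1 f U \<le> ereal C\<^sub>E * enn2ereal (total_variation M f U)"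
      using C\<^sub>E_pos G[OF int[OF f] U] by (simp add: times_ennreal.rep_eq)
  qed
  moreover have "is_radon_extension (variation_measure M f) (\<lambda>U. enn2ereal (total_variation M f U)) \<and>
            is_radon_extension (Gamma_measure \<Gamma>\<^sub>1 f) (\<Gamma>\<^sub>1 f) \<and>
            finite_measure (Gamma_measure \<Gamma>\<^sub>1 f) \<and>
            absolutely_continuous (variation_measure M f) (Gamma_measure \<Gamma>\<^sub>1 f) \<and>
            absolutely_continuous (Gamma_measure \<Gamma>\<^sub>1 f) (variation_measure M f) \<and>
            bounded_RN_deriv (variation_measure M f) (Gamma_measure \<Gamma>\<^sub>1 f) \<and>
            bounded_RN_deriv (Gamma_measure \<Gamma>\<^sub>1 f) (variation_measure M f)" if f: "f \<in> KS_1_1 M" for f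
  proof -
    note oV = open_set_function_variation[OF f] and oG = open_set_function_G[OF f]
    have GM: "Gamma_measure \<Gamma>\<^sub>1 f = outer_extension (G f)" by (simp add: Gamma_measure_def G_def[abs_def])
    show ?thesis
      unfolding GM variation_measure_def
      by (intro conjI is_radon_extension_outer_extension oV oG G int f open_set_function.finite_outer_extension
          outer_extension_dominated[OF oG oV upper[OF f]] outer_extension_dominated[OF oV oG lower[OF f]]) auto
  qed
  moreover have "0 < 1 / c" using c by simp
  ultimately show ?thesis using C\<^sub>E_pos by blast
qed

end
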